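(* Let $\mathcal{M}=\{M_1,\dots,M_N\}$ be a set of real $d\times d$ matrices, let $\mathbb{P}=[p_{ij}]$ be an $N\times N$ transition probability matrix, and let $\Sigma_A$ be the associated Markovian switched system. Assume that either $p=2$, or $p=1$ and $\mathcal{M}$ leaves a proper cone $K\subset\mathbb{R}^d$ invariant. Then the following conditions are equivalent: (i) $\rho_{p,A}<1$ for every $\sigma_0\in\{1,\dots,N\}$; (ii) $\Sigma_A$ is $p$th mean stable; (iii) $\Sigma_A$ is $p$th moment stable; (iv) $\rho(T_p)<1$, where $T_p$ is the $Nd^p\times Nd^p$ matrix $$T_p=(\mathbb{P}^\top\otimes I_{d^p})\operatorname{diag}(M_1^{\otimes p},\dots,M_N^{\otimes p}).$$
   Context: $\{\sigma_k\}_{k=0}^\infty$ is a time-homogeneous Markov chain on $\{1,\dots,N\}$ with transition probabilities $p_{ij}=P(\sigma_{k+1}=j\mid\sigma_k=i)$ and constant (deterministic) initial state $\sigma_0\in\{1,\dots,N\}$. Put $A_k=M_{\sigma_k}$ and $A=\{A_k\}_{k=0}^\infty$. $\Sigma_A$ is the system $x(k+1)=A_kx(k)$, $k=0,1,\dots$, and $x(\cdot;x_0,\sigma_0)$ denotes its trajectory with $x(0)=x_0\in\mathbb{R}^d$ and initial Markov state $\sigma_0$. Norms $\|\cdot\|$ are arbitrary fixed norms on the relevant finite-dimensional spaces. $\Sigma_A$ is $p$th mean stable if there exist $C>0$ and $\beta>0$ such that $E[\|x(k;x_0,\sigma_0)\|^p]\le Ce^{-\beta k}\|x_0\|^p$ for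 all $k\ge0$, all $x_0\in\mathbb{R}^d$ and all $\sigma_0\in\{1,\dots,N\}$. $\Sigma_A$ is $p$th moment stable if there exist $C>0$ and $\beta>0$ such that $\|E[x(k;x_0,\sigma_0)^{\otimes p}]\|\le Ce^{-\beta k}\|x_0\|^p$ for all $k\ge0$, all $x_0\in\mathbb{R}^d$ and all $\sigma_0\in\{1,\dots,N\}$. The $L^p$-norm joint spectral radius of $A$ (which depends on $\sigma_0$) is $\rho_{p,A}:=\lim_{k\to\infty}(E[\|A_k\cdots A_1\|^p])^{1/(pk)}$. $\otimes$ is the Kronecker product, $(\cdot)^{\otimes p}$ the $p$-fold Kronecker power, $I_{d^p}$ the identity matrix of size $d^p$, $\operatorname{diag}(\cdot)$ the block-diagonal matrix, and $\rho(\cdot)$ the spectral radius. A subset $K\subset\mathbb{R}^d$ is a cone if it is closed under multiplication by nonnegative scalars; it is proper if it is closed, convex, has nonempty interior, and is pointed ($x,-x\in K$ implies $x=0$). $\mathcal{M}$ leaves $K$ invariant if $MK\subset K$ for every $M\in\mathcal{M}$. *)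

theory Defs
  imports "HOL-Probability.Probability"
    "HOL-Analysis.Abstract_Euclidean_Space"
    "Jordan_Normal_Form.Spectral_Radius"
begin

unbundle no vec_syntax
no_notation Inner_Product.inner (infix "\<bullet>" 70)

section \<open>Kronecker products\<close>

definition kron_vec :: "'a::semiring_1 vec \<Rightarrow> 'a vec \<Rightarrow> 'a vec" where
  "kron_vec x y = vec (dim_vec x * dim_vec y)
     (\<lambda>i. x $ (i div dim_vec y) * y $ (i mod dim_vec y))"

definition kron_mat :: "'a::semiring_1 mat \<Rightarrow> 'a mat \<Rightarrow> 'a mat" where
  "kron_mat A B = mat (dim_row A * dim_row B) (dim_col A * dim_col B)
     (\<lambda>(i, j). A $$ (i div dim_row B, j div dim_col B) * B $$ (i mod dim_row B, j mod dim_col B))"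

primrec kron_pow_vec :: "'a::semiring_1 vec \<Rightarrow> nat \<Rightarrow> 'a vec" where
  "kron_pow_vec x 0 = vec 1 (\<lambda>_. 1)"
| "kron_pow_vec x (Suc p) = kron_vec x (kron_pow_vec x p)"

primrec kron_pow_mat :: "'a::semiring_1 mat \<Rightarrow> nat \<Rightarrow> 'a mat" where
  "kron_pow_mat A 0 = 1\<^sub>m 1"
| "kron_pow_mat A (Suc p) = kron_mat A (kron_pow_mat A p)"


section \<open>Norms\<close>

text \<open>Vectors and matrices of a given size form carriers of types that are not normed spaces, so
  an arbitrary norm is a function satisfying the norm axioms on the carrier.  Matrix norms need
  not be submultiplicative.\<close>

definition is_vec_norm :: "nat \<Rightarrow> (real vec \<Rightarrow> real) \<Rightarrow> bool" where
  "is_vec_norm n nrm \<longleftrightarrow>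
     (\<forall>x \<in> carrier_vec n. 0 \<le> nrm x) \<and>
     (\<forall>x \<in> carrier_vec n. nrm x = 0 \<longleftrightarrow> x = 0\<^sub>v n) \<and>
     (\<forall>x \<in> carrier_vec n. \<forall>c. nrm (c \<cdot>\<^sub>v x) = \<bar>c\<bar> * nrm x) \<and>
     (\<forall>x \<in> carrier_vec n. \<forall>y \<in> carrier_vec n. nrm (x + y) \<le> nrm x + nrm y)"

definition is_mat_norm :: "nat \<Rightarrow> (real mat \<Rightarrow> real) \<Rightarrow> bool" where
  "is_mat_norm n nrm \<longleftrightarrow>
     (\<forall>A \<in> carrier_mat n n. 0 \<le> nrm A) \<and>
     (\<forall>A \<in> carrier_mat n n. nrm A = 0 \<longleftrightarrow> A = 0\<^sub>m n n) \<and>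
     (\<forall>A \<in> carrier_mat n n. \<forall>c. nrm (c \<cdot>\<^sub>m A) = \<bar>c\<bar> * nrm A) \<and>
     (\<forall>A \<in> carrier_mat n n. \<forall>B \<in> carrier_mat n n. nrm (A + B) \<le> nrm A + nrm B)"


section \<open>Proper cones\<close>

text \<open>\<open>coords\<close> identifies \<open>carrier_vec d\<close> with the points of \<open>Euclidean_space d\<close>, which supplies
  the topology of \<open>d\<close>-dimensional real space.\<close>

definition coords :: "real vec \<Rightarrow> nat \<Rightarrow> real" where
  "coords v = (\<lambda>i. if i < dim_vec v then v $ i else 0)"

definition is_cone :: "nat \<Rightarrow> real vec set \<Rightarrow> bool" where
  "is_cone d K \<longleftrightarrow> K \<subseteq> carrier_vec d \<and> (\<forall>x \<in> K. \<forall>c \<ge> 0. c \<cdot>\<^sub>v x \<in> K)"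

definition proper_cone :: "nat \<Rightarrow> real vec set \<Rightarrow> bool" where
  "proper_cone d K \<longleftrightarrow>
     is_cone d K \<and>
     closedin (Euclidean_space d) (coords ` K) \<and>
     (\<forall>x \<in> K. \<forall>y \<in> K. \<forall>t \<in> {0..1}. (1 - t) \<cdot>\<^sub>v x + t \<cdot>\<^sub>v y \<in> K) \<and>
     Euclidean_space d interior_of (coords ` K) \<noteq> {} \<and>
     (\<forall>x. x \<in> K \<and> - x \<in> K \<longrightarrow> x = 0\<^sub>v d)"

definition leaves_invariant :: "real mat set \<Rightarrow> real vec set \<Rightarrow> bool" where
  "leaves_invariant MM K \<longleftrightarrow> (\<forall>M \<in> MM. \<forall>x \<in> K. M *\<^sub>v x \<in> K)"


section \<open>Markov chains\<close>

text \<open>The states are \<open>0, \<dots>, N - 1\<close>, so that they index rows and columns of the transition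
  matrix.\<close>

definition transition_matrix :: "nat \<Rightarrow> real mat \<Rightarrow> bool" where
  "transition_matrix N P \<longleftrightarrow>
     P \<in> carrier_mat N N \<and>
     (\<forall>i < N. \<forall>j < N. 0 \<le> P $$ (i, j)) \<and>
     (\<forall>i < N. (\<Sum>j < N. P $$ (i, j)) = 1)"

text \<open>Conditional probabilities are only constrained for histories of positive probability.\<close>

definition markov_chain ::
  "nat \<Rightarrow> real mat \<Rightarrow> nat \<Rightarrow> 'w measure \<Rightarrow> (nat \<Rightarrow> 'w \<Rightarrow> nat) \<Rightarrow> bool" where
  "markov_chain N P s \<Omega> \<sigma> \<longleftrightarrow>
     prob_space \<Omega> \<and>
     (\<forall>k. \<sigma> k \<in> measurable \<Omega> (count_space {..<N})) \<and>
     (\<forall>\<omega> \<in> space \<Omega>. \<sigma> 0 \<omega> = s) \<and>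
     (\<forall>k. \<forall>i. \<forall>j < N.
        \<P>(\<omega> in \<Omega>. \<forall>l \<le> k. \<sigma> l \<omega> = i l) > 0 \<longrightarrow>
        \<P>(\<omega> in \<Omega>. \<sigma> (Suc k) \<omega> = j \<bar> \<forall>l \<le> k. \<sigma> l \<omega> = i l) = P $$ (i k, j))"


section \<open>The switched system\<close>

text \<open>In what follows \<open>M\<close> is the family of matrices and \<open>\<sigma>\<close> a single switching process, whereas
  the stability notions take families \<open>\<Omega>\<close> and \<open>\<sigma>\<close> indexed by the initial state \<open>s\<close>.\<close>

primrec trajectory ::
  "(nat \<Rightarrow> real mat) \<Rightarrow> (nat \<Rightarrow> 'w \<Rightarrow> nat) \<Rightarrow> real vec \<Rightarrow> nat \<Rightarrow> 'w \<Rightarrow> real vec" where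
  "trajectory M \<sigma> x0 0 \<omega> = x0"
| "trajectory M \<sigma> x0 (Suc k) \<omega> = M (\<sigma> k \<omega>) *\<^sub>v trajectory M \<sigma> x0 k \<omega>"

text \<open>The product \<open>A\<^sub>k \<cdots> A\<^sub>1\<close>, which does not involve \<open>A\<^sub>0\<close>.\<close>

primrec switched_prod ::
  "nat \<Rightarrow> (nat \<Rightarrow> real mat) \<Rightarrow> (nat \<Rightarrow> 'w \<Rightarrow> nat) \<Rightarrow> nat \<Rightarrow> 'w \<Rightarrow> real mat" where
  "switched_prod d M \<sigma> 0 \<omega> = 1\<^sub>m d"
| "switched_prod d M \<sigma> (Suc k) \<omega> = M (\<sigma> (Suc k) \<omega>) * switched_prod d M \<sigma> k \<omega>"

definition expectation_vec :: "nat \<Rightarrow> 'w measure \<Rightarrow> ('w \<Rightarrow> real vec) \<Rightarrow> real vec" where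
  "expectation_vec n \<Omega> X = vec n (\<lambda>i. LINT \<omega>|\<Omega>. X \<omega> $ i)"

definition mean_stable ::
  "nat \<Rightarrow> (real vec \<Rightarrow> real) \<Rightarrow> nat \<Rightarrow> nat \<Rightarrow> (nat \<Rightarrow> real mat) \<Rightarrow>
   (nat \<Rightarrow> 'w measure) \<Rightarrow> (nat \<Rightarrow> nat \<Rightarrow> 'w \<Rightarrow> nat) \<Rightarrow> bool" where
  "mean_stable p vnorm d N M \<Omega> \<sigma> \<longleftrightarrow>
     (\<exists>C > 0. \<exists>\<beta> > 0. \<forall>k. \<forall>x0 \<in> carrier_vec d. \<forall>s < N.
        (LINT \<omega>|\<Omega> s. vnorm (trajectory M (\<sigma> s) x0 k \<omega>) ^ p)
          \<le> C * exp (- \<beta> * real k) * vnorm x0 ^ p)"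

definition moment_stable ::
  "nat \<Rightarrow> (real vec \<Rightarrow> real) \<Rightarrow> (real vec \<Rightarrow> real) \<Rightarrow> nat \<Rightarrow> nat \<Rightarrow> (nat \<Rightarrow> real mat) \<Rightarrow>
   (nat \<Rightarrow> 'w measure) \<Rightarrow> (nat \<Rightarrow> nat \<Rightarrow> 'w \<Rightarrow> nat) \<Rightarrow> bool" where
  "moment_stable p vnorm tnorm d N M \<Omega> \<sigma> \<longleftrightarrow>
     (\<exists>C > 0. \<exists>\<beta> > 0. \<forall>k. \<forall>x0 \<in> carrier_vec d. \<forall>s < N.
        tnorm (expectation_vec (d ^ p) (\<Omega> s) (\<lambda>\<omega>. kron_pow_vec (trajectory M (\<sigma> s) x0 k \<omega>) p))
          \<le> C * exp (- \<beta> * real k) * vnorm x0 ^ p)"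

definition Lp_joint_spectral_radius ::
  "nat \<Rightarrow> (real mat \<Rightarrow> real) \<Rightarrow> nat \<Rightarrow> (nat \<Rightarrow> real mat) \<Rightarrow>
   'w measure \<Rightarrow> (nat \<Rightarrow> 'w \<Rightarrow> nat) \<Rightarrow> real" where
  "Lp_joint_spectral_radius p mnorm d M \<Omega> \<sigma> =
     lim (\<lambda>k. (LINT \<omega>|\<Omega>. mnorm (switched_prod d M \<sigma> k \<omega>) ^ p) powr (1 / (real p * real k)))"

definition transfer_matrix :: "nat \<Rightarrow> nat \<Rightarrow> nat \<Rightarrow> real mat \<Rightarrow> (nat \<Rightarrow> real mat) \<Rightarrow> real mat" where
  "transfer_matrix p d N P M =
     kron_mat (transpose_mat P) (1\<^sub>m (d ^ p)) *
     diag_block_mat (map (\<lambda>i. kron_pow_mat (M i) p) [0..<N])"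

definition real_spectral_radius :: "real mat \<Rightarrow> real" where
  "real_spectral_radius A = spectral_radius (map_mat complex_of_real A)"

end

theory Submission
  imports Defs
begin

text \<open>Let \<open>X\<^sub>w\<close> be the product of the matrices along a word \<open>w\<close> of states, and let \<open>growth k s\<close> be the
expectation of \<open>\<parallel>X\<^sub>w\<parallel>\<^sup>p\<close> for the random word of the first \<open>k\<close> states of the chain started in \<open>s\<close>, where
the norm is the sum of the absolute values of the entries.  Each of the four conditions is shown
to be equivalent to exponential decay of \<open>growth\<close>, and this passes through finite sums over words:
\<open>markov_integral\<close> turns every integral over the probability space into such a sum.

Mean stability is decay of \<open>growth\<close> because the columns of a matrix determine its norm.  Decay of
\<open>growth\<close> bounds all tensor moments, since the entries of \<open>X\<^bsup>\<otimes>p\<^esup>\<close> are at most \<open>\<parallel>X\<parallel>\<^sup>p\<close>.  The converse is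
the heart of the matter, because a moment is linear in \<open>X\<^bsup>\<otimes>p\<^esup>\<close> and could be small through
cancellation.  What excludes this is a linear functional \<open>F\<close> on the tensors and finitely many
vectors \<open>v\<close> such that \<open>\<parallel>X\<parallel>\<^sup>p \<le> C \<Sum>\<^sub>v F((X v)\<^bsup>\<otimes>p\<^esup>)\<close> for all products \<open>X\<close>.  For \<open>p = 2\<close> the functional is the
trace and the \<open>v\<close> are the unit vectors (\<open>trace_dominates_entry_norm\<close>); for \<open>p = 1\<close> it is a functional
that is strictly positive on the invariant cone, and the \<open>v\<close> are an interior point of the cone and
small perturbations of it in the coordinate directions (\<open>cone_functional_dominates_entry_norm\<close>).
Integrating the inequality gives \<open>growth_decay_if_moments_decay\<close>.

For the transfer matrix \<open>T\<close>, the moments restricted to the events that the current state is \<open>j\<close> form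
a block vector which \<open>T\<close> advances by one step (\<open>T_state_moment\<close>).  So the entries of the powers of \<open>T\<close>
are restricted moments, and the spectral radius is less than one if and only if the powers decay.

The joint spectral radius leaves out the matrix of the initial state, so conditioning on the first
transition expresses it by the averages \<open>\<Sum>\<^sub>j P\<^sub>s\<^sub>j growth k j\<close>.  That its defining limit exists is part of
the claim.  By the domination inequality these averages are comparable to the norms of an orbit
\<open>T\<^sup>k u\<close>, and the norms of an orbit of a matrix are submultiplicative up to a constant
(\<open>linear_orbit_submultiplicative\<close>), so that Fekete's lemma applies.\<close>

section \<open>Matrix arithmetic in coordinates\<close>

lemma block_index_less: "i < n \<Longrightarrow> j < m \<Longrightarrow> i * m + j < n * (m::nat)"
proof -
  assume "i < n" "j < m"
  then have "i * m + j < Suc i * m" by simp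
  also have "\<dots> \<le> n * m" using \<open>i < n\<close> by (intro mult_le_mono1) simp
  finally show ?thesis .
qed

lemma block_index_div_mod:
  assumes "r < n * (m::nat)"
  shows "r div m < n" "r mod m < m" "r div m * m + r mod m = r"
proof -
  have "0 < m" using assms by (cases m) auto
  then show "r div m < n" "r mod m < m" using assms by (auto simp: less_mult_imp_div_less)
qed simp

lemma sum_div_mod:
  "(\<Sum>c<n * m. f (c div m) (c mod m)) = (\<Sum>i<n. \<Sum>j<m. f i j)" for n m :: nat
  unfolding sum.cartesian_product
  by (rule sum.reindex_bij_witness[of _ "\<lambda>(i, j). i * m + j" "\<lambda>c. (c div m, c mod m)"])
    (auto simp: block_index_less block_index_div_mod)

lemma mult_mat_index:
  assumes "A \<in> carrier_mat n m" "B \<in> carrier_mat m r" "i < n" "j < r"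
  shows "(A * B) $$ (i, j) = (\<Sum>k<m. A $$ (i, k) * B $$ (k, j))"
  using assms by (simp add: scalar_prod_def lessThan_atLeast0)

lemma mult_mat_vec_index:
  assumes "A \<in> carrier_mat n m" "x \<in> carrier_vec m" "i < n"
  shows "(A *\<^sub>v x) $ i = (\<Sum>k<m. A $$ (i, k) * x $ k)"
  using assms by (simp add: scalar_prod_def lessThan_atLeast0)

lemma sum_blocks:
  fixes f :: "nat \<Rightarrow> 'a::comm_monoid_add"
  shows "(\<Sum>c<n * m. f c) = (\<Sum>i<n. \<Sum>j<m. f (i * m + j))"
  using sum_div_mod[of "\<lambda>i j. f (i * m + j)" m n] by simp

lemma sum_swap_pairs:
  "(\<Sum>a\<in>A. \<Sum>b\<in>B. \<Sum>c\<in>C. \<Sum>e\<in>E. t a b c e) = (\<Sum>c\<in>C. \<Sum>e\<in>E. \<Sum>a\<in>A. \<Sum>b\<in>B. t a b c e)"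
proof -
  have "(\<Sum>a\<in>A. \<Sum>b\<in>B. \<Sum>c\<in>C. \<Sum>e\<in>E. t a b c e)
      = (\<Sum>x\<in>A \<times> B. \<Sum>y\<in>C \<times> E. t (fst x) (snd x) (fst y) (snd y))"
    by (simp add: sum.cartesian_product')
  also have "\<dots> = (\<Sum>y\<in>C \<times> E. \<Sum>x\<in>A \<times> B. t (fst x) (snd x) (fst y) (snd y))"
    by (rule sum.swap)
  finally show ?thesis by (simp add: sum.cartesian_product')
qed

text \<open>A submultiplicative norm in which Kronecker powers are easy to bound.  Arbitrary norms are compared
with it.\<close>

definition entry_norm :: "real mat \<Rightarrow> real" where
  "entry_norm A = (\<Sum>i<dim_row A. \<Sum>j<dim_col A. \<bar>A $$ (i, j)\<bar>)"

definition coord_norm :: "real vec \<Rightarrow> real" where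
  "coord_norm x = (\<Sum>i<dim_vec x. \<bar>x $ i\<bar>)"

lemma entry_norm_nonneg: "0 \<le> entry_norm A"
  by (auto simp: entry_norm_def intro!: sum_nonneg)

lemma coord_norm_nonneg: "0 \<le> coord_norm x"
  by (auto simp: coord_norm_def intro!: sum_nonneg)

lemma entry_le_entry_norm:
  assumes "i < dim_row A" "j < dim_col A"
  shows "\<bar>A $$ (i, j)\<bar> \<le> entry_norm A"
proof -
  have "\<bar>A $$ (i, j)\<bar> \<le> (\<Sum>j<dim_col A. \<bar>A $$ (i, j)\<bar>)"
    using assms by (intro member_le_sum) auto
  also have "\<dots> \<le> entry_norm A" unfolding entry_norm_def
    using assms by (intro member_le_sum[of i _ "\<lambda>i. \<Sum>j<dim_col A. \<bar>A $$ (i, j)\<bar>"]) (auto intro: sum_nonneg)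
  finally show ?thesis .
qed

lemma coord_le_coord_norm: "i < dim_vec x \<Longrightarrow> \<bar>x $ i\<bar> \<le> coord_norm x"
  unfolding coord_norm_def by (intro member_le_sum) auto

lemma entry_norm_mult:
  assumes A: "A \<in> carrier_mat n m" and B: "B \<in> carrier_mat m r"
  shows "entry_norm (A * B) \<le> entry_norm A * entry_norm B"
proof -
  have "entry_norm (A * B) = (\<Sum>i<n. \<Sum>j<r. \<bar>\<Sum>k<m. A $$ (i, k) * B $$ (k, j)\<bar>)"
    unfolding entry_norm_def using A B mult_mat_index[OF A B] by (intro sum.cong) auto
  also have "\<dots> \<le> (\<Sum>i<n. \<Sum>j<r. \<Sum>k<m. \<bar>A $$ (i, k)\<bar> * \<bar>B $$ (k, j)\<bar>)"
    by (intro sum_mono order_trans[OF sum_abs]) (simp add: abs_mult)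
  also have "\<dots> = (\<Sum>i<n. \<Sum>k<m. \<bar>A $$ (i, k)\<bar> * (\<Sum>j<r. \<bar>B $$ (k, j)\<bar>))"
    unfolding sum_distrib_left by (intro sum.cong refl sum.swap)
  also have "\<dots> \<le> (\<Sum>i<n. \<Sum>k<m. \<bar>A $$ (i, k)\<bar> * entry_norm B)"
  proof (intro sum_mono mult_left_mono)
    fix k assume "k \<in> {..<m}"
    then show "(\<Sum>j<r. \<bar>B $$ (k, j)\<bar>) \<le> entry_norm B"
      unfolding entry_norm_def using B
      by (intro order_trans[OF _ member_le_sum[of k _ "\<lambda>i. \<Sum>j<dim_col B. \<bar>B $$ (i, j)\<bar>"]]) (auto intro: sum_nonneg)
  qed auto
  also have "\<dots> = entry_norm A * entry_norm B"
    using A by (simp add: entry_norm_def sum_distrib_right)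
  finally show ?thesis .
qed

lemma coord_norm_mult_mat_vec:
  assumes A: "A \<in> carrier_mat n m" and x: "x \<in> carrier_vec m"
  shows "coord_norm (A *\<^sub>v x) \<le> entry_norm A * coord_norm x"
proof -
  have "coord_norm (A *\<^sub>v x) = (\<Sum>i<n. \<bar>\<Sum>k<m. A $$ (i, k) * x $ k\<bar>)"
    unfolding coord_norm_def using A mult_mat_vec_index[OF A x] by (intro sum.cong) auto
  also have "\<dots> \<le> (\<Sum>i<n. \<Sum>k<m. \<bar>A $$ (i, k)\<bar> * \<bar>x $ k\<bar>)"
    by (intro sum_mono order_trans[OF sum_abs]) (simp add: abs_mult)
  also have "\<dots> \<le> (\<Sum>i<n. \<Sum>k<m. \<bar>A $$ (i, k)\<bar> * coord_norm x)"
    using x by (intro sum_mono mult_left_mono coord_le_coord_norm) auto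
  also have "\<dots> = entry_norm A * coord_norm x"
    using A by (simp add: entry_norm_def sum_distrib_right)
  finally show ?thesis .
qed

lemma mult_unit_vec_index:
  fixes X :: "real mat"
  assumes X: "X \<in> carrier_mat n m" and "i < n" "b < m"
  shows "(X *\<^sub>v unit_vec m b) $ i = X $$ (i, b)"
proof -
  have "(X *\<^sub>v unit_vec m b) $ i = (\<Sum>k<m. X $$ (i, k) * unit_vec m b $ k)"
    using assms by (intro mult_mat_vec_index) auto
  also have "\<dots> = (\<Sum>k<m. if k = b then X $$ (i, k) else 0)"
    using assms by (intro sum.cong) auto
  finally show ?thesis using assms by simp
qed

lemma entry_norm_columns:
  assumes X: "X \<in> carrier_mat n m"
  shows "entry_norm X = (\<Sum>b<m. coord_norm (X *\<^sub>v unit_vec m b))"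
proof -
  have "entry_norm X = (\<Sum>b<m. \<Sum>i<n. \<bar>X $$ (i, b)\<bar>)"
    unfolding entry_norm_def using X by (subst sum.swap) simp
  also have "\<dots> = (\<Sum>b<m. coord_norm (X *\<^sub>v unit_vec m b))"
    unfolding coord_norm_def using X mult_unit_vec_index[OF X] by (intro sum.cong) auto
  finally show ?thesis .
qed

lemma power_sum_le:
  fixes f :: "'i \<Rightarrow> real"
  assumes "finite I" "I \<noteq> {}" "\<And>i. i \<in> I \<Longrightarrow> 0 \<le> f i"
  shows "(\<Sum>i\<in>I. f i) ^ p \<le> real (card I) ^ p * (\<Sum>i\<in>I. f i ^ p)"
proof -
  obtain m where m: "m \<in> I" "\<And>i. i \<in> I \<Longrightarrow> f i \<le> f m"
    using finite_imageI[OF assms(1), of f] Max_in[of "f ` I"] Max_ge[of "f ` I"] assms(2)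
    by (metis (no_types, lifting) image_eqI image_iff image_is_empty)
  have "(\<Sum>i\<in>I. f i) ^ p \<le> (real (card I) * f m) ^ p"
    using assms m by (intro power_mono sum_bounded_above sum_nonneg) auto
  also have "\<dots> = real (card I) ^ p * f m ^ p" by (rule power_mult_distrib)
  also have "\<dots> \<le> real (card I) ^ p * (\<Sum>i\<in>I. f i ^ p)"
    using assms m by (intro mult_left_mono member_le_sum[of m I "\<lambda>i. f i ^ p"]) auto
  finally show ?thesis .
qed

section \<open>Kronecker powers\<close>

lemma kron_mat_carrier:
  "A \<in> carrier_mat n m \<Longrightarrow> B \<in> carrier_mat r q \<Longrightarrow> kron_mat A B \<in> carrier_mat (n * r) (m * q)"
  by (simp add: kron_mat_def)

text \<open>The mixed product property: the index set of the Kronecker product is a product of index sets, and the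
sum over it factors.\<close>

lemma kron_mat_mult:
  fixes A :: "'a::comm_semiring_1 mat"
  assumes A: "A \<in> carrier_mat n k" and B: "B \<in> carrier_mat m l"
    and C: "C \<in> carrier_mat k r" and D: "D \<in> carrier_mat l q"
  shows "kron_mat A B * kron_mat C D = kron_mat (A * C) (B * D)"
proof (rule eq_matI)
  fix i j assume "i < dim_row (kron_mat (A * C) (B * D))" "j < dim_col (kron_mat (A * C) (B * D))"
  then have ij: "i < n * m" "j < r * q" using A B C D by (auto simp: kron_mat_def)
  note i = block_index_div_mod[OF ij(1)] and j = block_index_div_mod[OF ij(2)]
  have c: "c div l < k" "c mod l < l" if "c < k * l" for c using block_index_div_mod[OF that] by auto
  have "(kron_mat A B * kron_mat C D) $$ (i, j) = (\<Sum>c<k * l. kron_mat A B $$ (i, c) * kron_mat C D $$ (c, j))"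
    using ij by (intro mult_mat_index[OF kron_mat_carrier[OF A B] kron_mat_carrier[OF C D]])
  also have "\<dots> = (\<Sum>c<k * l. (A $$ (i div m, c div l) * B $$ (i mod m, c mod l)) *
      (C $$ (c div l, j div q) * D $$ (c mod l, j mod q)))"
    using A B C D ij by (intro sum.cong refl) (auto simp: kron_mat_def)
  also have "\<dots> = (\<Sum>a<k. \<Sum>b<l. (A $$ (i div m, a) * B $$ (i mod m, b)) *
      (C $$ (a, j div q) * D $$ (b, j mod q)))"
    by (rule sum_div_mod)
  also have "\<dots> = (\<Sum>a<k. A $$ (i div m, a) * C $$ (a, j div q)) * (\<Sum>b<l. B $$ (i mod m, b) * D $$ (b, j mod q))"
    unfolding sum_product by (intro sum.cong refl) (simp add: mult_ac)
  also have "\<dots> = (A * C) $$ (i div m, j div q) * (B * D) $$ (i mod m, j mod q)"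
    using mult_mat_index[OF A C i(1) j(1)] mult_mat_index[OF B D i(2) j(2)] by simp
  also have "\<dots> = kron_mat (A * C) (B * D) $$ (i, j)"
    using A B C D ij by (simp add: kron_mat_def)
  finally show "(kron_mat A B * kron_mat C D) $$ (i, j) = kron_mat (A * C) (B * D) $$ (i, j)" .
qed (use A B C D in \<open>auto simp: kron_mat_def\<close>)

lemma kron_mat_mult_vec:
  fixes A :: "'a::comm_semiring_1 mat"
  assumes A: "A \<in> carrier_mat n k" and B: "B \<in> carrier_mat m l"
    and x: "x \<in> carrier_vec k" and y: "y \<in> carrier_vec l"
  shows "kron_mat A B *\<^sub>v kron_vec x y = kron_vec (A *\<^sub>v x) (B *\<^sub>v y)"
proof (rule eq_vecI)
  fix i assume "i < dim_vec (kron_vec (A *\<^sub>v x) (B *\<^sub>v y))"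
  then have i0: "i < n * m" using A B by (auto simp: kron_vec_def)
  note i = block_index_div_mod[OF i0]
  have xy: "kron_vec x y \<in> carrier_vec (k * l)" using x y by (simp add: kron_vec_def)
  have "(kron_mat A B *\<^sub>v kron_vec x y) $ i = (\<Sum>c<k * l. kron_mat A B $$ (i, c) * kron_vec x y $ c)"
    using i0 by (intro mult_mat_vec_index[OF kron_mat_carrier[OF A B] xy])
  also have "\<dots> = (\<Sum>c<k * l. (A $$ (i div m, c div l) * B $$ (i mod m, c mod l)) *
      (x $ (c div l) * y $ (c mod l)))"
    using A B x y i0 by (intro sum.cong refl) (auto simp: kron_mat_def kron_vec_def)
  also have "\<dots> = (\<Sum>a<k. \<Sum>b<l. (A $$ (i div m, a) * B $$ (i mod m, b)) * (x $ a * y $ b))"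
    by (rule sum_div_mod)
  also have "\<dots> = (\<Sum>a<k. A $$ (i div m, a) * x $ a) * (\<Sum>b<l. B $$ (i mod m, b) * y $ b)"
    unfolding sum_product by (intro sum.cong refl) (simp add: mult_ac)
  also have "\<dots> = (A *\<^sub>v x) $ (i div m) * (B *\<^sub>v y) $ (i mod m)"
    using mult_mat_vec_index[OF A x i(1)] mult_mat_vec_index[OF B y i(2)] by simp
  also have "\<dots> = kron_vec (A *\<^sub>v x) (B *\<^sub>v y) $ i"
    using A B i0 by (simp add: kron_vec_def)
  finally show "(kron_mat A B *\<^sub>v kron_vec x y) $ i = kron_vec (A *\<^sub>v x) (B *\<^sub>v y) $ i" .
qed (use A B in \<open>auto simp: kron_vec_def kron_mat_def\<close>)

lemma kron_mat_one: "kron_mat (1\<^sub>m n) (1\<^sub>m m) = (1\<^sub>m (n * m) :: 'a::comm_semiring_1 mat)"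
proof (rule eq_matI)
  fix i j assume "i < dim_row (1\<^sub>m (n * m) :: 'a mat)" "j < dim_col (1\<^sub>m (n * m) :: 'a mat)"
  then have ij: "i < n * m" "j < n * m" by auto
  have "i = j" if "i div m = j div m" "i mod m = j mod m" using that by (metis div_mod_decomp)
  then show "kron_mat (1\<^sub>m n) (1\<^sub>m m) $$ (i, j) = (1\<^sub>m (n * m) :: 'a mat) $$ (i, j)"
    using ij block_index_div_mod[OF ij(1)] block_index_div_mod[OF ij(2)] by (auto simp: kron_mat_def)
qed (auto simp: kron_mat_def)

lemma kron_pow_mat_carrier: "A \<in> carrier_mat n m \<Longrightarrow> kron_pow_mat A p \<in> carrier_mat (n ^ p) (m ^ p)"
  by (induction p) (auto intro: kron_mat_carrier)

lemma kron_pow_vec_carrier: "x \<in> carrier_vec n \<Longrightarrow> kron_pow_vec x p \<in> carrier_vec (n ^ p)"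
  by (induction p) (auto simp: kron_vec_def)

lemma kron_pow_mat_mult:
  fixes A :: "'a::comm_semiring_1 mat"
  assumes "A \<in> carrier_mat n k" "B \<in> carrier_mat k m"
  shows "kron_pow_mat (A * B) p = kron_pow_mat A p * kron_pow_mat B p"
proof (induction p)
  case (Suc p)
  then show ?case
    using kron_mat_mult[OF assms(1) kron_pow_mat_carrier[OF assms(1), of p] assms(2) kron_pow_mat_carrier[OF assms(2), of p]]
    by simp
qed simp

lemma kron_pow_mat_one: "kron_pow_mat (1\<^sub>m n) p = (1\<^sub>m (n ^ p) :: 'a::comm_semiring_1 mat)"
  by (induction p) (auto simp: kron_mat_one)

lemma kron_pow_mult_vec:
  fixes A :: "'a::comm_semiring_1 mat"
  assumes "A \<in> carrier_mat n m" "x \<in> carrier_vec m"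
  shows "kron_pow_mat A p *\<^sub>v kron_pow_vec x p = kron_pow_vec (A *\<^sub>v x) p"
proof (induction p)
  case (Suc p)
  then show ?case
    using kron_mat_mult_vec[OF assms(1) kron_pow_mat_carrier[OF assms(1), of p] assms(2) kron_pow_vec_carrier[OF assms(2), of p]]
    by simp
qed simp

lemma kron_pow_vec_1: "kron_pow_vec (x :: 'a::comm_semiring_1 vec) 1 = x"
  by (rule eq_vecI) (auto simp: kron_vec_def)

lemma kron_pow_vec_2_index:
  fixes y :: "'a::comm_semiring_1 vec"
  assumes "y \<in> carrier_vec d" "i < d" "j < d"
  shows "kron_pow_vec y 2 $ (i * d + j) = y $ i * y $ j"
proof -
  have "kron_pow_vec y 2 = kron_vec y y" using kron_pow_vec_1[of y] by (simp add: numeral_2_eq_2)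
  moreover have "(i * d + j) div d = i" "(i * d + j) mod d = j" using assms by auto
  ultimately show ?thesis using assms block_index_less[OF assms(2,3)] by (simp add: kron_vec_def)
qed

lemma kron_pow_mat_entry_le:
  assumes A: "A \<in> carrier_mat n m" and "i < n ^ p" "j < m ^ p"
  shows "\<bar>kron_pow_mat A p $$ (i, j)\<bar> \<le> entry_norm A ^ p"
  using assms(2,3)
proof (induction p arbitrary: i j)
  case (Suc p)
  note i = block_index_div_mod[of i n "n ^ p"] and j = block_index_div_mod[of j m "m ^ p"]
  have "kron_pow_mat A (Suc p) $$ (i, j)
      = A $$ (i div n ^ p, j div m ^ p) * kron_pow_mat A p $$ (i mod n ^ p, j mod m ^ p)"
    using Suc.prems A kron_pow_mat_carrier[OF A, of p] by (simp add: kron_mat_def)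
  moreover have "\<bar>A $$ (i div n ^ p, j div m ^ p)\<bar> \<le> entry_norm A"
    using Suc.prems i j A by (intro entry_le_entry_norm) auto
  moreover have "\<bar>kron_pow_mat A p $$ (i mod n ^ p, j mod m ^ p)\<bar> \<le> entry_norm A ^ p"
    using Suc.prems i j by (intro Suc.IH) auto
  ultimately show ?case by (simp add: abs_mult mult_mono entry_norm_nonneg)
qed simp

lemma kron_pow_vec_entry_le:
  assumes "x \<in> carrier_vec n" "i < n ^ p"
  shows "\<bar>kron_pow_vec x p $ i\<bar> \<le> coord_norm x ^ p"
  using assms(2)
proof (induction p arbitrary: i)
  case (Suc p)
  note i = block_index_div_mod[of i n "n ^ p"]
  have "kron_pow_vec x (Suc p) $ i = x $ (i div n ^ p) * kron_pow_vec x p $ (i mod n ^ p)"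
    using Suc.prems assms(1) kron_pow_vec_carrier[OF assms(1), of p] by (simp add: kron_vec_def)
  moreover have "\<bar>x $ (i div n ^ p)\<bar> \<le> coord_norm x"
    using Suc.prems i assms(1) by (intro coord_le_coord_norm) auto
  moreover have "\<bar>kron_pow_vec x p $ (i mod n ^ p)\<bar> \<le> coord_norm x ^ p"
    using Suc.prems i by (intro Suc.IH) auto
  ultimately show ?case by (simp add: abs_mult mult_mono coord_norm_nonneg)
qed simp

section \<open>Equivalence of norms\<close>

text \<open>Tychonoff's theorem.  Compactness arguments for vectors are carried out in the product topology on
functions, because the dimension is a variable and not a type.\<close>

lemma compact_coordinatewise:
  fixes S :: "'i \<Rightarrow> real set"
  assumes "\<And>i. compact (S i)"
  shows "compact {f. \<forall>i. f i \<in> S i}"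
proof -
  have "compactin (powertop_real UNIV) (PiE UNIV S)"
    using assms by (simp add: compactin_PiE)
  moreover have "PiE UNIV S = {f. \<forall>i. f i \<in> S i}"
    by (auto simp: PiE_def Pi_def)
  ultimately show ?thesis
    by (simp add: euclidean_product_topology)
qed

lemma continuous_on_coordinate [continuous_intros]: "continuous_on S (\<lambda>f. f i :: real)"
  by (rule continuous_on_subset[OF continuous_on_product_coordinates]) simp

text \<open>The usual compactness proof: \<open>g\<close> is Lipschitz for the coordinate sum, hence continuous, and so
attains a minimum on the unit sphere, which is positive by definiteness.  The norm is a function
of all coordinates that sees only those in \<open>I\<close>; this covers vectors, matrices and the coefficients
of linear combinations alike.\<close>

lemma norm_dominates_coordinate_sum:
  fixes g :: "('i \<Rightarrow> real) \<Rightarrow> real"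
  assumes I: "finite I"
    and scale: "\<And>c f. g (\<lambda>i. c * f i) = \<bar>c\<bar> * g f"
    and tri: "\<And>f h. g (\<lambda>i. f i + h i) \<le> g f + g h"
    and definite: "\<And>f i. g f = 0 \<Longrightarrow> i \<in> I \<Longrightarrow> f i = 0"
    and coordwise: "\<And>f h. (\<And>i. i \<in> I \<Longrightarrow> f i = h i) \<Longrightarrow> g f = g h"
  shows "\<exists>C>0. \<forall>f. (\<Sum>i\<in>I. \<bar>f i\<bar>) \<le> C * g f"
    and "\<exists>C>0. \<forall>f. g f \<le> C * (\<Sum>i\<in>I. \<bar>f i\<bar>)"
proof -
  have zero: "g (\<lambda>_. 0) = 0" using scale[of 0] by simp
  have nonneg: "0 \<le> g f" for f
    using tri[of f "\<lambda>i. (-1) * f i"] zero scale[of "-1" f] by simp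
  define B where "B = 1 + (\<Sum>i\<in>I. g (\<lambda>j. if j = i then 1 else 0))"
  have Bi: "g (\<lambda>j. if j = i then 1 else 0) \<le> B" if "i \<in> I" for i
    using member_le_sum[OF that nonneg I, of "\<lambda>i. (\<lambda>j. if j = i then 1 else 0)"] by (simp add: B_def)
  have Bpos: "0 < B" unfolding B_def using sum_nonneg[of I "\<lambda>i. g (\<lambda>j. if j = i then 1 else 0)"] nonneg
    by (smt (verit) )
  have part: "g (\<lambda>i. if i \<in> J then f i else 0) \<le> B * (\<Sum>i\<in>J. \<bar>f i\<bar>)" if "finite J" "J \<subseteq> I" for J f
    using that
  proof (induction J)
    case empty
    then show ?case using zero by simp
  next
    case (insert j J)
    have "(\<lambda>i. if i \<in> insert j J then f i else 0)
        = (\<lambda>i. (if i \<in> J then f i else 0) + f j * (if i = j then 1 else 0))"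
      using insert.hyps by auto
    then have "g (\<lambda>i. if i \<in> insert j J then f i else 0)
        \<le> g (\<lambda>i. if i \<in> J then f i else 0) + \<bar>f j\<bar> * g (\<lambda>i. if i = j then 1 else 0)"
      using tri[of "\<lambda>i. if i \<in> J then f i else 0" "\<lambda>i. f j * (if i = j then 1 else 0)"]
      by (simp only: scale)
    also have "\<dots> \<le> B * (\<Sum>i\<in>J. \<bar>f i\<bar>) + \<bar>f j\<bar> * B"
      using insert Bi[of j] by (intro add_mono mult_left_mono) auto
    finally show ?case using insert.hyps by (simp add: algebra_simps)
  qed
  have upper: "g f \<le> B * (\<Sum>i\<in>I. \<bar>f i\<bar>)" for f
    using part[OF I subset_refl, of f] coordwise[of f "\<lambda>i. if i \<in> I then f i else 0"] by simp
  then show "\<exists>C>0. \<forall>f. g f \<le> C * (\<Sum>i\<in>I. \<bar>f i\<bar>)" using Bpos by blast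
  have lip: "\<bar>g h - g f\<bar> \<le> B * (\<Sum>i\<in>I. \<bar>h i - f i\<bar>)" for f h
  proof -
    have "g h \<le> g f + g (\<lambda>i. h i - f i)" using tri[of f "\<lambda>i. h i - f i"] by simp
    moreover have "g f \<le> g h + g (\<lambda>i. f i - h i)" using tri[of h "\<lambda>i. f i - h i"] by simp
    moreover have "(\<Sum>i\<in>I. \<bar>f i - h i\<bar>) = (\<Sum>i\<in>I. \<bar>h i - f i\<bar>)"
      by (intro sum.cong) auto
    ultimately show ?thesis using upper[of "\<lambda>i. h i - f i"] upper[of "\<lambda>i. f i - h i"] by auto
  qed
  have cont: "continuous_on UNIV g"
    unfolding continuous_on_def
  proof
    fix f :: "'i \<Rightarrow> real"
    have coord: "((\<lambda>h. h i) \<longlongrightarrow> f i) (at f within UNIV)" for i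
      using continuous_on_product_coordinates[of i] by (auto simp: continuous_on_def)
    have "((\<lambda>h. B * (\<Sum>i\<in>I. \<bar>h i - f i\<bar>)) \<longlongrightarrow> B * (\<Sum>i\<in>I. \<bar>f i - f i\<bar>)) (at f within UNIV)"
      by (intro tendsto_intros coord)
    then have lim: "((\<lambda>h. B * (\<Sum>i\<in>I. \<bar>h i - f i\<bar>)) \<longlongrightarrow> 0) (at f within UNIV)" by simp
    have "((\<lambda>h. g h - g f) \<longlongrightarrow> 0) (at f within UNIV)"
      by (rule Lim_null_comparison[OF _ lim]) (simp add: lip)
    then show "(g \<longlongrightarrow> g f) (at f within UNIV)" by (simp add: LIM_zero_iff)
  qed
  define K where "K = {f::'i \<Rightarrow> real. \<forall>i. f i \<in> (if i \<in> I then {-1..1} else {0})} \<inter> {f. (\<Sum>i\<in>I. \<bar>f i\<bar>) = 1}"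
  have "compact K"
    unfolding K_def
    by (intro compact_Int_closed compact_coordinatewise closed_Collect_eq continuous_intros) auto
  have inK: "(\<lambda>i. if i \<in> I then f i / t else 0) \<in> K" if "t = (\<Sum>i\<in>I. \<bar>f i\<bar>)" "t > 0" for f t
  proof -
    have "\<bar>f i\<bar> \<le> t" if "i \<in> I" for i
      using member_le_sum[OF that _ I, of "\<lambda>i. \<bar>f i\<bar>"] \<open>t = _\<close> by simp
    then have "\<bar>f i / t\<bar> \<le> 1" if "i \<in> I" for i using that \<open>t > 0\<close> by simp
    then have "-1 \<le> f i / t \<and> f i / t \<le> 1" if "i \<in> I" for i using that by (meson abs_le_iff minus_le_iff)
    moreover have "(\<Sum>i\<in>I. \<bar>f i / t\<bar>) = 1"
      using that by (simp add: sum_divide_distrib[symmetric])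
    ultimately show ?thesis by (simp add: K_def)
  qed
  show "\<exists>C>0. \<forall>f. (\<Sum>i\<in>I. \<bar>f i\<bar>) \<le> C * g f"
  proof (cases "K = {}")
    case True
    have "(\<Sum>i\<in>I. \<bar>f i\<bar>) = 0" for f :: "'i \<Rightarrow> real"
      proof -
      have "\<not> 0 < (\<Sum>i\<in>I. \<bar>f i\<bar>)" using inK[OF refl, of f] True by auto
      moreover have "0 \<le> (\<Sum>i\<in>I. \<bar>f i\<bar>)" by (intro sum_nonneg) auto
      ultimately show ?thesis by linarith
    qed
    then show ?thesis using nonneg by (intro exI[of _ 1]) simp
  next
    case False
    obtain f0 where f0: "f0 \<in> K" and min: "\<And>f. f \<in> K \<Longrightarrow> g f0 \<le> g f"
      using continuous_attains_inf[OF \<open>compact K\<close> False continuous_on_subset[OF cont subset_UNIV]] by blast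
    have "g f0 \<noteq> 0"
    proof
      assume "g f0 = 0"
      then have "(\<Sum>i\<in>I. \<bar>f0 i\<bar>) = 0" using definite by (intro sum.neutral) auto
      then show False using f0 by (simp add: K_def)
    qed
    then have pos: "0 < g f0" using nonneg[of f0] by linarith
    have "(\<Sum>i\<in>I. \<bar>f i\<bar>) \<le> 1 / g f0 * g f" for f
    proof (cases "(\<Sum>i\<in>I. \<bar>f i\<bar>) > 0")
      case True
      define t where "t = (\<Sum>i\<in>I. \<bar>f i\<bar>)"
      have "g f = g (\<lambda>i. t * (if i \<in> I then f i / t else 0))"
        using True by (intro coordwise) (auto simp: t_def)
      also have "\<dots> = t * g (\<lambda>i. if i \<in> I then f i / t else 0)"
        using True by (simp only: scale) (simp add: t_def)
      also have "\<dots> \<ge> t * g f0"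
        using min[OF inK[OF t_def]] True by (intro mult_left_mono) (auto simp: t_def)
      finally show ?thesis using pos by (simp add: t_def field_simps)
    next
      case False
      have "0 \<le> 1 / g f0 * g f" using pos nonneg[of f] by simp
      then show ?thesis using False by linarith
    qed
    then show ?thesis using pos by (intro exI[of _ "1 / g f0"]) auto
  qed
qed

lemma vec_norm_equivalent:
  assumes nrm: "is_vec_norm n nrm"
  shows "\<exists>C>0. \<forall>x\<in>carrier_vec n. nrm x \<le> C * coord_norm x \<and> coord_norm x \<le> C * nrm x"
proof -
  define g where "g f = nrm (vec n f)" for f
  have scale: "g (\<lambda>i. c * f i) = \<bar>c\<bar> * g f" for c f
  proof -
    have "vec n (\<lambda>i. c * f i) = c \<cdot>\<^sub>v vec n f" by auto
    then show ?thesis using nrm by (simp add: g_def is_vec_norm_def)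
  qed
  have tri: "g (\<lambda>i. f i + h i) \<le> g f + g h" for f h
  proof -
    have "vec n (\<lambda>i. f i + h i) = vec n f + vec n h" by auto
    then show ?thesis using nrm by (simp add: g_def is_vec_norm_def)
  qed
  have definite: "f i = 0" if "g f = 0" "i \<in> {..<n}" for f i
  proof -
    have "vec n f = 0\<^sub>v n" using nrm that by (simp add: g_def is_vec_norm_def)
    then have "vec n f $ i = 0\<^sub>v n $ i" by simp
    then show ?thesis using that by simp
  qed
  have coordwise: "g f = g h" if "\<And>i. i \<in> {..<n} \<Longrightarrow> f i = h i" for f h
  proof -
    have "vec n f = vec n h" using that by auto
    then show ?thesis by (simp add: g_def)
  qed
  have dominates: "\<exists>C>0. \<forall>f. (\<Sum>i\<in>{..<n}. \<bar>f i\<bar>) \<le> C * g f"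
    by (rule norm_dominates_coordinate_sum(1)) (fact finite_lessThan scale tri definite coordwise)+
  have dominated: "\<exists>C>0. \<forall>f. g f \<le> C * (\<Sum>i\<in>{..<n}. \<bar>f i\<bar>)"
    by (rule norm_dominates_coordinate_sum(2)) (fact finite_lessThan scale tri definite coordwise)+
  obtain A where A: "0 < A" "\<And>f. (\<Sum>i<n. \<bar>f i\<bar>) \<le> A * g f"
    using dominates by blast
  obtain B where B: "0 < B" "\<And>f. g f \<le> B * (\<Sum>i<n. \<bar>f i\<bar>)"
    using dominated by blast
  have "nrm x \<le> (A + B) * coord_norm x \<and> coord_norm x \<le> (A + B) * nrm x" if x: "x \<in> carrier_vec n" for x
  proof -
    have eq: "vec n (($) x) = x" using x by auto
    have cn: "coord_norm x = (\<Sum>i<n. \<bar>x $ i\<bar>)" using x by (simp add: coord_norm_def)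
    have "0 \<le> A * coord_norm x" "0 \<le> B * nrm x"
      using A B x nrm by (auto simp: coord_norm_nonneg is_vec_norm_def)
    then show ?thesis using A(2)[of "($) x"] B(2)[of "($) x"] by (simp add: g_def eq cn distrib_right)
  qed
  then show ?thesis using A(1) B(1) by (intro exI[of _ "A + B"]) auto
qed

lemma mat_norm_equivalent:
  assumes nrm: "is_mat_norm n nrm"
  shows "\<exists>C>0. \<forall>X\<in>carrier_mat n n. nrm X \<le> C * entry_norm X \<and> entry_norm X \<le> C * nrm X"
proof -
  let ?I = "{..<n} \<times> {..<n}"
  define g where "g f = nrm (mat n n f)" for f
  have scale: "g (\<lambda>i. c * f i) = \<bar>c\<bar> * g f" for c f
  proof -
    have "mat n n (\<lambda>i. c * f i) = c \<cdot>\<^sub>m mat n n f" by auto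
    then show ?thesis using nrm by (simp add: g_def is_mat_norm_def)
  qed
  have tri: "g (\<lambda>i. f i + h i) \<le> g f + g h" for f h
  proof -
    have "mat n n (\<lambda>i. f i + h i) = mat n n f + mat n n h" by auto
    then show ?thesis using nrm by (simp add: g_def is_mat_norm_def)
  qed
  have definite: "f i = 0" if "g f = 0" "i \<in> ?I" for f i
  proof -
    have "mat n n f = 0\<^sub>m n n" using nrm that by (simp add: g_def is_mat_norm_def)
    then have "mat n n f $$ i = 0\<^sub>m n n $$ i" by simp
    then show ?thesis using that by auto
  qed
  have coordwise: "g f = g h" if "\<And>i. i \<in> ?I \<Longrightarrow> f i = h i" for f h
  proof -
    have "mat n n f = mat n n h" using that by (intro eq_matI) auto
    then show ?thesis by (simp add: g_def)
  qed
  have fin: "finite ?I" by simp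
  have dominates: "\<exists>C>0. \<forall>f. (\<Sum>i\<in>?I. \<bar>f i\<bar>) \<le> C * g f"
    by (rule norm_dominates_coordinate_sum(1)) (fact fin scale tri definite coordwise)+
  have dominated: "\<exists>C>0. \<forall>f. g f \<le> C * (\<Sum>i\<in>?I. \<bar>f i\<bar>)"
    by (rule norm_dominates_coordinate_sum(2)) (fact fin scale tri definite coordwise)+
  obtain A where A: "0 < A" "\<And>f. (\<Sum>i\<in>?I. \<bar>f i\<bar>) \<le> A * g f"
    using dominates by blast
  obtain B where B: "0 < B" "\<And>f. g f \<le> B * (\<Sum>i\<in>?I. \<bar>f i\<bar>)"
    using dominated by blast
  have "nrm X \<le> (A + B) * entry_norm X \<and> entry_norm X \<le> (A + B) * nrm X" if X: "X \<in> carrier_mat n n" for X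
  proof -
    have eq: "mat n n (($$) X) = X" using X by auto
    have en: "entry_norm X = (\<Sum>i\<in>?I. \<bar>X $$ i\<bar>)" using X by (simp add: entry_norm_def sum.cartesian_product')
    have "0 \<le> A * entry_norm X" "0 \<le> B * nrm X"
      using A B X nrm by (auto simp: entry_norm_nonneg is_mat_norm_def)
    then show ?thesis using A(2)[of "($$) X"] B(2)[of "($$) X"] by (simp add: g_def eq en distrib_right)
  qed
  then show ?thesis using A(1) B(1) by (intro exI[of _ "A + B"]) auto
qed

section \<open>Expectations along the paths of a Markov chain\<close>

text \<open>The expectation, for the chain started in \<open>s\<close>, of a function of the word of the first \<open>k\<close> states (starting
with \<open>s\<close>) and of the state at time \<open>k\<close>, which is not part of the word.  The matrix of the state at time
\<open>k\<close> has not acted yet at time \<open>k\<close>, so words describe trajectories exactly.\<close>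

primrec path_exp ::
  "nat \<Rightarrow> real mat \<Rightarrow> nat \<Rightarrow> nat \<Rightarrow> (nat list \<Rightarrow> nat \<Rightarrow> real) \<Rightarrow> real" where
  "path_exp N P 0 s \<phi> = \<phi> [] s"
| "path_exp N P (Suc k) s \<phi> = (\<Sum>j<N. P $$ (s, j) * path_exp N P k j (\<lambda>w. \<phi> (s # w)))"

text \<open>The definition splits off the first transition, which suits conditioning on the second state; time
evolution needs the last transition.\<close>

lemma path_exp_Suc_last:
  "path_exp N P (Suc k) s \<phi> = path_exp N P k s (\<lambda>w i. \<Sum>j<N. P $$ (i, j) * \<phi> (w @ [i]) j)"
proof (induction k arbitrary: s \<phi>)
  case (Suc k)
  have "path_exp N P (Suc (Suc k)) s \<phi>
      = (\<Sum>j<N. P $$ (s, j) * path_exp N P (Suc k) j (\<lambda>w. \<phi> (s # w)))"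
    by (rule path_exp.simps(2))
  also have "\<dots> = path_exp N P (Suc k) s (\<lambda>w i. \<Sum>j<N. P $$ (i, j) * \<phi> (w @ [i]) j)"
    unfolding Suc.IH[of _ "\<lambda>w. \<phi> (s # w)"] by simp
  finally show ?case .
qed simp

lemma path_exp_sum:
  "path_exp N P k s (\<lambda>w e. \<Sum>x\<in>X. F x w e) = (\<Sum>x\<in>X. path_exp N P k s (F x))"
proof (induction k arbitrary: s F)
  case (Suc k)
  then show ?case by (simp add: sum_distrib_left sum.swap[of _ X])
qed simp

lemma path_exp_cmult:
  "path_exp N P k s (\<lambda>w e. c * \<phi> w e) = c * path_exp N P k s \<phi>"
proof (induction k arbitrary: s \<phi>)
  case (Suc k)
  then show ?case by (simp add: sum_distrib_left mult_ac)
qed simp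

lemma path_exp_mono:
  assumes "transition_matrix N P" "s < N"
    and "\<And>w e. length w = k \<Longrightarrow> set w \<subseteq> {..<N} \<Longrightarrow> e < N \<Longrightarrow> \<phi> w e \<le> \<psi> w e"
  shows "path_exp N P k s \<phi> \<le> path_exp N P k s \<psi>"
  using assms(2-3)
proof (induction k arbitrary: s \<phi> \<psi>)
  case (Suc k)
  have "0 \<le> P $$ (s, j)" if "j < N" for j
    using assms(1) that Suc.prems(1) by (simp add: transition_matrix_def)
  moreover have "path_exp N P k j (\<lambda>w. \<phi> (s # w)) \<le> path_exp N P k j (\<lambda>w. \<psi> (s # w))" if "j < N" for j
    using Suc.prems that by (intro Suc.IH) auto
  ultimately show ?case by (auto intro!: sum_mono mult_left_mono)
qed simp

lemma path_exp_cong: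
  assumes "transition_matrix N P" "s < N"
    and "\<And>w e. length w = k \<Longrightarrow> set w \<subseteq> {..<N} \<Longrightarrow> e < N \<Longrightarrow> \<phi> w e = \<psi> w e"
  shows "path_exp N P k s \<phi> = path_exp N P k s \<psi>"
  using assms by (intro order_antisym path_exp_mono) auto

lemma path_exp_nonneg:
  assumes "transition_matrix N P" "s < N"
    and "\<And>w e. length w = k \<Longrightarrow> set w \<subseteq> {..<N} \<Longrightarrow> e < N \<Longrightarrow> 0 \<le> \<phi> w e"
  shows "0 \<le> path_exp N P k s \<phi>"
  using path_exp_mono[OF assms(1,2), of k "\<lambda>_ _. 0" \<phi>] assms(3)
    path_exp_cmult[of N P k s 0 "\<lambda>_ _. 0"] by simp

lemma path_exp_abs:
  assumes "transition_matrix N P" "s < N"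
    and "\<And>w e. length w = k \<Longrightarrow> set w \<subseteq> {..<N} \<Longrightarrow> e < N \<Longrightarrow> \<bar>\<phi> w e\<bar> \<le> \<psi> w e"
  shows "\<bar>path_exp N P k s \<phi>\<bar> \<le> path_exp N P k s \<psi>"
proof (rule abs_leI)
  show "path_exp N P k s \<phi> \<le> path_exp N P k s \<psi>"
    using assms by (intro path_exp_mono) (auto simp: abs_le_iff)
  have "path_exp N P k s (\<lambda>w e. (-1) * \<phi> w e) \<le> path_exp N P k s \<psi>"
    using assms by (intro path_exp_mono) (auto simp: abs_le_iff)
  then show "- path_exp N P k s \<phi> \<le> path_exp N P k s \<psi>"
    unfolding path_exp_cmult by simp
qed

lemma integral_finitely_valued:
  fixes f :: "'b \<Rightarrow> real"
  assumes "finite_measure M" "finite H"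
    and val: "\<And>\<omega>. \<omega> \<in> space M \<Longrightarrow> X \<omega> \<in> H"
    and meas: "\<And>h. h \<in> H \<Longrightarrow> {\<omega> \<in> space M. X \<omega> = h} \<in> sets M"
  shows "(LINT \<omega>|M. f (X \<omega>)) = (\<Sum>h\<in>H. f h * measure M {\<omega> \<in> space M. X \<omega> = h})"
proof -
  interpret finite_measure M by fact
  have "(LINT \<omega>|M. f (X \<omega>)) = (LINT \<omega>|M. (\<Sum>h\<in>H. f h * indicator {\<omega> \<in> space M. X \<omega> = h} \<omega>))"
  proof (intro Bochner_Integration.integral_cong refl)
    fix \<omega> assume "\<omega> \<in> space M"
    then have "(\<Sum>h\<in>H. f h * indicator {\<omega> \<in> space M. X \<omega> = h} \<omega>) = (\<Sum>h\<in>H. if h = X \<omega> then f h else 0)"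
      by (intro sum.cong) auto
    then show "f (X \<omega>) = (\<Sum>h\<in>H. f h * indicator {\<omega> \<in> space M. X \<omega> = h} \<omega>)"
      using val[OF \<open>\<omega> \<in> space M\<close>] assms(2) by simp
  qed
  also have "\<dots> = (\<Sum>h\<in>H. f h * measure M {\<omega> \<in> space M. X \<omega> = h})"
    using meas by (subst Bochner_Integration.integral_sum)
      (auto intro!: integrable_real_indicator simp: emeasure_finite less_top[symmetric])
  finally show ?thesis .
qed

text \<open>Histories take finitely many values, so both sides are finite sums over histories.  The Markov
property compares them term by term; histories of probability zero contribute nothing.\<close>

lemma markov_step:
  assumes mc: "markov_chain N P s \<Omega> \<sigma>"
  shows "(LINT \<omega>|\<Omega>. \<phi> (map (\<lambda>l. \<sigma> l \<omega>) [0..<Suc k]) (\<sigma> (Suc k) \<omega>)) =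
    (LINT \<omega>|\<Omega>. (\<Sum>j<N. P $$ (\<sigma> k \<omega>, j) * \<phi> (map (\<lambda>l. \<sigma> l \<omega>) [0..<Suc k]) j))"
proof -
  interpret prob_space \<Omega> using mc by (simp add: markov_chain_def)
  have meas[measurable]: "\<sigma> l \<in> measurable \<Omega> (count_space {..<N})" for l
    using mc by (simp add: markov_chain_def)
  have val: "\<sigma> l \<omega> < N" if "\<omega> \<in> space \<Omega>" for l \<omega>
    using measurable_space[OF meas that] by simp
  define hist where "hist \<omega> = map (\<lambda>l. \<sigma> l \<omega>) [0..<Suc k]" for \<omega>
  define H where "H = {h. set h \<subseteq> {..<N} \<and> length h = Suc k}"
  have finH: "finite H" unfolding H_def by (rule finite_lists_length_eq) simp
  have histH: "hist \<omega> \<in> H" if "\<omega> \<in> space \<Omega>" for \<omega>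
    using val[OF that] by (auto simp: H_def hist_def simp del: upt_Suc)
  have hist_eq: "hist \<omega> = h \<longleftrightarrow> (\<forall>l\<le>k. \<sigma> l \<omega> = h ! l)" if "h \<in> H" for h \<omega>
    using that by (auto simp: list_eq_iff_nth_eq H_def hist_def less_Suc_eq_le simp del: upt_Suc)
  have state_set: "{\<omega> \<in> space \<Omega>. \<sigma> l \<omega> = i} \<in> sets \<Omega>" for l i
    by measurable
  have path_set: "{\<omega> \<in> space \<Omega>. \<forall>l\<le>m. \<sigma> l \<omega> = i l} \<in> sets \<Omega>" for m i
  proof (induction m)
    case 0
    show ?case using state_set[of 0 "i 0"] by simp
  next
    case (Suc m)
    have "{\<omega> \<in> space \<Omega>. \<forall>l\<le>Suc m. \<sigma> l \<omega> = i l}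
        = {\<omega> \<in> space \<Omega>. \<forall>l\<le>m. \<sigma> l \<omega> = i l} \<inter> {\<omega> \<in> space \<Omega>. \<sigma> (Suc m) \<omega> = i (Suc m)}"
      by (auto simp: le_Suc_eq)
    then show ?case using Suc state_set[of "Suc m"] by auto
  qed
  have hist_set: "{\<omega> \<in> space \<Omega>. hist \<omega> = h} \<in> sets \<Omega>" if "h \<in> H" for h
    using path_set[of k "\<lambda>l. h ! l"] hist_eq[OF that] by simp
  have split: "{\<omega> \<in> space \<Omega>. (hist \<omega>, \<sigma> (Suc k) \<omega>) = (h, j)}
      = {\<omega> \<in> space \<Omega>. hist \<omega> = h} \<inter> {\<omega> \<in> space \<Omega>. \<sigma> (Suc k) \<omega> = j}" for h j
    by auto
  have pair_set: "{\<omega> \<in> space \<Omega>. (hist \<omega>, \<sigma> (Suc k) \<omega>) = hj} \<in> sets \<Omega>" if "hj \<in> H \<times> {..<N}" for hj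
    using that hist_set state_set[of "Suc k"] split[of "fst hj" "snd hj"] by auto
  have joint: "measure \<Omega> {\<omega> \<in> space \<Omega>. (hist \<omega>, \<sigma> (Suc k) \<omega>) = (h, j)}
      = P $$ (h ! k, j) * measure \<Omega> {\<omega> \<in> space \<Omega>. hist \<omega> = h}" if "h \<in> H" "j < N" for h j
  proof (cases "measure \<Omega> {\<omega> \<in> space \<Omega>. hist \<omega> = h} = 0")
    case True
    have "measure \<Omega> {\<omega> \<in> space \<Omega>. (hist \<omega>, \<sigma> (Suc k) \<omega>) = (h, j)} \<le> measure \<Omega> {\<omega> \<in> space \<Omega>. hist \<omega> = h}"
      using hist_set that by (intro finite_measure_mono) auto
    then show ?thesis using True measure_nonneg[of \<Omega>] by (simp add: antisym)
  next
    case False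
    have "0 < \<P>(\<omega> in \<Omega>. \<forall>l\<le>k. \<sigma> l \<omega> = h ! l)"
      using False measure_nonneg[of \<Omega>] hist_eq[OF that(1)] by (simp add: less_le)
    then have "\<P>(\<omega> in \<Omega>. \<sigma> (Suc k) \<omega> = j \<bar> \<forall>l \<le> k. \<sigma> l \<omega> = h ! l) = P $$ (h ! k, j)"
      using mc that by (simp add: markov_chain_def)
    then show ?thesis
      using False hist_eq[OF that(1)] by (simp add: cond_prob_def field_simps conj_commute)
  qed
  have "(LINT \<omega>|\<Omega>. \<phi> (hist \<omega>) (\<sigma> (Suc k) \<omega>)) = (LINT \<omega>|\<Omega>. case_prod \<phi> (hist \<omega>, \<sigma> (Suc k) \<omega>))"
    by simp
  also have "\<dots> = (\<Sum>hj\<in>H \<times> {..<N}. case_prod \<phi> hj * measure \<Omega> {\<omega> \<in> space \<Omega>. (hist \<omega>, \<sigma> (Suc k) \<omega>) = hj})"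
    using finH histH val pair_set by (intro integral_finitely_valued) (auto simp: finite_measure_axioms)
  also have "\<dots> = (\<Sum>h\<in>H. (\<Sum>j<N. P $$ (h ! k, j) * \<phi> h j) * measure \<Omega> {\<omega> \<in> space \<Omega>. hist \<omega> = h})"
    unfolding sum.cartesian_product' sum_distrib_right
    using joint by (intro sum.cong refl) (auto simp: mult_ac)
  also have "\<dots> = (LINT \<omega>|\<Omega>. (\<Sum>j<N. P $$ (hist \<omega> ! k, j) * \<phi> (hist \<omega>) j))"
    using finH histH hist_set
    by (intro integral_finitely_valued[symmetric]) (auto simp: finite_measure_axioms)
  also have "\<dots> = (LINT \<omega>|\<Omega>. (\<Sum>j<N. P $$ (\<sigma> k \<omega>, j) * \<phi> (hist \<omega>) j))"
    by (simp add: hist_def del: upt_Suc)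
  finally show ?thesis by (simp add: hist_def del: upt_Suc)
qed

lemma markov_integral:
  assumes mc: "markov_chain N P s \<Omega> \<sigma>"
  shows "(LINT \<omega>|\<Omega>. \<phi> (map (\<lambda>l. \<sigma> l \<omega>) [0..<k]) (\<sigma> k \<omega>)) = path_exp N P k s \<phi>"
proof (induction k arbitrary: \<phi>)
  case 0
  interpret prob_space \<Omega> using mc by (simp add: markov_chain_def)
  have "(LINT \<omega>|\<Omega>. \<phi> [] (\<sigma> 0 \<omega>)) = (LINT \<omega>|\<Omega>. \<phi> [] s)"
    using mc by (intro Bochner_Integration.integral_cong) (auto simp: markov_chain_def)
  then show ?case by (simp add: prob_space)
next
  case (Suc k)
  have snoc: "map (\<lambda>l. \<sigma> l \<omega>) [0..<Suc k] = map (\<lambda>l. \<sigma> l \<omega>) [0..<k] @ [\<sigma> k \<omega>]" for \<omega>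
    by simp
  show ?case
    unfolding markov_step[OF mc, of \<phi> k] path_exp_Suc_last[of N P k s \<phi>]
    unfolding snoc by (rule Suc)
qed

lemma markov_chain_state:
  assumes "markov_chain N P s \<Omega> \<sigma>" "\<omega> \<in> space \<Omega>"
  shows "\<sigma> l \<omega> < N"
proof -
  have "\<sigma> l \<in> measurable \<Omega> (count_space {..<N})" using assms(1) by (simp add: markov_chain_def)
  from measurable_space[OF this assms(2)] show ?thesis by simp
qed

section \<open>Products along words of states\<close>

text \<open>The first letter of the word acts first, hence stands at the right end of the product.\<close>

primrec word_prod :: "nat \<Rightarrow> (nat \<Rightarrow> 'a::semiring_1 mat) \<Rightarrow> nat list \<Rightarrow> 'a mat" where
  "word_prod d M [] = 1\<^sub>m d"
| "word_prod d M (i # w) = word_prod d M w * M i"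

lemma word_prod_carrier:
  "(\<And>i. i < N \<Longrightarrow> M i \<in> carrier_mat d d) \<Longrightarrow> set w \<subseteq> {..<N} \<Longrightarrow> word_prod d M w \<in> carrier_mat d d"
  by (induction w) auto

lemma word_prod_snoc:
  assumes "\<And>i. i < N \<Longrightarrow> M i \<in> carrier_mat d d" "set w \<subseteq> {..<N}" "j < N"
  shows "word_prod d M (w @ [j]) = M j * word_prod d M w"
  using assms(2)
proof (induction w)
  case (Cons i w)
  then have "word_prod d M w \<in> carrier_mat d d" by (intro word_prod_carrier assms) auto
  then show ?case using Cons assms assoc_mult_mat[of "M j" d d "word_prod d M w" d "M i" d] by auto
qed (use assms(1)[OF assms(3)] in simp)

lemma kron_pow_word_prod:
  fixes M :: "nat \<Rightarrow> 'a::comm_semiring_1 mat"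
  assumes "\<And>i. i < N \<Longrightarrow> M i \<in> carrier_mat d d" "set w \<subseteq> {..<N}"
  shows "kron_pow_mat (word_prod d M w) p = word_prod (d ^ p) (\<lambda>i. kron_pow_mat (M i) p) w"
  using assms(2)
proof (induction w)
  case (Cons i w)
  then have "word_prod d M w \<in> carrier_mat d d" by (intro word_prod_carrier assms) auto
  then show ?case using Cons assms(1)[of i] kron_pow_mat_mult[of "word_prod d M w" d d "M i" d p] by simp
qed (simp add: kron_pow_mat_one)

lemma trajectory_word_prod:
  assumes "\<And>i. i < N \<Longrightarrow> M i \<in> carrier_mat d d" "\<And>l. \<sigma> l \<omega> < N" "x0 \<in> carrier_vec d"
  shows "trajectory M \<sigma> x0 k \<omega> = word_prod d M (map (\<lambda>l. \<sigma> l \<omega>) [0..<k]) *\<^sub>v x0"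
proof (induction k)
  case (Suc k)
  have w: "set (map (\<lambda>l. \<sigma> l \<omega>) [0..<k]) \<subseteq> {..<N}" using assms(2) by auto
  have snoc: "map (\<lambda>l. \<sigma> l \<omega>) [0..<Suc k] = map (\<lambda>l. \<sigma> l \<omega>) [0..<k] @ [\<sigma> k \<omega>]" by simp
  show ?case
    unfolding snoc using Suc word_prod_snoc[OF assms(1) w assms(2)] assms
      word_prod_carrier[OF assms(1) w] by (simp add: assoc_mult_mat_vec[of _ d d _ d])
qed (use assms in simp)

lemma switched_prod_word_prod:
  assumes "\<And>i. i < N \<Longrightarrow> M i \<in> carrier_mat d d" "\<And>l. \<sigma> l \<omega> < N"
  shows "switched_prod d M \<sigma> k \<omega> = word_prod d M (tl (map (\<lambda>l. \<sigma> l \<omega>) [0..<Suc k]))"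
proof -
  have "switched_prod d M \<sigma> k \<omega> = word_prod d M (map (\<lambda>l. \<sigma> l \<omega>) [1..<Suc k])"
  proof (induction k)
    case (Suc k)
    have snoc: "map (\<lambda>l. \<sigma> l \<omega>) [1..<Suc (Suc k)] = map (\<lambda>l. \<sigma> l \<omega>) [1..<Suc k] @ [\<sigma> (Suc k) \<omega>]" by simp
    have w: "set (map (\<lambda>l. \<sigma> l \<omega>) [1..<Suc k]) \<subseteq> {..<N}" using assms(2) by auto
    show ?case unfolding snoc using Suc word_prod_snoc[OF assms(1) w assms(2)] by simp
  qed simp
  also have "[1..<Suc k] = tl [0..<Suc k]" by (simp add: upt_rec[of 0 "Suc k"] del: upt_Suc)
  finally show ?thesis by (simp only: map_tl)
qed

section \<open>Growth rates of orbits of a matrix\<close>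

text \<open>Fekete's lemma in multiplicative form.  The multiplicative form also covers sequences that vanish
from some point on, where logarithms would not be available.\<close>

lemma submultiplicative_root_convergent:
  fixes a :: "nat \<Rightarrow> real"
  assumes nonneg: "\<And>k. 0 \<le> a k" and C: "0 < C" and sub: "\<And>k l. a (k + l) \<le> C * a k * a l"
  shows "convergent (\<lambda>k. a k powr (1 / real k))"
proof -
  define b where "b k = C * a k" for k
  have b0: "0 \<le> b k" for k using nonneg C by (simp add: b_def)
  have bsub: "b (k + l) \<le> b k * b l" for k l
    using mult_left_mono[OF sub[of k l], of C] C by (simp add: b_def mult_ac)
  define R where "R = (\<lambda>m. b m powr (1 / real m)) ` {1..}"
  have R: "R \<noteq> {}" "bdd_below R" by (auto simp: R_def intro!: bdd_belowI[of _ 0])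
  define L where "L = Inf R"
  have L0: "0 \<le> L" unfolding L_def using R by (intro cInf_greatest) (auto simp: R_def)
  have lower: "L \<le> b k powr (1 / real k)" if "1 \<le> k" for k
    unfolding L_def using R that by (intro cInf_lower) (auto simp: R_def)
  have "(\<lambda>k. b k powr (1 / real k)) \<longlonglongrightarrow> L"
  proof (rule order_tendstoI)
    fix x assume "x < L"
    then show "eventually (\<lambda>k. x < b k powr (1 / real k)) sequentially"
      using lower by (intro eventually_sequentiallyI[of 1]) (meson less_le_trans)
  next
    fix x assume x: "L < x"
    define q where "q = (L + x) / 2"
    have q: "L < q" "q < x" "0 < q" using x L0 by (auto simp: q_def)
    obtain m where m: "1 \<le> m" "b m powr (1 / real m) < q"
      using cInf_lessD[OF R(1), of q] q by (auto simp: L_def R_def)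
    have bm: "b m \<le> q ^ m"
    proof (cases "b m = 0")
      case False
      then have "b m = (b m powr (1 / real m)) ^ m"
        using m b0[of m] by (simp add: powr_realpow[symmetric] powr_powr)
      also have "\<dots> \<le> q ^ m" using m by (intro power_mono) auto
      finally show ?thesis .
    qed (use q in auto)
    define D where "D = 1 + (\<Sum>r<m. b r / q ^ r)"
    have sum0: "0 \<le> (\<Sum>r<m. b r / q ^ r)" using b0 q by (intro sum_nonneg) auto
    then have D: "0 < D" by (simp add: D_def)
    have bound: "b k \<le> D * q ^ k" for k
    proof (induction k rule: less_induct)
      case (less k)
      show ?case
      proof (cases "k < m")
        case True
        then have "b k / q ^ k \<le> (\<Sum>r<m. b r / q ^ r)"
          using b0 q by (intro member_le_sum[of k _ "\<lambda>r. b r / q ^ r"]) auto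
        then have "b k / q ^ k \<le> D" by (simp add: D_def)
        then show ?thesis using q by (simp add: field_simps)
      next
        case False
        have "b k \<le> b m * b (k - m)" using bsub[of m "k - m"] False by simp
        also have "\<dots> \<le> q ^ m * (D * q ^ (k - m))"
          using less[of "k - m"] m False bm b0 q by (intro mult_mono) auto
        also have "\<dots> = D * q ^ k" using False by (simp add: power_add[symmetric])
        finally show ?thesis .
      qed
    qed
    have "(\<lambda>k. D powr (1 / real k) * q) \<longlonglongrightarrow> D powr 0 * q"
      using D by (intro tendsto_intros lim_1_over_n) auto
    then have "(\<lambda>k. D powr (1 / real k) * q) \<longlonglongrightarrow> q" using D by simp
    then have close: "eventually (\<lambda>k. D powr (1 / real k) * q < x) sequentially"
      using q by (intro order_tendstoD(2)) auto
    have upper: "b k powr (1 / real k) \<le> D powr (1 / real k) * q" if "1 \<le> k" for k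
    proof -
      have "b k powr (1 / real k) \<le> (D * q ^ k) powr (1 / real k)"
        using bound b0 by (intro powr_mono2) auto
      also have "\<dots> = D powr (1 / real k) * q"
        using that D q by (simp add: powr_mult powr_realpow[symmetric] powr_powr)
      finally show ?thesis .
    qed
    show "eventually (\<lambda>k. b k powr (1 / real k) < x) sequentially"
      using close eventually_ge_at_top[of 1] by eventually_elim (use upper in force)
  qed
  moreover have "(\<lambda>k. (1 / C) powr (1 / real k)) \<longlonglongrightarrow> (1 / C) powr 0"
    using C by (intro tendsto_intros lim_1_over_n) auto
  ultimately have "(\<lambda>k. (1 / C) powr (1 / real k) * b k powr (1 / real k)) \<longlonglongrightarrow> (1 / C) powr 0 * L"
    by (intro tendsto_mult)
  moreover have "(1 / C) powr (1 / real k) * b k powr (1 / real k) = a k powr (1 / real k)" for k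
    using C nonneg[of k] by (simp add: powr_mult[symmetric] b_def)
  ultimately show ?thesis by (auto simp: convergent_def)
qed

text \<open>Submultiplicativity up to a constant, unlike submultiplicativity, is preserved by two-sided bounds.\<close>

lemma submultiplicative_comparable:
  fixes u b :: "nat \<Rightarrow> real"
  assumes "0 \<le> A" "0 \<le> C" "\<And>k. 0 \<le> u k" "\<And>k. b k \<le> A * u k" "\<And>k. u k \<le> B * b k"
    and sub: "\<And>k l. u (k + l) \<le> C * u k * u l"
  shows "b (k + l) \<le> (A * C * B ^ 2) * b k * b l"
proof -
  have "b (k + l) \<le> A * u (k + l)" by fact
  also have "\<dots> \<le> A * (C * (u k * u l))"
    using assms(1) sub[of k l] by (intro mult_left_mono) (auto simp: mult.assoc)
  also have "\<dots> \<le> A * (C * ((B * b k) * (B * b l)))"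
    using assms(1-3) assms(5) by (intro mult_left_mono mult_mono) (auto intro: order_trans)
  finally show ?thesis by (simp add: power2_eq_square mult_ac)
qed

text \<open>The vectors are the columns of a square matrix with one additional row of zeros, so that its
determinant vanishes.\<close>

lemma vectors_dependent:
  fixes u :: "nat \<Rightarrow> real vec"
  assumes u: "\<And>k. u k \<in> carrier_vec n"
  shows "\<exists>c. (\<exists>i\<le>n. c i \<noteq> 0) \<and> (\<forall>a<n. (\<Sum>i\<le>n. c i * u i $ a) = 0)"
proof -
  define A where "A = mat (Suc n) (Suc n) (\<lambda>(a, i). if a < n then u i $ a else 0)"
  have A: "A \<in> carrier_mat (Suc n) (Suc n)" by (simp add: A_def)
  have "A = mat\<^sub>r (Suc n) (Suc n) (\<lambda>a. if a = n then 0\<^sub>v (Suc n) else vec (Suc n) (\<lambda>i. u i $ a))"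
    by (rule eq_matI) (auto simp: A_def)
  then have "det A = 0" using det_row_0[of n "Suc n" "\<lambda>a. vec (Suc n) (\<lambda>i. u i $ a)"] by auto
  then obtain v where v: "v \<in> carrier_vec (Suc n)" "v \<noteq> 0\<^sub>v (Suc n)" "A *\<^sub>v v = 0\<^sub>v (Suc n)"
    using det_0_iff_vec_prod_zero[OF A] by blast
  have "(\<Sum>i\<le>n. v $ i * u i $ a) = 0" if "a < n" for a
  proof -
    have "(\<Sum>i\<le>n. v $ i * u i $ a) = (\<Sum>i<Suc n. A $$ (a, i) * v $ i)"
      using that by (intro sum.cong) (auto simp: A_def)
    also have "\<dots> = (A *\<^sub>v v) $ a" using mult_mat_vec_index[OF A v(1), of a] that by simp
    finally show ?thesis using v that by simp
  qed
  moreover have "\<exists>i\<le>n. v $ i \<noteq> 0"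
  proof (rule ccontr)
    assume "\<not> (\<exists>i\<le>n. v $ i \<noteq> 0)"
    then have "v = 0\<^sub>v (Suc n)" using v(1) by (intro eq_vecI) auto
    then show False using v by simp
  qed
  ultimately show ?thesis by (intro exI[of _ "\<lambda>i. v $ i"]) auto
qed

text \<open>Let \<open>u\<^sub>0, \<dots>, u\<^bsub>m-1\<^esub>\<close> be the longest linearly independent initial part of the orbit.  Every
\<open>u\<^sub>l\<close> is a combination of these vectors with coefficients bounded by a multiple of the norm of
\<open>u\<^sub>l\<close>.  Applying \<open>T\<^sup>k\<close> expresses \<open>u\<^bsub>k+l\<^esub>\<close> with the same coefficients by
\<open>u\<^sub>k, \<dots>, u\<^bsub>k+m-1\<^esub>\<close>, whose norms are bounded by a multiple of the norm of \<open>u\<^sub>k\<close>.\<close>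

lemma linear_orbit_submultiplicative:
  fixes T :: "real mat" and u :: "nat \<Rightarrow> real vec"
  assumes T: "T \<in> carrier_mat n n" and u: "\<And>k. u k \<in> carrier_vec n"
    and step: "\<And>k. u (Suc k) = T *\<^sub>v u k"
  shows "\<exists>C>0. \<forall>k l. coord_norm (u (k + l)) \<le> C * coord_norm (u k) * coord_norm (u l)"
proof -
  define dep where "dep m \<longleftrightarrow> (\<exists>c. (\<exists>i\<le>m. c i \<noteq> 0) \<and> (\<forall>a<n. (\<Sum>i\<le>m. c i * u i $ a) = 0))" for m
  have "dep n" unfolding dep_def by (rule vectors_dependent[OF u])
  \<comment> \<open>\<open>m\<close> is the first index at which \<open>u 0, \<dots>, u m\<close> are dependent.\<close>
  define m where "m = (LEAST m. dep m)"
  have "dep m" unfolding m_def by (rule LeastI[of dep n]) fact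
  have least: "\<not> dep j" if "j < m" for j using not_less_Least that unfolding m_def by blast
  have indep: "c i = 0" if "\<And>a. a < n \<Longrightarrow> (\<Sum>i<m. c i * u i $ a) = 0" "i < m" for c i
  proof (cases m)
    case (Suc j)
    then show ?thesis using least[of j] that unfolding dep_def lessThan_Suc_atMost[symmetric] Suc
      by (metis lessI less_Suc_eq_le)
  qed (use that in simp)
  obtain c where c: "\<exists>i\<le>m. c i \<noteq> 0" "\<And>a. a < n \<Longrightarrow> (\<Sum>i\<le>m. c i * u i $ a) = 0"
    using \<open>dep m\<close> unfolding dep_def by blast
  have split: "(\<Sum>i\<le>m. c i * u i $ a) = (\<Sum>i<m. c i * u i $ a) + c m * u m $ a" for a
    by (simp add: lessThan_Suc_atMost[symmetric])
  have cm: "c m \<noteq> 0"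
  proof
    assume "c m = 0"
    then have "(\<Sum>i<m. c i * u i $ a) = 0" if "a < n" for a using c(2)[OF that] split[of a] by simp
    then have "c i = 0" if "i < m" for i using indep that by blast
    then show False using c(1) \<open>c m = 0\<close> by (metis le_neq_implies_less)
  qed
  define span where "span x \<longleftrightarrow> (\<exists>e. \<forall>a<n. x $ a = (\<Sum>i<m. e i * u i $ a))" for x
  have span_base: "span (u i)" if "i \<le> m" for i
  proof (cases "i = m")
    case True
    have "u m $ a = (\<Sum>i<m. (- c i / c m) * u i $ a)" if "a < n" for a
    proof -
      have "c m * u m $ a = - (\<Sum>i<m. c i * u i $ a)" using c(2)[OF that] split[of a] by linarith
      then have "u m $ a = - (\<Sum>i<m. c i * u i $ a) / c m" using cm by (simp add: field_simps)
      then show ?thesis by (simp add: sum_divide_distrib sum_negf)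
    qed
    then show ?thesis unfolding span_def True by (intro exI[of _ "\<lambda>i. - c i / c m"]) blast
  next
    case False
    then have "(\<Sum>j<m. (if j = i then 1 else 0) * u j $ a) = u i $ a" for a
      using that by (simp add: if_distrib[of "\<lambda>x. x * _"] cong: if_cong)
    then show ?thesis unfolding span_def by (intro exI[of _ "\<lambda>j. if j = i then 1 else 0"]) simp
  qed
  have T_index: "(T *\<^sub>v u k) $ a = (\<Sum>b<n. T $$ (a, b) * u k $ b)" if "a < n" for k a
    by (rule mult_mat_vec_index[OF T u that])
  \<comment> \<open>Linear relations between members of the orbit persist under a shift of time.\<close>
  have shift: "\<forall>a<n. u (k + l) $ a = (\<Sum>i<m. e i * u (k + i) $ a)"
    if "\<forall>a<n. u l $ a = (\<Sum>i<m. e i * u i $ a)" for e k l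
  proof (induction k)
    case (Suc k)
    show ?case
    proof (intro allI impI)
      fix a assume a: "a < n"
      have "u (Suc k + l) $ a = (\<Sum>b<n. T $$ (a, b) * (\<Sum>i<m. e i * u (k + i) $ b))"
        using Suc a T_index[OF a, of "k + l"] by (simp add: step)
      also have "\<dots> = (\<Sum>i<m. e i * (\<Sum>b<n. T $$ (a, b) * u (k + i) $ b))"
        unfolding sum_distrib_left by (subst sum.swap) (simp add: mult_ac)
      also have "\<dots> = (\<Sum>i<m. e i * u (Suc k + i) $ a)"
        using T_index[OF a] by (simp add: step)
      finally show "u (Suc k + l) $ a = (\<Sum>i<m. e i * u (Suc k + i) $ a)" .
    qed
  qed (use that in simp)
  have span_all: "span (u l)" for l
  proof (induction l)
    case (Suc l)
    then obtain e where e: "\<forall>a<n. u l $ a = (\<Sum>i<m. e i * u i $ a)" unfolding span_def by blast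
    obtain f where f: "\<And>i. i \<le> m \<Longrightarrow> \<forall>a<n. u i $ a = (\<Sum>j<m. f i j * u j $ a)"
      using span_base unfolding span_def by metis
    have "u (Suc l) $ a = (\<Sum>j<m. (\<Sum>i<m. e i * f (Suc i) j) * u j $ a)" if "a < n" for a
    proof -
      have "u (Suc l) $ a = (\<Sum>i<m. e i * u (Suc i) $ a)" using shift[OF e, of 1] that by simp
      also have "\<dots> = (\<Sum>i<m. e i * (\<Sum>j<m. f (Suc i) j * u j $ a))"
      proof (intro sum.cong refl)
        fix i assume "i \<in> {..<m}"
        then show "e i * u (Suc i) $ a = e i * (\<Sum>j<m. f (Suc i) j * u j $ a)"
          using f[of "Suc i"] that by simp
      qed
      also have "\<dots> = (\<Sum>j<m. (\<Sum>i<m. e i * f (Suc i) j) * u j $ a)"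
        unfolding sum_distrib_left sum_distrib_right by (subst sum.swap) (simp add: mult_ac)
      finally show ?thesis .
    qed
    then show ?case unfolding span_def by (intro exI[of _ "\<lambda>j. \<Sum>i<m. e i * f (Suc i) j"]) blast
  qed (use span_base in simp)
  define g where "g e = (\<Sum>a<n. \<bar>\<Sum>i<m. e i * u i $ a\<bar>)" for e
  have "\<exists>C>0. \<forall>e. (\<Sum>i<m. \<bar>e i\<bar>) \<le> C * g e"
  proof (rule norm_dominates_coordinate_sum(1))
    show "g (\<lambda>i. r * e i) = \<bar>r\<bar> * g e" for r e
      by (simp add: g_def sum_distrib_left[symmetric] abs_mult mult.assoc)
    show "g (\<lambda>i. e i + f i) \<le> g e + g f" for e f
      unfolding g_def sum.distrib[symmetric] distrib_right by (intro sum_mono) (simp add: sum.distrib)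
    show "e i = 0" if "g e = 0" "i \<in> {..<m}" for e i
      using that indep[of e i] unfolding g_def by (subst (asm) sum_nonneg_eq_0_iff) auto
    show "g e = g f" if "\<And>i. i \<in> {..<m} \<Longrightarrow> e i = f i" for e f
      using that by (simp add: g_def)
  qed simp
  then obtain C where C: "0 < C" "\<And>e. (\<Sum>i<m. \<bar>e i\<bar>) \<le> C * g e" by blast
  have iter: "coord_norm (u (k + i)) \<le> entry_norm T ^ i * coord_norm (u k)" for k i
  proof (induction i)
    case (Suc i)
    have "coord_norm (u (k + Suc i)) \<le> entry_norm T * coord_norm (u (k + i))"
      using coord_norm_mult_mat_vec[OF T u[of "k + i"]] by (simp add: step)
    also have "\<dots> \<le> entry_norm T * (entry_norm T ^ i * coord_norm (u k))"
      using Suc by (intro mult_left_mono entry_norm_nonneg)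
    finally show ?case by (simp add: mult_ac)
  qed simp
  define D where "D = 1 + (\<Sum>i<m. entry_norm T ^ i)"
  have D: "entry_norm T ^ i \<le> D" if "i < m" for i
    using member_le_sum[of i "{..<m}" "\<lambda>i. entry_norm T ^ i"] that entry_norm_nonneg by (simp add: D_def)
  have D0: "0 < D" unfolding D_def using entry_norm_nonneg by (intro add_pos_nonneg sum_nonneg) auto
  have "coord_norm (u (k + l)) \<le> (D * C) * coord_norm (u k) * coord_norm (u l)" for k l
  proof -
    obtain e where e: "\<forall>a<n. u l $ a = (\<Sum>i<m. e i * u i $ a)" using span_all[of l] unfolding span_def by blast
    have dims: "dim_vec (u k) = n" for k using u[of k] by simp
    have ge: "g e = coord_norm (u l)" using e by (simp add: g_def coord_norm_def dims)
    have "coord_norm (u (k + l)) = (\<Sum>a<n. \<bar>\<Sum>i<m. e i * u (k + i) $ a\<bar>)"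
      using shift[OF e, of k] by (simp add: coord_norm_def dims)
    also have "\<dots> \<le> (\<Sum>a<n. \<Sum>i<m. \<bar>e i\<bar> * \<bar>u (k + i) $ a\<bar>)"
      by (intro sum_mono order_trans[OF sum_abs]) (simp add: abs_mult)
    also have "\<dots> = (\<Sum>i<m. \<bar>e i\<bar> * coord_norm (u (k + i)))"
      by (subst sum.swap) (simp add: coord_norm_def dims sum_distrib_left)
    also have "\<dots> \<le> (\<Sum>i<m. \<bar>e i\<bar> * (D * coord_norm (u k)))"
      using D by (intro sum_mono mult_left_mono order_trans[OF iter] mult_right_mono coord_norm_nonneg) auto
    also have "\<dots> = (\<Sum>i<m. \<bar>e i\<bar>) * (D * coord_norm (u k))" by (simp add: sum_distrib_right)
    also have "\<dots> \<le> (C * coord_norm (u l)) * (D * coord_norm (u k))"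
      using C(2)[of e] D0 by (intro mult_right_mono) (auto simp: ge coord_norm_nonneg)
    finally show ?thesis by (simp add: mult_ac)
  qed
  then show ?thesis using C D0 by (intro exI[of _ "D * C"]) auto
qed

section \<open>Spectral radius and decay of powers\<close>

lemma pow_mat_commute:
  fixes A :: "'a::semiring_1 mat"
  assumes A: "A \<in> carrier_mat n n"
  shows "A * A ^\<^sub>m k = A ^\<^sub>m k * A"
proof (induction k)
  case (Suc k)
  have "A * A ^\<^sub>m Suc k = (A * A ^\<^sub>m k) * A"
    using A by (simp add: assoc_mult_mat[of A n n "A ^\<^sub>m k" n A n])
  then show ?case using Suc by simp
qed (use A in simp)

lemma pow_mat_smult:
  fixes A :: "'a::comm_ring_1 mat"
  assumes A: "A \<in> carrier_mat n n"
  shows "(c \<cdot>\<^sub>m A) ^\<^sub>m k = c ^ k \<cdot>\<^sub>m (A ^\<^sub>m k)"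
proof (induction k)
  case (Suc k)
  have "(c ^ k \<cdot>\<^sub>m (A ^\<^sub>m k)) * (c \<cdot>\<^sub>m A) = c \<cdot>\<^sub>m (c ^ k \<cdot>\<^sub>m (A ^\<^sub>m k * A))"
    using A by (simp add: mult_smult_assoc_mat[of _ n n _ n] mult_smult_distrib[of _ n n _ n])
  then show ?case using Suc A by (auto simp: mult_ac intro!: eq_matI)
qed (use A in auto)

text \<open>If the spectral radius is less than \<open>q < 1\<close>, then \<open>A / q\<close> has spectral radius less than one, so its powers
are bounded and those of \<open>A\<close> decay like \<open>q\<^sup>k\<close>.  Conversely, decaying powers applied to an eigenvector
force the eigenvalue into the open unit disc.\<close>

lemma spectral_radius_less_1_iff_powers_decay:
  fixes A :: "real mat"
  assumes A: "A \<in> carrier_mat n n" and n: "0 < n"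
  shows "real_spectral_radius A < 1 \<longleftrightarrow>
    (\<exists>C>0. \<exists>\<beta>>0. \<forall>k. \<forall>i<n. \<forall>j<n. \<bar>(A ^\<^sub>m k) $$ (i, j)\<bar> \<le> C * exp (- \<beta> * real k))" (is "_ \<longleftrightarrow> ?decay")
proof
  let ?A = "map_mat complex_of_real A"
  have cA: "?A \<in> carrier_mat n n" using A by simp
  have pow: "?A ^\<^sub>m k = map_mat complex_of_real (A ^\<^sub>m k)" for k
    by (rule of_real_hom.mat_hom_pow[OF A, symmetric])
  {
    assume less: "real_spectral_radius A < 1"
    define r where "r = spectral_radius ?A"
    define q where "q = (r + 1) / 2"
    have "0 \<le> r" using spectral_radius_mem_max(1)[OF cA n] by (auto simp: r_def)
    then have q: "0 < q" "q < 1" "r < q" using less by (auto simp: q_def r_def real_spectral_radius_def)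
    define B where "B = complex_of_real (1 / q) \<cdot>\<^sub>m ?A"
    have B: "B \<in> carrier_mat n n" using A by (simp add: B_def)
    have "spectral_radius B < 1"
    proof -
      obtain b where b: "b \<in> spectrum B" "spectral_radius B = norm b"
        using spectral_radius_mem_max(1)[OF B n] by auto
      then obtain v where v: "v \<in> carrier_vec n" "v \<noteq> 0\<^sub>v n" "B *\<^sub>v v = b \<cdot>\<^sub>v v"
        using B by (auto simp: spectrum_def eigenvalue_def eigenvector_def)
      have "?A = complex_of_real q \<cdot>\<^sub>m B" using q by (auto simp: B_def intro!: eq_matI)
      moreover have "(complex_of_real q \<cdot>\<^sub>m B) *\<^sub>v v = complex_of_real q \<cdot>\<^sub>v (B *\<^sub>v v)"
      proof (rule eq_vecI)
        fix i assume "i < dim_vec (complex_of_real q \<cdot>\<^sub>v (B *\<^sub>v v))"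
        then have "i < n" using B by simp
        then show "((complex_of_real q \<cdot>\<^sub>m B) *\<^sub>v v) $ i = (complex_of_real q \<cdot>\<^sub>v (B *\<^sub>v v)) $ i"
          using B mult_mat_vec_index[of "complex_of_real q \<cdot>\<^sub>m B" n n v i] mult_mat_vec_index[OF B v(1), of i] v(1)
          by (simp add: sum_distrib_left mult.assoc del: index_mult_mat_vec)
      qed (use B in simp)
      ultimately have "?A *\<^sub>v v = complex_of_real q \<cdot>\<^sub>v (B *\<^sub>v v)" by simp
      then have "?A *\<^sub>v v = (complex_of_real q * b) \<cdot>\<^sub>v v" using v by (simp add: smult_smult_assoc)
      then have "complex_of_real q * b \<in> spectrum ?A"
        using v A by (auto simp: spectrum_def eigenvalue_def eigenvector_def)
      then have "norm (complex_of_real q * b) \<le> r"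
        unfolding r_def by (intro spectral_radius_mem_max(2)[OF cA n]) auto
      then have "q * norm b \<le> r" using q by (simp add: norm_mult)
      then have "q * norm b < q" using q by linarith
      then have "norm b < 1" using q by simp
      then show ?thesis using b by simp
    qed
    then obtain c where c: "\<And>k. norm_bound (B ^\<^sub>m k) c"
      using spectral_radius_jnf_norm_bound_less_1_upper_triangular[OF B] by blast
    have "\<bar>(A ^\<^sub>m k) $$ (i, j)\<bar> \<le> (\<bar>c\<bar> + 1) * exp (- (- ln q) * real k)" if "i < n" "j < n" for k i j
    proof -
      have Ak: "A ^\<^sub>m k \<in> carrier_mat n n" using A by simp
      have Bk: "B ^\<^sub>m k = complex_of_real (1 / q) ^ k \<cdot>\<^sub>m map_mat complex_of_real (A ^\<^sub>m k)"
        unfolding B_def pow_mat_smult[OF cA] pow ..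
      have "norm ((B ^\<^sub>m k) $$ (i, j)) \<le> c"
        using c[of k] that B by (simp add: norm_bound_def)
      also have "norm ((B ^\<^sub>m k) $$ (i, j)) = \<bar>(A ^\<^sub>m k) $$ (i, j)\<bar> / q ^ k"
        unfolding Bk using that carrier_matD[OF Ak] carrier_matD[OF A] q
        by (simp add: norm_mult norm_power norm_divide power_divide)
      finally have "\<bar>(A ^\<^sub>m k) $$ (i, j)\<bar> \<le> c * q ^ k" using q by (simp add: field_simps)
      also have "\<dots> \<le> (\<bar>c\<bar> + 1) * q ^ k" using q by (intro mult_right_mono) auto
      also have "q ^ k = exp (- (- ln q) * real k)"
        using q by (simp add: exp_of_nat2_mult)
      finally show ?thesis .
    qed
    moreover have "0 < - ln q" using q by simp
    moreover have "0 < \<bar>c\<bar> + 1" by simp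
    ultimately show ?decay by blast
  }
  {
    assume ?decay
    then obtain C \<beta> where C: "0 < C" "0 < \<beta>"
      "\<And>k i j. i < n \<Longrightarrow> j < n \<Longrightarrow> \<bar>(A ^\<^sub>m k) $$ (i, j)\<bar> \<le> C * exp (- \<beta> * real k)" by blast
    obtain ev where ev: "ev \<in> spectrum ?A" "spectral_radius ?A = norm ev"
      using spectral_radius_mem_max(1)[OF cA n] by auto
    then obtain v where v: "eigenvector ?A v ev" by (auto simp: spectrum_def eigenvalue_def)
    then have vn: "v \<in> carrier_vec n" "v \<noteq> 0\<^sub>v n" using A by (auto simp: eigenvector_def)
    then obtain i where i: "i < n" "v $ i \<noteq> 0" by (metis carrier_vecD eq_vecI index_zero_vec)
    have "norm ev < 1"
    proof (rule ccontr)
      assume "\<not> norm ev < 1"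
      have bound: "norm (v $ i) \<le> C * exp (- \<beta> * real k) * (\<Sum>j<n. norm (v $ j))" for k
      proof -
        have "norm (v $ i) \<le> norm ev ^ k * norm (v $ i)"
          using \<open>\<not> norm ev < 1\<close> by (simp add: mult_le_cancel_right1 one_le_power)
        also have "\<dots> = norm ((ev ^ k \<cdot>\<^sub>v v) $ i)" using i vn by (simp add: norm_mult norm_power)
        also have "(ev ^ k \<cdot>\<^sub>v v) $ i = (\<Sum>j<n. complex_of_real ((A ^\<^sub>m k) $$ (i, j)) * v $ j)"
          unfolding eigenvector_pow[OF cA v, symmetric] pow
          using mult_mat_vec_index[of "map_mat complex_of_real (A ^\<^sub>m k)" n n v i] i vn A by auto
        also have "norm \<dots> \<le> (\<Sum>j<n. C * exp (- \<beta> * real k) * norm (v $ j))"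
          using C(3)[OF i(1)] by (intro sum_norm_le) (auto simp: norm_mult intro!: mult_right_mono)
        also have "\<dots> = C * exp (- \<beta> * real k) * (\<Sum>j<n. norm (v $ j))"
          by (simp add: sum_distrib_left)
        finally show ?thesis .
      qed
      have "(\<lambda>k. exp (- \<beta>) ^ k) \<longlonglongrightarrow> 0" using C by (intro LIMSEQ_realpow_zero) auto
      then have lim: "(\<lambda>k. exp (- \<beta> * real k)) \<longlonglongrightarrow> 0"
        unfolding exp_of_nat2_mult .
      have "(\<lambda>k. C * exp (- \<beta> * real k) * (\<Sum>j<n. norm (v $ j))) \<longlonglongrightarrow> C * 0 * (\<Sum>j<n. norm (v $ j))"
        by (intro tendsto_intros lim)
      then have "norm (v $ i) \<le> C * 0 * (\<Sum>j<n. norm (v $ j))"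
        using bound by (intro LIMSEQ_le_const) auto
      then show False using i by simp
    qed
    then show "real_spectral_radius A < 1" using ev by (simp add: real_spectral_radius_def)
  }
qed

section \<open>Exponential decay\<close>

definition exp_decay :: "nat \<Rightarrow> (nat \<Rightarrow> nat \<Rightarrow> real) \<Rightarrow> bool" where
  "exp_decay N f \<longleftrightarrow> (\<exists>C>0. \<exists>\<beta>>0. \<forall>k. \<forall>s<N. f k s \<le> C * exp (- \<beta> * real k))"

lemma exp_decay_bound:
  assumes "exp_decay N f" "0 \<le> c" "\<And>k s. s < N \<Longrightarrow> g k s \<le> c * f k s"
  shows "exp_decay N g"
proof -
  obtain C \<beta> where C: "0 < C" "0 < \<beta>" "\<And>k s. s < N \<Longrightarrow> f k s \<le> C * exp (- \<beta> * real k)"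
    using assms(1) unfolding exp_decay_def by blast
  have "g k s \<le> (c * C + 1) * exp (- \<beta> * real k)" if "s < N" for k s
  proof -
    have "g k s \<le> c * (C * exp (- \<beta> * real k))"
      using assms(3)[OF that, of k] mult_left_mono[OF C(3)[OF that, of k] assms(2)] by linarith
    also have "\<dots> \<le> c * (C * exp (- \<beta> * real k)) + exp (- \<beta> * real k)" by simp
    also have "\<dots> = (c * C + 1) * exp (- \<beta> * real k)" by (simp add: distrib_right mult.assoc)
    finally show ?thesis .
  qed
  moreover have "0 < c * C + 1" using assms(2) C by (simp add: add_nonneg_pos)
  ultimately show ?thesis using C(2) unfolding exp_decay_def by blast
qed

lemma exp_decay_shift:
  assumes "exp_decay N f" "0 \<le> c" "\<And>k s. s < N \<Longrightarrow> g (Suc k) s \<le> c * f k s"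
  shows "exp_decay N g"
proof -
  obtain C \<beta> where C: "0 < C" "0 < \<beta>" "\<And>k s. s < N \<Longrightarrow> f k s \<le> C * exp (- \<beta> * real k)"
    using assms(1) unfolding exp_decay_def by blast
  define G where "G = 1 + (\<Sum>s<N. \<bar>g 0 s\<bar>) + c * C * exp \<beta>"
  have cC: "0 \<le> c * C * exp \<beta>" using assms(2) C by simp
  have sum0: "0 \<le> (\<Sum>s<N. \<bar>g 0 s\<bar>)" by (intro sum_nonneg) auto
  have "g k s \<le> G * exp (- \<beta> * real k)" if s: "s < N" for k s
  proof (cases k)
    case 0
    have "\<bar>g 0 s\<bar> \<le> (\<Sum>s<N. \<bar>g 0 s\<bar>)" using s by (intro member_le_sum) auto
    then show ?thesis using 0 cC by (simp add: G_def)
  next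
    case (Suc m)
    have "g k s \<le> c * (C * exp (- \<beta> * real m))"
      using assms(3)[OF s, of m] mult_left_mono[OF C(3)[OF s, of m] assms(2)] Suc by simp
    also have "\<dots> = c * C * exp \<beta> * exp (- \<beta> * real k)"
      by (simp add: Suc mult.assoc exp_add[symmetric] algebra_simps)
    also have "\<dots> \<le> G * exp (- \<beta> * real k)"
      using sum0 by (intro mult_right_mono) (auto simp: G_def)
    finally show ?thesis .
  qed
  moreover have "0 < G" using cC sum0 unfolding G_def by linarith
  ultimately show ?thesis using C(2) unfolding exp_decay_def by blast
qed

lemma exp_decay_sum:
  assumes "finite V" "\<And>v. v \<in> V \<Longrightarrow> exp_decay N (f v)"
  shows "exp_decay N (\<lambda>k s. \<Sum>v\<in>V. f v k s)"
  using assms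
proof (induction V)
  case empty
  then show ?case unfolding exp_decay_def by (auto intro!: exI[of _ 1])
next
  case (insert v V)
  obtain C \<beta> where C: "0 < C" "0 < \<beta>" "\<And>k s. s < N \<Longrightarrow> f v k s \<le> C * exp (- \<beta> * real k)"
    using insert.prems[of v] unfolding exp_decay_def by blast
  obtain C' \<beta>' where C': "0 < C'" "0 < \<beta>'" "\<And>k s. s < N \<Longrightarrow> (\<Sum>v\<in>V. f v k s) \<le> C' * exp (- \<beta>' * real k)"
    using insert unfolding exp_decay_def by blast
  have "(\<Sum>v\<in>insert v V. f v k s) \<le> (C + C') * exp (- min \<beta> \<beta>' * real k)" if "s < N" for k s
  proof -
    have "f v k s \<le> C * exp (- min \<beta> \<beta>' * real k)"
      using C(1) by (intro order_trans[OF C(3)[OF that, of k]]) (auto intro!: mult_right_mono)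
    moreover have "(\<Sum>v\<in>V. f v k s) \<le> C' * exp (- min \<beta> \<beta>' * real k)"
      using C'(1) by (intro order_trans[OF C'(3)[OF that, of k]]) (auto intro!: mult_right_mono)
    ultimately show ?thesis using insert.hyps by (simp add: distrib_right)
  qed
  then show ?case unfolding exp_decay_def
    using C C' by (intro exI[of _ "C + C'"] conjI exI[of _ "min \<beta> \<beta>'"]) auto
qed

text \<open>There are finitely many initial states, so the constants can be chosen uniformly.\<close>

lemma exp_decay_pointwise:
  "exp_decay N f \<longleftrightarrow> (\<forall>s<N. \<exists>C>0. \<exists>\<beta>>0. \<forall>k. f k s \<le> C * exp (- \<beta> * real k))"
proof
  assume all: "\<forall>s<N. \<exists>C>0. \<exists>\<beta>>0. \<forall>k. f k s \<le> C * exp (- \<beta> * real k)"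
  have "exp_decay N (\<lambda>k s. if s = t then f k t else 0)" if t: "t < N" for t
  proof -
    obtain C \<beta> where C: "0 < C" "0 < \<beta>" "\<And>k. f k t \<le> C * exp (- \<beta> * real k)" using all t by blast
    have "(if s = t then f k t else 0) \<le> C * exp (- \<beta> * real k)" for k s
      using C(1) C(3)[of k] by simp
    then show ?thesis unfolding exp_decay_def using C(1,2) by blast
  qed
  then have "exp_decay N (\<lambda>k s. \<Sum>t<N. if s = t then f k t else 0)"
    by (intro exp_decay_sum) auto
  then show "exp_decay N f"
    by (rule exp_decay_bound[of _ _ 1]) auto
qed (unfold exp_decay_def, blast)

lemma exp_decay_exp: "0 < \<beta> \<Longrightarrow> exp_decay N (\<lambda>k s. exp (- \<beta> * real k))"
  unfolding exp_decay_def by (intro exI[of _ 1] conjI exI[of _ \<beta>]) auto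

text \<open>Submultiplicativity makes the limit exist; of a divergent sequence, \<open>lim\<close> is an unspecified number.\<close>

lemma root_limit_less_1_iff:
  fixes b :: "nat \<Rightarrow> real"
  assumes p: "0 < p" and nonneg: "\<And>k. 0 \<le> b k" and C: "0 < C"
    and sub: "\<And>k l. b (k + l) \<le> C * b k * b l"
  shows "lim (\<lambda>k. b k powr (1 / (real p * real k))) < 1 \<longleftrightarrow>
    (\<exists>C>0. \<exists>\<beta>>0. \<forall>k. b k \<le> C * exp (- \<beta> * real k))"
proof -
  obtain l where l: "(\<lambda>k. b k powr (1 / real k)) \<longlonglongrightarrow> l"
    using submultiplicative_root_convergent[OF nonneg C sub] by (auto simp: convergent_def)
  have "(\<lambda>k. (b k powr (1 / real k)) powr (1 / real p)) \<longlonglongrightarrow> l powr (1 / real p)"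
    by (intro tendsto_powr'[OF l tendsto_const]) (use p in auto)
  then have lim_p: "(\<lambda>k. b k powr (1 / (real p * real k))) \<longlonglongrightarrow> l powr (1 / real p)"
    by (simp add: powr_powr mult.commute)
  define L where "L = l powr (1 / real p)"
  have L: "(\<lambda>k. b k powr (1 / (real p * real k))) \<longlonglongrightarrow> L" using lim_p by (simp add: L_def)
  have L0: "0 \<le> L" by (simp add: L_def)
  have "L < 1 \<longleftrightarrow> (\<exists>C>0. \<exists>\<beta>>0. \<forall>k. b k \<le> C * exp (- \<beta> * real k))"
  proof
    assume "L < 1"
    define q where "q = (L + 1) / 2"
    have q: "0 < q" "q < 1" "L < q" using \<open>L < 1\<close> L0 by (auto simp: q_def)
    obtain K where K: "\<And>k. K \<le> k \<Longrightarrow> b k powr (1 / (real p * real k)) < q"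
      using order_tendstoD(2)[OF L q(3)] by (auto simp: eventually_sequentially)
    define \<beta> where "\<beta> = - real p * ln q"
    have \<beta>: "0 < \<beta>" using p q by (simp add: \<beta>_def mult_pos_neg)
    define D where "D = 1 + (\<Sum>k\<le>K. b k * exp (\<beta> * real k))"
    have D0: "0 \<le> (\<Sum>k\<le>K. b k * exp (\<beta> * real k))" using nonneg by (intro sum_nonneg) auto
    have "b k \<le> D * exp (- \<beta> * real k)" for k
    proof (cases "k \<le> K")
      case True
      have "b k * exp (\<beta> * real k) \<le> (\<Sum>k\<le>K. b k * exp (\<beta> * real k))"
        using True nonneg by (intro member_le_sum[of k _ "\<lambda>k. b k * exp (\<beta> * real k)"]) auto
      then have "b k * exp (\<beta> * real k) \<le> D" by (simp add: D_def)
      then have "b k * exp (\<beta> * real k) * exp (- \<beta> * real k) \<le> D * exp (- \<beta> * real k)"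
        by (intro mult_right_mono) auto
      then show ?thesis by (simp add: mult.assoc exp_add[symmetric])
    next
      case False
      then have k: "0 < k" by simp
      then have pk: "0 < real p * real k" using p by auto
      have "b k = (b k powr (1 / (real p * real k))) powr (real p * real k)"
        using p k nonneg[of k] by (simp add: powr_powr)
      also have "\<dots> \<le> q powr (real p * real k)"
        using K[of k] False pk by (intro powr_mono2) auto
      also have "\<dots> = exp (- \<beta> * real k)" using q by (simp add: powr_def \<beta>_def)
      also have "\<dots> \<le> D * exp (- \<beta> * real k)" using D0 by (simp add: D_def)
      finally show ?thesis .
    qed
    moreover have "0 < D" using D0 by (simp add: D_def)
    ultimately show "\<exists>C>0. \<exists>\<beta>>0. \<forall>k. b k \<le> C * exp (- \<beta> * real k)" using \<beta> by blast
  next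
    assume "\<exists>C>0. \<exists>\<beta>>0. \<forall>k. b k \<le> C * exp (- \<beta> * real k)"
    then obtain C \<beta> where C: "0 < C" "0 < \<beta>" "\<And>k. b k \<le> C * exp (- \<beta> * real k)" by blast
    have "(\<lambda>k. C powr (1 / real p * (1 / real k)) * exp (- \<beta> / real p)) \<longlonglongrightarrow> C powr (1 / real p * 0) * exp (- \<beta> / real p)"
      using C(1) by (intro tendsto_intros lim_1_over_n) auto
    then have "(\<lambda>k. C powr (1 / (real p * real k)) * exp (- \<beta> / real p)) \<longlonglongrightarrow> exp (- \<beta> / real p)"
      using C(1) by simp
    then have "L \<le> exp (- \<beta> / real p)"
    proof (rule LIMSEQ_le[OF L], intro exI[of _ 1] allI impI)
      fix k :: nat assume k: "1 \<le> k"
      have "b k powr (1 / (real p * real k)) \<le> (C * exp (- \<beta> * real k)) powr (1 / (real p * real k))"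
        using C(3) nonneg by (intro powr_mono2) auto
      also have "\<dots> = C powr (1 / (real p * real k)) * exp (- \<beta> / real p)"
        using C(1) k p by (simp add: powr_mult exp_powr_real)
      finally show "b k powr (1 / (real p * real k)) \<le> C powr (1 / (real p * real k)) * exp (- \<beta> / real p)" .
    qed
    also have "\<dots> < 1" using C(2) p by simp
    finally show "L < 1" .
  qed
  then show ?thesis using limI[OF L] by simp
qed

section \<open>The transfer matrix\<close>

lemma diag_block_mat_uniform:
  assumes "\<And>A. A \<in> set As \<Longrightarrow> A \<in> carrier_mat D D"
  shows "diag_block_mat As \<in> carrier_mat (length As * D) (length As * D) \<and>
    (\<forall>i < length As. \<forall>j < length As. \<forall>a < D. \<forall>b < D.
      diag_block_mat As $$ (i * D + a, j * D + b) = (if i = j then (As ! i) $$ (a, b) else 0))"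
  using assms
proof (induction As)
  case (Cons A As)
  have A: "A \<in> carrier_mat D D" using Cons.prems by simp
  have tail: "diag_block_mat As \<in> carrier_mat (length As * D) (length As * D)"
    and entries: "\<And>i j a b. i < length As \<Longrightarrow> j < length As \<Longrightarrow> a < D \<Longrightarrow> b < D \<Longrightarrow>
      diag_block_mat As $$ (i * D + a, j * D + b) = (if i = j then (As ! i) $$ (a, b) else 0)"
    using Cons by auto
  have block: "diag_block_mat (A # As) =
      four_block_mat A (0\<^sub>m D (length As * D)) (0\<^sub>m (length As * D) D) (diag_block_mat As)"
    using A tail by (simp add: Let_def)
  have "diag_block_mat (A # As) $$ (i * D + a, j * D + b) = (if i = j then ((A # As) ! i) $$ (a, b) else 0)"
    if "i < length (A # As)" "j < length (A # As)" "a < D" "b < D" for i j a b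
  proof -
    have bounds: "i * D + a < D + length As * D" "j * D + b < D + length As * D"
      using block_index_less[of i "Suc (length As)" a D] block_index_less[of j "Suc (length As)" b D] that by auto
    show ?thesis
      unfolding block using A tail bounds that entries[of "i - 1" "j - 1" a b]
      by (cases i; cases j) (auto simp: add.assoc)
  qed
  moreover have "diag_block_mat (A # As) \<in> carrier_mat (length (A # As) * D) (length (A # As) * D)"
    unfolding block using A tail by auto
  ultimately show ?case by blast
qed simp

text \<open>The \<open>p\<close>th transfer matrix of the switched
system is this matrix for the Kronecker powers, so tensors enter below merely as vectors of length \<open>d\<^sup>p\<close>.\<close>

definition block_transfer :: "nat \<Rightarrow> nat \<Rightarrow> real mat \<Rightarrow> (nat \<Rightarrow> real mat) \<Rightarrow> real mat" where
  "block_transfer N D P B = kron_mat (transpose_mat P) (1\<^sub>m D) * diag_block_mat (map B [0..<N])"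

locale markov_product =
  fixes N D :: nat and P :: "real mat" and B :: "nat \<Rightarrow> real mat"
  assumes transition: "transition_matrix N P"
    and carrier: "\<And>i. i < N \<Longrightarrow> B i \<in> carrier_mat D D"
begin

abbreviation "T \<equiv> block_transfer N D P B"

text \<open>The \<open>j\<close>th block is the expectation of \<open>X\<^sub>w v\<close> on the event that the chain is in state \<open>j\<close> at time \<open>k\<close>.\<close>

definition state_moment :: "nat \<Rightarrow> nat \<Rightarrow> real vec \<Rightarrow> real vec" where
  "state_moment k s v = vec (N * D) (\<lambda>r. path_exp N P k s
     (\<lambda>w e. if e = r div D then (word_prod D B w *\<^sub>v v) $ (r mod D) else 0))"

lemma P_carrier: "P \<in> carrier_mat N N"
  using transition by (simp add: transition_matrix_def)

lemma diag_carrier: "diag_block_mat (map B [0..<N]) \<in> carrier_mat (N * D) (N * D)"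
proof -
  have "A \<in> carrier_mat D D" if "A \<in> set (map B [0..<N])" for A using that carrier by auto
  from diag_block_mat_uniform[of "map B [0..<N]" D, OF this] show ?thesis by simp
qed

lemma diag_index:
  assumes "i < N" "j < N" "a < D" "b < D"
  shows "diag_block_mat (map B [0..<N]) $$ (i * D + a, j * D + b) = (if i = j then B i $$ (a, b) else 0)"
proof -
  have "A \<in> carrier_mat D D" if "A \<in> set (map B [0..<N])" for A using that carrier by auto
  from diag_block_mat_uniform[of "map B [0..<N]" D, OF this] show ?thesis using assms by simp
qed

lemma kron_carrier: "kron_mat (transpose_mat P) (1\<^sub>m D) \<in> carrier_mat (N * D) (N * D)"
  using kron_mat_carrier[of "transpose_mat P" N N "1\<^sub>m D" D D] P_carrier by simp

lemma T_carrier: "T \<in> carrier_mat (N * D) (N * D)"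
  unfolding block_transfer_def using kron_carrier diag_carrier by simp

lemma T_mult_index:
  assumes z: "z \<in> carrier_vec (N * D)" and j: "j < N" and a: "a < D"
  shows "(T *\<^sub>v z) $ (j * D + a) = (\<Sum>i<N. \<Sum>b<D. P $$ (i, j) * (B i $$ (a, b) * z $ (i * D + b)))"
proof -
  define y where "y = diag_block_mat (map B [0..<N]) *\<^sub>v z"
  have y: "y \<in> carrier_vec (N * D)" unfolding y_def using diag_carrier z by simp
  have yi: "y $ (i * D + a) = (\<Sum>b<D. B i $$ (a, b) * z $ (i * D + b))" if i: "i < N" for i
  proof -
    have "y $ (i * D + a) = (\<Sum>i'<N. \<Sum>b<D. diag_block_mat (map B [0..<N]) $$ (i * D + a, i' * D + b) * z $ (i' * D + b))"
      unfolding y_def mult_mat_vec_index[OF diag_carrier z block_index_less[OF i a]] sum_blocks ..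
    also have "\<dots> = (\<Sum>i'<N. if i' = i then (\<Sum>b<D. B i $$ (a, b) * z $ (i * D + b)) else 0)"
      using diag_index[OF i _ a] by (intro sum.cong) auto
    finally show ?thesis using i by simp
  qed
  have "(T *\<^sub>v z) $ (j * D + a) = (kron_mat (transpose_mat P) (1\<^sub>m D) *\<^sub>v y) $ (j * D + a)"
    unfolding block_transfer_def y_def using kron_carrier diag_carrier z by (simp add: assoc_mult_mat_vec)
  also have "\<dots> = (\<Sum>i<N. \<Sum>b<D. kron_mat (transpose_mat P) (1\<^sub>m D) $$ (j * D + a, i * D + b) * y $ (i * D + b))"
    unfolding mult_mat_vec_index[OF kron_carrier y block_index_less[OF j a]] sum_blocks ..
  also have "\<dots> = (\<Sum>i<N. \<Sum>b<D. if b = a then P $$ (i, j) * y $ (i * D + a) else 0)"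
    using P_carrier j a block_index_less by (intro sum.cong refl) (auto simp: kron_mat_def)
  also have "\<dots> = (\<Sum>i<N. P $$ (i, j) * y $ (i * D + a))" using a by simp
  also have "\<dots> = (\<Sum>i<N. \<Sum>b<D. P $$ (i, j) * (B i $$ (a, b) * z $ (i * D + b)))"
    using yi by (simp add: sum_distrib_left)
  finally show ?thesis .
qed

lemma state_moment_carrier: "state_moment k s v \<in> carrier_vec (N * D)"
  by (simp add: state_moment_def)

lemma state_moment_index:
  assumes "j < N" "a < D"
  shows "state_moment k s v $ (j * D + a) =
    path_exp N P k s (\<lambda>w e. if e = j then (word_prod D B w *\<^sub>v v) $ a else 0)"
proof -
  have "(j * D + a) div D = j" "(j * D + a) mod D = a" using assms by auto
  then show ?thesis using block_index_less[OF assms] unfolding state_moment_def by (simp only: index_vec)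
qed

text \<open>Split off the last transition: from state \<open>i\<close>, the matrix \<open>B i\<close> acts and the chain then moves to \<open>j\<close> with
probability \<open>P\<^sub>i\<^sub>j\<close>, which is how \<open>T\<close> is composed of its blocks.\<close>

lemma T_state_moment:
  assumes s: "s < N" and v: "v \<in> carrier_vec D"
  shows "T *\<^sub>v state_moment k s v = state_moment (Suc k) s v"
proof (rule eq_vecI)
  fix r assume "r < dim_vec (state_moment (Suc k) s v)"
  then have r0: "r < N * D" by (simp add: state_moment_def)
  define j a where "j = r div D" and "a = r mod D"
  have j: "j < N" and a: "a < D" and r: "r = j * D + a"
    using block_index_div_mod[OF r0] by (auto simp: j_def a_def)
  have "(T *\<^sub>v state_moment k s v) $ r = (\<Sum>i<N. \<Sum>b<D. P $$ (i, j) * (B i $$ (a, b) *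
      path_exp N P k s (\<lambda>w e. if e = i then (word_prod D B w *\<^sub>v v) $ b else 0)))"
    unfolding r T_mult_index[OF state_moment_carrier j a]
    by (intro sum.cong refl) (simp add: state_moment_index)
  also have "\<dots> = path_exp N P k s (\<lambda>w e. \<Sum>i<N. \<Sum>b<D. P $$ (i, j) * (B i $$ (a, b) *
      (if e = i then (word_prod D B w *\<^sub>v v) $ b else 0)))"
    by (simp only: path_exp_sum path_exp_cmult)
  also have "\<dots> = path_exp N P k s (\<lambda>w e. \<Sum>j'<N. P $$ (e, j') *
      (if j' = j then (word_prod D B (w @ [e]) *\<^sub>v v) $ a else 0))"
  proof (rule path_exp_cong[OF transition s])
    fix w e assume w: "set w \<subseteq> {..<N}" and e: "e < N"
    have W: "word_prod D B w \<in> carrier_mat D D" by (rule word_prod_carrier[OF carrier w])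
    have Wv: "word_prod D B w *\<^sub>v v \<in> carrier_vec D" using W v by simp
    have "(\<Sum>i<N. \<Sum>b<D. P $$ (i, j) * (B i $$ (a, b) * (if e = i then (word_prod D B w *\<^sub>v v) $ b else 0)))
        = (\<Sum>i<N. if i = e then P $$ (e, j) * (\<Sum>b<D. B e $$ (a, b) * (word_prod D B w *\<^sub>v v) $ b) else 0)"
      unfolding sum_distrib_left by (intro sum.cong refl) auto
    also have "\<dots> = P $$ (e, j) * (B e *\<^sub>v (word_prod D B w *\<^sub>v v)) $ a"
      using e mult_mat_vec_index[OF carrier[OF e] Wv a] by simp
    also have "B e *\<^sub>v (word_prod D B w *\<^sub>v v) = word_prod D B (w @ [e]) *\<^sub>v v"
      using word_prod_snoc[OF carrier w e] assoc_mult_mat_vec[OF carrier[OF e] W v] by simp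
    finally show "(\<Sum>i<N. \<Sum>b<D. P $$ (i, j) * (B i $$ (a, b) * (if e = i then (word_prod D B w *\<^sub>v v) $ b else 0)))
        = (\<Sum>j'<N. P $$ (e, j') * (if j' = j then (word_prod D B (w @ [e]) *\<^sub>v v) $ a else 0))"
      using j by (simp add: if_distrib[of "\<lambda>x. _ * x"] cong: if_cong)
  qed
  also have "\<dots> = state_moment (Suc k) s v $ r"
    unfolding r state_moment_index[OF j a] path_exp_Suc_last ..
  finally show "(T *\<^sub>v state_moment k s v) $ r = state_moment (Suc k) s v $ r" .
qed (use T_carrier in \<open>simp add: state_moment_def\<close>)

lemma T_pow_state_moment:
  assumes s: "s < N" and v: "v \<in> carrier_vec D"
  shows "T ^\<^sub>m k *\<^sub>v state_moment 0 s v = state_moment k s v"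
proof (induction k)
  case (Suc k)
  have "T ^\<^sub>m Suc k *\<^sub>v state_moment 0 s v = (T * T ^\<^sub>m k) *\<^sub>v state_moment 0 s v"
    by (simp add: pow_mat_commute[OF T_carrier])
  also have "\<dots> = T *\<^sub>v (T ^\<^sub>m k *\<^sub>v state_moment 0 s v)"
    using T_carrier state_moment_carrier by (intro assoc_mult_mat_vec) auto
  finally show ?case using Suc T_state_moment[OF s v] by simp
next
  case 0
  have "dim_row T = N * D" using T_carrier by simp
  then show ?case using one_mult_mat_vec[OF state_moment_carrier] by simp
qed

lemma state_moment_unit:
  assumes s: "s < N" and b: "b < D"
  shows "state_moment 0 s (unit_vec D b) = unit_vec (N * D) (s * D + b)"
proof (rule eq_vecI)
  fix r assume "r < dim_vec (unit_vec (N * D) (s * D + b) :: real vec)"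
  then have r: "r < N * D" by simp
  have "r div D = s \<and> r mod D = b \<longleftrightarrow> r = s * D + b" using b by auto
  then show "state_moment 0 s (unit_vec D b) $ r = unit_vec (N * D) (s * D + b) $ r"
    using r b block_index_div_mod[OF r] block_index_less[OF s b] by (auto simp: state_moment_def)
qed (simp add: state_moment_def)

lemma T_pow_entry:
  assumes s: "s < N" and b: "b < D" and r: "r < N * D"
  shows "(T ^\<^sub>m k) $$ (r, s * D + b) = state_moment k s (unit_vec D b) $ r"
proof -
  have "state_moment k s (unit_vec D b) $ r = (T ^\<^sub>m k *\<^sub>v unit_vec (N * D) (s * D + b)) $ r"
    using T_pow_state_moment[OF s, of "unit_vec D b"] state_moment_unit[OF s b] by simp
  also have "\<dots> = (\<Sum>c<N * D. (T ^\<^sub>m k) $$ (r, c) * unit_vec (N * D) (s * D + b) $ c)"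
    using T_carrier r by (intro mult_mat_vec_index) auto
  also have "\<dots> = (\<Sum>c<N * D. if c = s * D + b then (T ^\<^sub>m k) $$ (r, c) else 0)"
    using block_index_less[OF s b] by (intro sum.cong) auto
  finally show ?thesis using block_index_less[OF s b] by simp
qed

lemma sum_state_moment:
  assumes s: "s < N" and a: "a < D"
  shows "(\<Sum>j<N. state_moment k s v $ (j * D + a)) = path_exp N P k s (\<lambda>w _. (word_prod D B w *\<^sub>v v) $ a)"
proof -
  have "(\<Sum>j<N. state_moment k s v $ (j * D + a))
      = path_exp N P k s (\<lambda>w e. \<Sum>j<N. if e = j then (word_prod D B w *\<^sub>v v) $ a else 0)"
    unfolding path_exp_sum using a by (intro sum.cong refl) (simp add: state_moment_index)
  also have "\<dots> = path_exp N P k s (\<lambda>w _. (word_prod D B w *\<^sub>v v) $ a)"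
    by (rule path_exp_cong[OF transition s]) simp
  finally show ?thesis .
qed

end

section \<open>Functionals that dominate the matrix norm\<close>

text \<open>\<open>F\<close> points from \<open>y\<close> to its nearest point \<open>k0\<close> of the cone.  Moving from \<open>k0\<close> in a direction of the cone
cannot decrease the distance, whence \<open>F\<close> is nonnegative on the cone; moving towards the apex as well
gives \<open>F(k0) = 0\<close>, so \<open>F(y) = - \<parallel>F\<parallel>\<^sup>2\<close>.\<close>

lemma closed_cone_separation:
  fixes K :: "(nat \<Rightarrow> real) set"
  assumes closed: "closed K"
    and supp: "\<And>f i. f \<in> K \<Longrightarrow> d \<le> i \<Longrightarrow> f i = 0"
    and cone: "\<And>f c. f \<in> K \<Longrightarrow> 0 \<le> c \<Longrightarrow> (\<lambda>i. c * f i) \<in> K"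
    and add: "\<And>f h. f \<in> K \<Longrightarrow> h \<in> K \<Longrightarrow> (\<lambda>i. f i + h i) \<in> K"
    and ne: "K \<noteq> {}"
    and y: "y \<notin> K" "\<And>i. d \<le> i \<Longrightarrow> y i = 0"
  shows "\<exists>F. (\<forall>k\<in>K. 0 \<le> (\<Sum>i<d. F i * k i)) \<and> (\<Sum>i<d. F i * y i) < 0"
proof -
  define q where "q k = (\<Sum>i<d. (k i - y i)\<^sup>2)" for k :: "nat \<Rightarrow> real"
  have zK: "(\<lambda>_. 0) \<in> K" using ne cone[of _ 0] by auto
  define box where "box = {k::nat \<Rightarrow> real. \<forall>i. k i \<in> {- (\<bar>y i\<bar> + sqrt (q (\<lambda>_. 0)))..\<bar>y i\<bar> + sqrt (q (\<lambda>_. 0))}}"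
  have q0: "0 \<le> q k" for k unfolding q_def by (intro sum_nonneg) auto
  have "compact (box \<inter> K)"
    unfolding box_def by (intro compact_Int_closed compact_coordinatewise closed) auto
  moreover have "(\<lambda>_. 0) \<in> box \<inter> K" using zK q0 by (auto simp: box_def intro: add_nonneg_nonneg order_trans[of _ 0])
  moreover have "continuous_on (box \<inter> K) q"
    unfolding q_def by (intro continuous_intros)
  ultimately obtain k0 where k0: "k0 \<in> box \<inter> K" and min0: "\<And>k. k \<in> box \<inter> K \<Longrightarrow> q k0 \<le> q k"
    using continuous_attains_inf[of "box \<inter> K" q] by blast
  have min: "q k0 \<le> q k" if "k \<in> K" for k
  proof (cases "q k \<le> q (\<lambda>_. 0)")
    case True
    have bound: "\<bar>k i\<bar> \<le> \<bar>y i\<bar> + sqrt (q (\<lambda>_. 0))" for i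
    proof (cases "i < d")
      case i: True
      have "(k i - y i)\<^sup>2 \<le> q k"
        unfolding q_def using i by (intro member_le_sum) auto
      then have "\<bar>k i - y i\<bar> \<le> sqrt (q (\<lambda>_. 0))" using True by (intro real_le_rsqrt) auto
      then show ?thesis by linarith
    next
      case False
      then show ?thesis using supp[OF that, of i] q0 by simp
    qed
    have "- (\<bar>y i\<bar> + sqrt (q (\<lambda>_. 0))) \<le> k i \<and> k i \<le> \<bar>y i\<bar> + sqrt (q (\<lambda>_. 0))" for i
      using bound[of i] by linarith
    then have "k \<in> box" unfolding box_def by simp
    then show ?thesis using min0 that by blast
  next
    case False
    then show ?thesis using min0[of "\<lambda>_. 0"] \<open>(\<lambda>_. 0) \<in> box \<inter> K\<close> by linarith
  qed
  define F where "F i = k0 i - y i" for i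
  have expand: "q (\<lambda>i. k0 i + t * k i) = q k0 + t * (2 * (\<Sum>i<d. F i * k i) + t * (\<Sum>i<d. (k i)\<^sup>2))" for t k
    unfolding q_def F_def sum_distrib_left sum.distrib[symmetric]
    by (intro sum.cong) (auto simp: power2_eq_square algebra_simps)
  \<comment> \<open>Only the first-order term matters for small \<open>t\<close>.\<close>
  have small: "0 \<le> a" if "\<And>t. 0 < t \<Longrightarrow> t \<le> 1 \<Longrightarrow> 0 \<le> a + t * b" for a b :: real
  proof (rule ccontr)
    assume "\<not> 0 \<le> a"
    define t where "t = min 1 (- a / (2 * (\<bar>b\<bar> + 1)))"
    have t: "0 < t" "t \<le> 1" using \<open>\<not> 0 \<le> a\<close> by (auto simp: t_def intro!: divide_neg_pos)
    have "t * b \<le> t * \<bar>b\<bar>" using t by (intro mult_left_mono) auto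
    also have "\<dots> \<le> (- a / (2 * (\<bar>b\<bar> + 1))) * (\<bar>b\<bar> + 1)" using t \<open>\<not> 0 \<le> a\<close>
      by (intro mult_mono) (auto simp: t_def)
    also have "\<dots> = - a / 2"
    proof -
      have "\<bar>b\<bar> + 1 \<noteq> 0" by linarith
      then show ?thesis by (simp add: field_simps)
    qed
    finally show False using that[OF t] \<open>\<not> 0 \<le> a\<close> by linarith
  qed
  have Fk: "0 \<le> (\<Sum>i<d. F i * k i)" if "k \<in> K" for k
  proof -
    have "0 \<le> 2 * (\<Sum>i<d. F i * k i)"
    proof (rule small)
      fix t :: real assume t: "0 < t" "t \<le> 1"
      have "(\<lambda>i. k0 i + t * k i) \<in> K" using k0 t that by (intro add cone) auto
      from min[OF this] show "0 \<le> 2 * (\<Sum>i<d. F i * k i) + t * (\<Sum>i<d. (k i)\<^sup>2)"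
        unfolding expand using t by (simp add: zero_le_mult_iff)
    qed
    then show ?thesis by simp
  qed
  have "0 \<le> - 2 * (\<Sum>i<d. F i * k0 i)"
  proof (rule small)
    fix t :: real assume t: "0 < t" "t \<le> 1"
    have "(\<lambda>i. (1 - t) * k0 i) \<in> K" using k0 t by (intro cone) auto
    also have "(\<lambda>i. (1 - t) * k0 i) = (\<lambda>i. k0 i + (- t) * k0 i)" by (auto simp: algebra_simps)
    finally have "q k0 \<le> q (\<lambda>i. k0 i + (- t) * k0 i)" by (rule min)
    then have "0 \<le> (- t) * (2 * (\<Sum>i<d. F i * k0 i) + (- t) * (\<Sum>i<d. (k0 i)\<^sup>2))"
      unfolding expand[of "- t" k0] by (simp only: le_add_same_cancel1)
    then show "0 \<le> - 2 * (\<Sum>i<d. F i * k0 i) + t * (\<Sum>i<d. (k0 i)\<^sup>2)"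
      using t by (simp add: zero_le_mult_iff mult_le_0_iff)
  qed
  then have Fk0: "(\<Sum>i<d. F i * k0 i) \<le> 0" by simp
  have "(\<Sum>i<d. (F i)\<^sup>2) \<noteq> 0"
  proof
    assume "(\<Sum>i<d. (F i)\<^sup>2) = 0"
    then have "F i = 0" if "i < d" for i
      using that by (subst (asm) sum_nonneg_eq_0_iff) auto
    then have "k0 i = y i" for i
      using y(2)[of i] supp[of k0 i] k0 by (cases "i < d") (auto simp: F_def)
    then have "k0 = y" by auto
    then show False using k0 y by auto
  qed
  then have "0 < (\<Sum>i<d. (F i)\<^sup>2)" using sum_nonneg[of "{..<d}" "\<lambda>i. (F i)\<^sup>2"] by force
  moreover have "(\<Sum>i<d. F i * y i) = (\<Sum>i<d. F i * k0 i) - (\<Sum>i<d. (F i)\<^sup>2)"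
    unfolding sum_subtractf[symmetric] by (intro sum.cong) (auto simp: F_def power2_eq_square algebra_simps)
  ultimately show ?thesis using Fk Fk0 by (intro exI[of _ F]) auto
qed

text \<open>The interior of the dual cone of a closed pointed cone is not empty.  For every \<open>y\<close> on the unit sphere
of the cone, pointedness places \<open>-y\<close> outside the cone, and separation yields a functional that is
nonnegative on the cone and positive at \<open>y\<close>.  By compactness a finite sum of these is positive on
the whole sphere.\<close>

lemma pointed_cone_positive_functional:
  fixes K :: "(nat \<Rightarrow> real) set"
  assumes closed: "closed K"
    and supp: "\<And>f i. f \<in> K \<Longrightarrow> d \<le> i \<Longrightarrow> f i = 0"
    and cone: "\<And>f c. f \<in> K \<Longrightarrow> 0 \<le> c \<Longrightarrow> (\<lambda>i. c * f i) \<in> K"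
    and add: "\<And>f h. f \<in> K \<Longrightarrow> h \<in> K \<Longrightarrow> (\<lambda>i. f i + h i) \<in> K"
    and pointed: "\<And>f. f \<in> K \<Longrightarrow> (\<lambda>i. - f i) \<in> K \<Longrightarrow> f = (\<lambda>_. 0)"
  shows "\<exists>F c. 0 < c \<and> (\<forall>k\<in>K. c * (\<Sum>i<d. \<bar>k i\<bar>) \<le> (\<Sum>i<d. F i * k i))"
proof -
  define S where "S = {f::nat \<Rightarrow> real. \<forall>i. f i \<in> (if i < d then {-1..1} else {0})} \<inter> (K \<inter> {f. (\<Sum>i<d. \<bar>f i\<bar>) = 1})"
  have "compact S"
    unfolding S_def
    by (intro compact_Int_closed compact_coordinatewise closed_Int closed closed_Collect_eq continuous_intros) auto
  have scaled: "(\<lambda>i. 1 / t * k i) \<in> S" if "k \<in> K" "t = (\<Sum>i<d. \<bar>k i\<bar>)" "t > 0" for k t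
  proof -
    have "\<bar>k i\<bar> \<le> t" if "i < d" for i
      using member_le_sum[of i "{..<d}" "\<lambda>i. \<bar>k i\<bar>"] that \<open>t = _\<close> by simp
    then have "\<bar>k i / t\<bar> \<le> 1" if "i < d" for i using that \<open>t > 0\<close> by simp
    then have "-1 \<le> k i / t \<and> k i / t \<le> 1" if "i < d" for i using that by (meson abs_le_iff minus_le_iff)
    moreover have "(\<Sum>i<d. \<bar>k i / t\<bar>) = 1"
      using that by (simp add: sum_divide_distrib[symmetric])
    moreover have "(\<lambda>i. 1 / t * k i) \<in> K" using that by (intro cone) auto
    ultimately show ?thesis using supp[OF \<open>k \<in> K\<close>] by (auto simp: S_def)
  qed
  have "\<exists>F. (\<forall>k\<in>K. 0 \<le> (\<Sum>i<d. F i * k i)) \<and> 0 < (\<Sum>i<d. F i * y i)" if "y \<in> S" for y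
  proof -
    have "(\<lambda>i. - y i) \<notin> K"
    proof
      assume "(\<lambda>i. - y i) \<in> K"
      moreover have "y \<in> K" using that by (simp add: S_def)
      ultimately have "y = (\<lambda>_. 0)" by (rule pointed[rotated])
      then show False using that by (simp add: S_def)
    qed
    moreover have "y \<in> K" using that by (simp add: S_def)
    ultimately have "\<exists>F. (\<forall>k\<in>K. 0 \<le> (\<Sum>i<d. F i * k i)) \<and> (\<Sum>i<d. F i * (- y i)) < 0"
      using supp by (intro closed_cone_separation closed cone add) auto
    then show ?thesis by (simp add: sum_negf)
  qed
  then obtain F where F: "\<And>y k. y \<in> S \<Longrightarrow> k \<in> K \<Longrightarrow> 0 \<le> (\<Sum>i<d. F y i * k i)"
      "\<And>y. y \<in> S \<Longrightarrow> 0 < (\<Sum>i<d. F y i * y i)" by metis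
  have "\<exists>T\<subseteq>S. finite T \<and> S \<subseteq> (\<Union>y\<in>T. {z. 0 < (\<Sum>i<d. F y i * z i)})"
  proof (rule compactE_image[OF \<open>compact S\<close>, of S "\<lambda>y. {z. 0 < (\<Sum>i<d. F y i * z i)}"])
    show "open {z. 0 < (\<Sum>i<d. F y i * z i)}" for y
      by (intro open_Collect_less continuous_intros)
  qed (use F in auto)
  then obtain T where T: "T \<subseteq> S" "finite T" "S \<subseteq> (\<Union>y\<in>T. {z. 0 < (\<Sum>i<d. F y i * z i)})" by blast
  define G where "G i = (\<Sum>y\<in>T. F y i)" for i
  have G: "(\<Sum>i<d. G i * z i) = (\<Sum>y\<in>T. \<Sum>i<d. F y i * z i)" for z
    unfolding G_def sum_distrib_right by (rule sum.swap)
  have Gpos: "0 < (\<Sum>i<d. G i * z i)" if "z \<in> S" for z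
  proof -
    obtain y where "y \<in> T" "0 < (\<Sum>i<d. F y i * z i)" using subsetD[OF T(3) \<open>z \<in> S\<close>] by auto
    moreover have "z \<in> K" using that by (simp add: S_def)
    then have "0 \<le> (\<Sum>i<d. F w i * z i)" if "w \<in> T" for w
      using F(1)[OF subsetD[OF T(1) that]] by simp
    ultimately show ?thesis unfolding G using T(2) by (intro sum_pos2[of T y]) auto
  qed
  have key: "\<exists>c>0. \<forall>z\<in>S. c \<le> (\<Sum>i<d. G i * z i)"
  proof (cases "S = {}")
    case True
    then show ?thesis by (intro exI[of _ 1]) auto
  next
    case False
    have "continuous_on S (\<lambda>z. \<Sum>i<d. G i * z i)"
      by (intro continuous_intros)
    from continuous_attains_inf[OF \<open>compact S\<close> False this] show ?thesis using Gpos by blast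
  qed
  then obtain c where c: "0 < c" "\<And>z. z \<in> S \<Longrightarrow> c \<le> (\<Sum>i<d. G i * z i)" by blast
  have "c * (\<Sum>i<d. \<bar>k i\<bar>) \<le> (\<Sum>i<d. G i * k i)" if "k \<in> K" for k
  proof (cases "(\<Sum>i<d. \<bar>k i\<bar>) > 0")
    case True
    define t where "t = (\<Sum>i<d. \<bar>k i\<bar>)"
    have "c \<le> (\<Sum>i<d. G i * (1 / t * k i))" using c(2)[OF scaled[OF that t_def]] True t_def by blast
    also have "\<dots> = (\<Sum>i<d. G i * k i) / t" by (simp add: sum_divide_distrib)
    finally show ?thesis using True by (simp add: t_def field_simps)
  next
    case False
    moreover have "0 \<le> (\<Sum>i<d. \<bar>k i\<bar>)" by (intro sum_nonneg) auto
    ultimately have "(\<Sum>i<d. \<bar>k i\<bar>) = 0" by linarith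
    moreover then have "k i = 0" if "i < d" for i using that by (subst (asm) sum_nonneg_eq_0_iff) auto
    ultimately show ?thesis by simp
  qed
  then show ?thesis using c(1) by blast
qed

text \<open>The functional with coefficients \<open>F(i, j) = [i = j]\<close> maps \<open>y \<otimes> y\<close> to \<open>\<Sum>\<^sub>i y\<^sub>i\<^sup>2\<close>; summed over the columns of \<open>X\<close> this
is the squared Frobenius norm.\<close>

lemma trace_dominates_entry_norm:
  assumes X: "X \<in> carrier_mat d d"
  shows "entry_norm X ^ 2 \<le> real (d * d) ^ 2 * (\<Sum>v\<in>unit_vec d ` {..<d}. \<Sum>a<d ^ 2.
    (if a div d = a mod d then 1 else 0) * kron_pow_vec (X *\<^sub>v v) 2 $ a)"
proof (cases "d = 0")
  case True
  then show ?thesis using X by (simp add: entry_norm_def)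
next
  case False
  have inj: "inj_on (unit_vec d :: nat \<Rightarrow> real vec) {..<d}"
  proof (rule inj_onI)
    fix i j assume "i \<in> {..<d}" "j \<in> {..<d}" "unit_vec d i = (unit_vec d j :: real vec)"
    then have "unit_vec d i $ i = (unit_vec d j :: real vec) $ i" by simp
    then show "i = j" using \<open>i \<in> {..<d}\<close> \<open>j \<in> {..<d}\<close> by (simp split: if_splits)
  qed
  have diag: "(\<Sum>a<d ^ 2. (if a div d = a mod d then 1 else 0) * kron_pow_vec y 2 $ a) = (\<Sum>i<d. (y $ i)\<^sup>2)"
    if y: "y \<in> carrier_vec d" for y :: "real vec"
  proof -
    have "(\<Sum>a<d ^ 2. (if a div d = a mod d then 1 else 0) * kron_pow_vec y 2 $ a)
        = (\<Sum>a<d * d. (\<lambda>i j. (if i = j then 1 else 0) * kron_pow_vec y 2 $ (i * d + j)) (a div d) (a mod d))"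
      by (intro sum.cong) (auto simp: power2_eq_square)
    also have "\<dots> = (\<Sum>i<d. \<Sum>j<d. (if i = j then 1 else 0) * kron_pow_vec y 2 $ (i * d + j))"
      by (rule sum_div_mod)
    also have "\<dots> = (\<Sum>i<d. \<Sum>j<d. if j = i then (y $ i)\<^sup>2 else 0)"
      using kron_pow_vec_2_index[OF y] by (intro sum.cong refl) (auto simp: power2_eq_square)
    finally show ?thesis by simp
  qed
  have "entry_norm X ^ 2 = (\<Sum>ij\<in>{..<d} \<times> {..<d}. \<bar>X $$ ij\<bar>) ^ 2"
    using X by (simp add: entry_norm_def sum.cartesian_product)
  also have "\<dots> \<le> real (card ({..<d} \<times> {..<d})) ^ 2 * (\<Sum>ij\<in>{..<d} \<times> {..<d}. \<bar>X $$ ij\<bar> ^ 2)"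
    using False by (intro power_sum_le) auto
  also have "(\<Sum>ij\<in>{..<d} \<times> {..<d}. \<bar>X $$ ij\<bar> ^ 2) = (\<Sum>b<d. \<Sum>i<d. ((X *\<^sub>v unit_vec d b) $ i)\<^sup>2)"
    using mult_unit_vec_index[OF X] by (subst sum.swap) (simp add: sum.cartesian_product')
  also have "\<dots> = (\<Sum>v\<in>unit_vec d ` {..<d}. \<Sum>a<d ^ 2.
      (if a div d = a mod d then 1 else 0) * kron_pow_vec (X *\<^sub>v v) 2 $ a)"
    using X diag by (subst sum.reindex[OF inj]) simp
  finally show ?thesis by simp
qed

lemma proper_cone_add:
  assumes K: "proper_cone d K" and x: "x \<in> K" and y: "y \<in> K"
  shows "x + y \<in> K"
proof -
  have dims: "x \<in> carrier_vec d" "y \<in> carrier_vec d"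
    using K x y by (auto simp: proper_cone_def is_cone_def)
  have convex: "\<forall>x\<in>K. \<forall>y\<in>K. \<forall>t\<in>{0..1}. (1 - t) \<cdot>\<^sub>v x + t \<cdot>\<^sub>v y \<in> K"
    using K by (simp add: proper_cone_def)
  have "(1 - 1 / 2) \<cdot>\<^sub>v x + (1 / 2 :: real) \<cdot>\<^sub>v y \<in> K"
    using convex[rule_format, OF x y, of "1 / 2"] by simp
  then have "2 \<cdot>\<^sub>v ((1 - 1 / 2) \<cdot>\<^sub>v x + (1 / 2 :: real) \<cdot>\<^sub>v y) \<in> K"
    using K by (simp add: proper_cone_def is_cone_def)
  also have "2 \<cdot>\<^sub>v ((1 - 1 / 2) \<cdot>\<^sub>v x + (1 / 2 :: real) \<cdot>\<^sub>v y) = x + y"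
    using dims by (intro eq_vecI) auto
  finally show ?thesis .
qed

lemma proper_cone_positive_functional:
  assumes K: "proper_cone d K"
  shows "\<exists>F c. 0 < c \<and> (\<forall>y\<in>K. c * coord_norm y \<le> (\<Sum>i<d. F i * y $ i))"
proof -
  have dim: "y \<in> carrier_vec d" if "y \<in> K" for y
    using K that by (auto simp: proper_cone_def is_cone_def)
  have coords_eq: "coords y i = (if i < d then y $ i else 0)" if "y \<in> carrier_vec d" for y i
    using that by (simp add: coords_def)
  have "\<exists>F c. 0 < c \<and> (\<forall>k\<in>coords ` K. c * (\<Sum>i<d. \<bar>k i\<bar>) \<le> (\<Sum>i<d. F i * k i))"
  proof (rule pointed_cone_positive_functional)
    show "closed (coords ` K)"
      using K by (intro closedin_Euclidean_imp_closed[of d]) (simp add: proper_cone_def)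
    show "f i = 0" if "f \<in> coords ` K" "d \<le> i" for f i
      using that dim by (auto simp: coords_eq)
    show "(\<lambda>i. c * f i) \<in> coords ` K" if f: "f \<in> coords ` K" and c: "0 \<le> c" for f c
    proof -
      obtain y where y: "y \<in> K" "f = coords y" using f by auto
      then have "c \<cdot>\<^sub>v y \<in> K" using K c by (simp add: proper_cone_def is_cone_def)
      moreover have "(\<lambda>i. c * f i) = coords (c \<cdot>\<^sub>v y)" using y by (auto simp: coords_def)
      ultimately show ?thesis by simp
    qed
    show "(\<lambda>i. f i + h i) \<in> coords ` K" if fh: "f \<in> coords ` K" "h \<in> coords ` K" for f h
    proof -
      obtain x y where xy: "x \<in> K" "f = coords x" "y \<in> K" "h = coords y" using fh by auto
      have "(\<lambda>i. f i + h i) = coords (x + y)" using xy dim[of x] dim[of y] by (auto simp: coords_def)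
      then show ?thesis using proper_cone_add[OF K] xy by simp
    qed
    show "f = (\<lambda>_. 0)" if f: "f \<in> coords ` K" "(\<lambda>i. - f i) \<in> coords ` K" for f
    proof -
      obtain x y where xy: "x \<in> K" "f = coords x" "y \<in> K" "(\<lambda>i. - f i) = coords y" using f by auto
      have "y = - x"
      proof (rule eq_vecI)
        fix i assume "i < dim_vec (- x)"
        then have "i < d" using dim[OF xy(1)] by simp
        moreover have "- f i = coords y i" using xy(4) by metis
        ultimately show "y $ i = (- x) $ i" using xy(2) dim[OF xy(1)] dim[OF xy(3)] by (simp add: coords_eq)
      qed (use dim[OF xy(1)] dim[OF xy(3)] in simp)
      then have "x = 0\<^sub>v d" using K xy by (simp add: proper_cone_def)
      then show ?thesis using xy(2) by (auto simp: coords_def)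
    qed
  qed
  then obtain F c where Fc: "0 < c" "\<And>y. y \<in> K \<Longrightarrow> c * (\<Sum>i<d. \<bar>coords y i\<bar>) \<le> (\<Sum>i<d. F i * coords y i)"
    by auto
  have "c * coord_norm y \<le> (\<Sum>i<d. F i * y $ i)" if "y \<in> K" for y
    using Fc(2)[OF that] dim[OF that] by (simp add: coords_eq coord_norm_def)
  then show ?thesis using Fc(1) by blast
qed

text \<open>An interior point \<open>u\<close> can be moved a little in every coordinate direction.  The resulting points of the
cone span the whole space, with control over the coefficients.\<close>

lemma proper_cone_interior_point:
  assumes K: "proper_cone d K"
  shows "\<exists>u\<in>K. \<forall>i<d. \<exists>\<epsilon>>0. u + \<epsilon> \<cdot>\<^sub>v unit_vec d i \<in> K"
proof -
  have dim: "y \<in> carrier_vec d" if "y \<in> K" for y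
    using K that by (auto simp: proper_cone_def is_cone_def)
  obtain z U where U: "openin (Euclidean_space d) U" "z \<in> U" "U \<subseteq> coords ` K"
    using K unfolding proper_cone_def interior_of_def by auto
  obtain W where W: "open W" "U = W \<inter> {x. \<forall>i\<ge>d. x i = 0}"
    using U(1) unfolding Euclidean_space_def openin_subtopology euclidean_product_topology by auto
  obtain u where u: "u \<in> K" "z = coords u" using U by auto
  have "\<exists>\<epsilon>>0. u + \<epsilon> \<cdot>\<^sub>v unit_vec d i \<in> K" if i: "i < d" for i
  proof -
    define g where "g t = (\<lambda>j. z j + t * (if j = i then 1 else 0))" for t :: real
    have "continuous_on UNIV g"
      unfolding g_def by (intro continuous_on_coordinatewise_then_product continuous_intros)
    then have "open (g -` W)" using W(1) by (simp add: continuous_on_open_vimage)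
    moreover have "g 0 = z" by (simp add: g_def)
    then have "0 \<in> g -` W" using U W by auto
    ultimately obtain e where e: "e > 0" "ball 0 e \<subseteq> g -` W" by (meson open_contains_ball)
    then have "g (e / 2) \<in> W" by (auto simp: subset_iff dist_real_def)
    moreover have "g (e / 2) j = 0" if "d \<le> j" for j
      using that i u dim[OF u(1)] by (auto simp: g_def coords_def)
    ultimately have "g (e / 2) \<in> coords ` K" using U W by auto
    then obtain y where y: "y \<in> K" "g (e / 2) = coords y" by auto
    have "y = u + (e / 2) \<cdot>\<^sub>v unit_vec d i"
    proof (rule eq_vecI)
      fix j assume "j < dim_vec (u + (e / 2) \<cdot>\<^sub>v unit_vec d i)"
      then have j: "j < d" by simp
      have "coords y j = coords u j + e / 2 * (if j = i then 1 else 0)"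
        using y(2) u(2) by (metis g_def)
      then show "y $ j = (u + (e / 2) \<cdot>\<^sub>v unit_vec d i) $ j"
        using i j dim[OF y(1)] dim[OF u(1)] by (auto simp: coords_def)
    qed (use dim[OF y(1)] in simp)
    then show ?thesis using y e by (intro exI[of _ "e / 2"]) auto
  qed
  then show ?thesis using u by blast
qed

lemma word_prod_invariant:
  fixes M :: "nat \<Rightarrow> real mat"
  assumes M: "\<And>i. i < N \<Longrightarrow> M i \<in> carrier_mat d d" and K: "K \<subseteq> carrier_vec d"
    and inv: "leaves_invariant (M ` {..<N}) K" and w: "set w \<subseteq> {..<N}" and x: "x \<in> K"
  shows "word_prod d M w *\<^sub>v x \<in> K"
  using w x
proof (induction w arbitrary: x)
  case Nil
  have "x \<in> carrier_vec d" using Nil K by auto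
  then show ?case using Nil by simp
next
  case (Cons i w)
  have "word_prod d M w \<in> carrier_mat d d" using Cons by (intro word_prod_carrier[OF M]) auto
  moreover have "M i *\<^sub>v x \<in> K" using inv Cons by (auto simp: leaves_invariant_def)
  ultimately show ?case
    using Cons M[of i] K assoc_mult_mat_vec[of "word_prod d M w" d d "M i" d x] by auto
qed

text \<open>The column \<open>X e\<^sub>i\<close> is the difference of \<open>X (u + \<epsilon>\<^sub>i e\<^sub>i)\<close> and \<open>X u\<close> divided by \<open>\<epsilon>\<^sub>i\<close>.  Both vectors lie in the
invariant cone, where the norm is bounded by a multiple of the strictly positive functional.\<close>

lemma cone_functional_dominates_entry_norm:
  fixes M :: "nat \<Rightarrow> real mat"
  assumes M: "\<And>i. i < N \<Longrightarrow> M i \<in> carrier_mat d d" and K: "proper_cone d K"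
    and inv: "leaves_invariant (M ` {..<N}) K"
  shows "\<exists>F V C. finite V \<and> V \<subseteq> carrier_vec d \<and> 0 \<le> C \<and> (\<forall>w. set w \<subseteq> {..<N} \<longrightarrow>
    entry_norm (word_prod d M w) \<le> C * (\<Sum>v\<in>V. \<Sum>a<d. F a * (word_prod d M w *\<^sub>v v) $ a))"
proof -
  have KC: "K \<subseteq> carrier_vec d" using K by (auto simp: proper_cone_def is_cone_def)
  obtain F c where c: "0 < c" and F: "\<And>y. y \<in> K \<Longrightarrow> c * coord_norm y \<le> (\<Sum>i<d. F i * y $ i)"
    using proper_cone_positive_functional[OF K] by blast
  obtain u \<epsilon> where u: "u \<in> K" and \<epsilon>: "\<And>i. i < d \<Longrightarrow> 0 < \<epsilon> i \<and> u + \<epsilon> i \<cdot>\<^sub>v unit_vec d i \<in> K"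
    using proper_cone_interior_point[OF K] by metis
  define V where "V = insert u ((\<lambda>i. u + \<epsilon> i \<cdot>\<^sub>v unit_vec d i) ` {..<d})"
  have VK: "V \<subseteq> K" using u \<epsilon> by (auto simp: V_def)
  have finV: "finite V" by (simp add: V_def)
  define C where "C = (\<Sum>i<d. 2 / (\<epsilon> i * c))"
  have C0: "0 \<le> C" unfolding C_def using \<epsilon> c
    by (intro sum_nonneg divide_nonneg_nonneg mult_nonneg_nonneg) (auto simp: less_imp_le)
  have bound: "entry_norm X \<le> C * (\<Sum>v\<in>V. \<Sum>a<d. F a * (X *\<^sub>v v) $ a)"
    if X: "X \<in> carrier_mat d d" and XK: "\<And>x. x \<in> K \<Longrightarrow> X *\<^sub>v x \<in> K" for X
  proof -
    define R where "R = (\<Sum>v\<in>V. \<Sum>a<d. F a * (X *\<^sub>v v) $ a)"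
    have nonneg: "0 \<le> (\<Sum>a<d. F a * (X *\<^sub>v v) $ a)" if "v \<in> V" for v
      using F[OF XK, of v] VK that c coord_norm_nonneg by (meson mult_nonneg_nonneg order.trans less_imp_le subsetD)
    have le: "c * coord_norm (X *\<^sub>v v) \<le> R" if "v \<in> V" for v
    proof -
      have "c * coord_norm (X *\<^sub>v v) \<le> (\<Sum>a<d. F a * (X *\<^sub>v v) $ a)"
        using F[OF XK] VK that by auto
      also have "\<dots> \<le> R" unfolding R_def
        using that nonneg finV by (intro member_le_sum[of v V "\<lambda>v. \<Sum>a<d. F a * (X *\<^sub>v v) $ a"]) auto
      finally show ?thesis .
    qed
    have col: "coord_norm (X *\<^sub>v unit_vec d i) \<le> 2 / (\<epsilon> i * c) * R" if i: "i < d" for i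
    proof -
      let ?v = "u + \<epsilon> i \<cdot>\<^sub>v unit_vec d i"
      have uc: "u \<in> carrier_vec d" using u KC by auto
      have split: "X *\<^sub>v ?v = X *\<^sub>v u + \<epsilon> i \<cdot>\<^sub>v (X *\<^sub>v unit_vec d i)"
        using X uc by (simp add: mult_add_distrib_mat_vec[OF X uc] mult_mat_vec[OF X])
      have "\<epsilon> i * coord_norm (X *\<^sub>v unit_vec d i) = (\<Sum>a<d. \<bar>(X *\<^sub>v ?v) $ a - (X *\<^sub>v u) $ a\<bar>)"
        unfolding split coord_norm_def sum_distrib_left using X \<epsilon>[OF i] by (intro sum.cong) (auto simp: abs_mult simp del: index_mult_mat_vec)
      also have "\<dots> \<le> (\<Sum>a<d. \<bar>(X *\<^sub>v ?v) $ a\<bar> + \<bar>(X *\<^sub>v u) $ a\<bar>)" by (intro sum_mono) simp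
      also have "\<dots> = coord_norm (X *\<^sub>v ?v) + coord_norm (X *\<^sub>v u)"
        using X by (simp add: coord_norm_def sum.distrib)
      finally have "c * (\<epsilon> i * coord_norm (X *\<^sub>v unit_vec d i)) \<le> c * (coord_norm (X *\<^sub>v ?v) + coord_norm (X *\<^sub>v u))"
        using c by (intro mult_left_mono) auto
      also have "\<dots> \<le> R + R"
        unfolding distrib_left using i by (intro add_mono le) (auto simp: V_def)
      finally have "c * (\<epsilon> i * coord_norm (X *\<^sub>v unit_vec d i)) \<le> 2 * R" by simp
      then show ?thesis using c \<epsilon>[OF i] by (simp add: field_simps)
    qed
    have "entry_norm X \<le> (\<Sum>i<d. 2 / (\<epsilon> i * c) * R)"
      unfolding entry_norm_columns[OF X] using col by (intro sum_mono) auto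
    then show ?thesis by (simp add: C_def R_def sum_distrib_right)
  qed
  have "entry_norm (word_prod d M w) \<le> C * (\<Sum>v\<in>V. \<Sum>a<d. F a * (word_prod d M w *\<^sub>v v) $ a)"
    if w: "set w \<subseteq> {..<N}" for w
    by (intro bound word_prod_carrier[OF M w] word_prod_invariant[OF M KC inv w])
  moreover have "V \<subseteq> carrier_vec d" using VK KC by (rule subset_trans)
  ultimately show ?thesis using finV C0 by (intro exI[of _ F] exI[of _ V] exI[of _ C]) simp
qed

section \<open>Stability of the switched system\<close>

locale switched_system =
  fixes p d N :: nat and P :: "real mat" and M :: "nat \<Rightarrow> real mat"
  assumes p: "0 < p" and d: "0 < d" and N: "0 < N"
    and transition: "transition_matrix N P"
    and M: "\<And>i. i < N \<Longrightarrow> M i \<in> carrier_mat d d"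
begin

sublocale lifted: markov_product N "d ^ p" P "\<lambda>i. kron_pow_mat (M i) p"
  using transition M by unfold_locales (auto intro: kron_pow_mat_carrier)

abbreviation "W \<equiv> word_prod d M"

definition growth :: "nat \<Rightarrow> nat \<Rightarrow> real" where
  "growth k s = path_exp N P k s (\<lambda>w _. entry_norm (W w) ^ p)"

definition tensor_moment :: "nat \<Rightarrow> nat \<Rightarrow> real vec \<Rightarrow> real vec" where
  "tensor_moment k s x =
     vec (d ^ p) (\<lambda>a. path_exp N P k s (\<lambda>w _. kron_pow_vec (W w *\<^sub>v x) p $ a))"

text \<open>The cases \<open>p = 2\<close> and \<open>p = 1\<close> differ only in the proof of such an inequality.  Its right-hand side is
linear in the tensors, so expectations turn it into a bound by moments.\<close>

definition dominating_functional :: "(nat \<Rightarrow> real) \<Rightarrow> real vec set \<Rightarrow> real \<Rightarrow> bool" where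
  "dominating_functional F V C \<longleftrightarrow> finite V \<and> V \<subseteq> carrier_vec d \<and> 0 \<le> C \<and> (\<forall>w. set w \<subseteq> {..<N} \<longrightarrow>
     entry_norm (W w) ^ p \<le> C * (\<Sum>v\<in>V. \<Sum>a<d ^ p. F a * kron_pow_vec (W w *\<^sub>v v) p $ a))"

lemma W_carrier: "set w \<subseteq> {..<N} \<Longrightarrow> W w \<in> carrier_mat d d"
  by (rule word_prod_carrier[OF M])

lemma growth_nonneg: "s < N \<Longrightarrow> 0 \<le> growth k s"
  unfolding growth_def by (rule path_exp_nonneg[OF transition]) (simp_all add: entry_norm_nonneg)

lemma lifted_word_mult:
  assumes "set w \<subseteq> {..<N}" "x \<in> carrier_vec d"
  shows "word_prod (d ^ p) (\<lambda>i. kron_pow_mat (M i) p) w *\<^sub>v kron_pow_vec x p = kron_pow_vec (W w *\<^sub>v x) p"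
  using kron_pow_word_prod[of N M d w p, OF M assms(1)] kron_pow_mult_vec[OF W_carrier[OF assms(1)] assms(2), of p] by simp

lemma tensor_entry_le:
  assumes w: "set w \<subseteq> {..<N}" and x: "x \<in> carrier_vec d" and a: "a < d ^ p"
  shows "\<bar>kron_pow_vec (W w *\<^sub>v x) p $ a\<bar> \<le> coord_norm x ^ p * entry_norm (W w) ^ p"
proof -
  have "\<bar>kron_pow_vec (W w *\<^sub>v x) p $ a\<bar> \<le> coord_norm (W w *\<^sub>v x) ^ p"
    using W_carrier[OF w] x a by (intro kron_pow_vec_entry_le[of _ d]) auto
  also have "\<dots> \<le> (entry_norm (W w) * coord_norm x) ^ p"
    using coord_norm_mult_mat_vec[OF W_carrier[OF w] x] by (intro power_mono coord_norm_nonneg)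
  finally show ?thesis by (simp add: power_mult_distrib mult.commute)
qed

lemma tensor_moment_le:
  assumes "s < N" "x \<in> carrier_vec d" "a < d ^ p"
  shows "\<bar>tensor_moment k s x $ a\<bar> \<le> coord_norm x ^ p * growth k s"
proof -
  have "\<bar>path_exp N P k s (\<lambda>w _. kron_pow_vec (W w *\<^sub>v x) p $ a)\<bar>
      \<le> path_exp N P k s (\<lambda>w _. coord_norm x ^ p * entry_norm (W w) ^ p)"
    using assms tensor_entry_le by (intro path_exp_abs[OF transition]) auto
  then show ?thesis using assms(3) by (simp add: tensor_moment_def growth_def path_exp_cmult)
qed

lemma state_moment_le:
  assumes s: "s < N" and x: "x \<in> carrier_vec d" and r: "r < N * d ^ p"
  shows "\<bar>lifted.state_moment k s (kron_pow_vec x p) $ r\<bar> \<le> coord_norm x ^ p * growth k s"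
proof -
  note r' = block_index_div_mod[OF r]
  have "\<bar>path_exp N P k s (\<lambda>w e. if e = r div d ^ p
        then (word_prod (d ^ p) (\<lambda>i. kron_pow_mat (M i) p) w *\<^sub>v kron_pow_vec x p) $ (r mod d ^ p) else 0)\<bar>
      \<le> path_exp N P k s (\<lambda>w _. coord_norm x ^ p * entry_norm (W w) ^ p)"
    using tensor_entry_le[OF _ x r'(2)]
    by (intro path_exp_abs[OF transition s])
      (auto simp: lifted_word_mult[OF _ x] coord_norm_nonneg entry_norm_nonneg)
  then show ?thesis using r by (simp add: lifted.state_moment_def growth_def path_exp_cmult)
qed

lemma tensor_moment_sum:
  assumes s: "s < N" and x: "x \<in> carrier_vec d" and a: "a < d ^ p"
  shows "tensor_moment k s x $ a = (\<Sum>j<N. lifted.state_moment k s (kron_pow_vec x p) $ (j * d ^ p + a))"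
proof -
  have "(\<Sum>j<N. lifted.state_moment k s (kron_pow_vec x p) $ (j * d ^ p + a))
      = path_exp N P k s (\<lambda>w _. (word_prod (d ^ p) (\<lambda>i. kron_pow_mat (M i) p) w *\<^sub>v kron_pow_vec x p) $ a)"
    by (rule lifted.sum_state_moment[OF s a])
  also have "\<dots> = path_exp N P k s (\<lambda>w _. kron_pow_vec (W w *\<^sub>v x) p $ a)"
    using x by (intro path_exp_cong[OF transition s]) (simp add: lifted_word_mult)
  finally show ?thesis using a by (simp add: tensor_moment_def)
qed

lemma growth_le_functional:
  assumes dom: "dominating_functional F V C" and s: "s < N"
  shows "growth k s \<le> C * (\<Sum>v\<in>V. \<Sum>a<d ^ p. F a * tensor_moment k s v $ a)"
proof -
  have "growth k s \<le> path_exp N P k s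
      (\<lambda>w _. C * (\<Sum>v\<in>V. \<Sum>a<d ^ p. F a * kron_pow_vec (W w *\<^sub>v v) p $ a))"
    unfolding growth_def using dom by (intro path_exp_mono[OF transition s]) (simp add: dominating_functional_def)
  also have "\<dots> = C * (\<Sum>v\<in>V. \<Sum>a<d ^ p. F a * path_exp N P k s (\<lambda>w _. kron_pow_vec (W w *\<^sub>v v) p $ a))"
    by (simp only: path_exp_cmult path_exp_sum)
  also have "\<dots> = C * (\<Sum>v\<in>V. \<Sum>a<d ^ p. F a * tensor_moment k s v $ a)"
    by (simp add: tensor_moment_def)
  finally show ?thesis .
qed

text \<open>The nonlinear expectation \<open>growth\<close> is controlled by finitely many linear moments.\<close>

lemma growth_decay_if_moments_decay:
  assumes dom: "dominating_functional F V C"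
    and moments: "\<And>v. v \<in> V \<Longrightarrow> exp_decay N (\<lambda>k s. coord_norm (tensor_moment k s v))"
  shows "exp_decay N growth"
proof -
  define G where "G = (\<Sum>a<d ^ p. \<bar>F a\<bar>)"
  have G0: "0 \<le> G" unfolding G_def by (intro sum_nonneg) auto
  have decay: "exp_decay N (\<lambda>k s. \<Sum>v\<in>V. coord_norm (tensor_moment k s v))"
    using dom moments by (intro exp_decay_sum) (auto simp: dominating_functional_def)
  have bound: "growth k s \<le> (C * G) * (\<Sum>v\<in>V. coord_norm (tensor_moment k s v))" if s: "s < N" for k s
  proof -
    have "(\<Sum>a<d ^ p. F a * tensor_moment k s v $ a) \<le> G * coord_norm (tensor_moment k s v)" for v
    proof -
      have "(\<Sum>a<d ^ p. F a * tensor_moment k s v $ a) \<le> (\<Sum>a<d ^ p. \<bar>F a\<bar> * coord_norm (tensor_moment k s v))"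
      proof (intro sum_mono)
        fix a assume "a \<in> {..<d ^ p}"
        then have "\<bar>tensor_moment k s v $ a\<bar> \<le> coord_norm (tensor_moment k s v)"
          by (intro coord_le_coord_norm) (simp add: tensor_moment_def)
        then have "\<bar>F a\<bar> * \<bar>tensor_moment k s v $ a\<bar> \<le> \<bar>F a\<bar> * coord_norm (tensor_moment k s v)"
          by (intro mult_left_mono) auto
        then show "F a * tensor_moment k s v $ a \<le> \<bar>F a\<bar> * coord_norm (tensor_moment k s v)"
          using abs_ge_self[of "F a * tensor_moment k s v $ a"] by (simp add: abs_mult)
      qed
      then show ?thesis by (simp add: G_def sum_distrib_right)
    qed
    then have "C * (\<Sum>v\<in>V. \<Sum>a<d ^ p. F a * tensor_moment k s v $ a)
        \<le> C * (\<Sum>v\<in>V. G * coord_norm (tensor_moment k s v))"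
      using dom by (intro mult_left_mono sum_mono) (auto simp: dominating_functional_def)
    then show ?thesis
      using growth_le_functional[OF dom s, of k] by (simp add: sum_distrib_left mult.assoc)
  qed
  have "0 \<le> C * G" using G0 dom by (simp add: dominating_functional_def)
  then show ?thesis by (rule exp_decay_bound[OF decay _ bound])
qed

text \<open>The columns of \<open>T\<^sup>k\<close> are restricted moments with initial vector a unit vector of the tensor space, which
need not be a tensor power; they are bounded because \<open>growth\<close> bounds the whole matrix
\<open>X\<^bsup>\<otimes>p\<^esup>\<close> and not just its values at tensor powers.\<close>

lemma radius_less_1_iff_growth_decay:
  assumes dom: "dominating_functional F V C"
  shows "real_spectral_radius lifted.T < 1 \<longleftrightarrow> exp_decay N growth"
proof -
  have n: "0 < N * d ^ p" using N d by simp
  have "exp_decay N growth \<longleftrightarrow> (\<exists>C>0. \<exists>\<beta>>0. \<forall>k. \<forall>i<N * d ^ p. \<forall>j<N * d ^ p.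
      \<bar>(lifted.T ^\<^sub>m k) $$ (i, j)\<bar> \<le> C * exp (- \<beta> * real k))" (is "_ \<longleftrightarrow> ?powers")
  proof
    assume "exp_decay N growth"
    then obtain C \<beta> where C: "0 < C" "0 < \<beta>" "\<And>k s. s < N \<Longrightarrow> growth k s \<le> C * exp (- \<beta> * real k)"
      unfolding exp_decay_def by blast
    have "\<bar>(lifted.T ^\<^sub>m k) $$ (r, c)\<bar> \<le> C * exp (- \<beta> * real k)" if r: "r < N * d ^ p" and c: "c < N * d ^ p" for k r c
    proof -
      define s b where "s = c div d ^ p" and "b = c mod d ^ p"
      have sb: "s < N" "b < d ^ p" "c = s * d ^ p + b"
        using block_index_div_mod[OF c] by (auto simp: s_def b_def)
      note r' = block_index_div_mod[OF r]
      have entry: "\<bar>(word_prod (d ^ p) (\<lambda>i. kron_pow_mat (M i) p) w *\<^sub>v unit_vec (d ^ p) b) $ (r mod d ^ p)\<bar>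
          \<le> entry_norm (W w) ^ p" if w: "set w \<subseteq> {..<N}" for w
        using mult_unit_vec_index[OF kron_pow_mat_carrier[OF W_carrier[OF w]] r'(2) sb(2)]
          kron_pow_mat_entry_le[OF W_carrier[OF w] r'(2) sb(2)] kron_pow_word_prod[of N M d w p, OF M w] by simp
      have "\<bar>(lifted.T ^\<^sub>m k) $$ (r, c)\<bar> = \<bar>lifted.state_moment k s (unit_vec (d ^ p) b) $ r\<bar>"
        unfolding sb(3) by (simp only: lifted.T_pow_entry[OF sb(1,2) r])
      also have "\<dots> \<le> growth k s"
        using r entry unfolding lifted.state_moment_def growth_def
        by (simp, intro path_exp_abs[OF transition sb(1)]) (auto simp: entry_norm_nonneg)
      also have "\<dots> \<le> C * exp (- \<beta> * real k)" by (rule C(3)[OF sb(1)])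
      finally show ?thesis .
    qed
    then show ?powers using C(1,2) by blast
  next
    assume ?powers
    then obtain D \<beta> where D: "0 < D" "0 < \<beta>"
      "\<And>k i j. i < N * d ^ p \<Longrightarrow> j < N * d ^ p \<Longrightarrow> \<bar>(lifted.T ^\<^sub>m k) $$ (i, j)\<bar> \<le> D * exp (- \<beta> * real k)"
      by blast
    have "exp_decay N (\<lambda>k s. coord_norm (tensor_moment k s v))" if "v \<in> V" for v
    proof -
      have v: "v \<in> carrier_vec d" using dom that by (auto simp: dominating_functional_def)
      have y: "kron_pow_vec v p \<in> carrier_vec (d ^ p)" by (rule kron_pow_vec_carrier[OF v])
      define n where "n = N * d ^ p"
      define E where "E = (\<Sum>s<N. coord_norm (lifted.state_moment 0 s (kron_pow_vec v p)))"
      have E0: "0 \<le> E" unfolding E_def by (intro sum_nonneg coord_norm_nonneg)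
      have "coord_norm (tensor_moment k s v) \<le> (real n * real n * D * E) * exp (- \<beta> * real k)" if s: "s < N" for k s
      proof -
        have Tk: "lifted.T ^\<^sub>m k \<in> carrier_mat n n" using lifted.T_carrier by (simp add: n_def)
        have "coord_norm (tensor_moment k s v)
            = (\<Sum>a<d ^ p. \<bar>\<Sum>j<N. lifted.state_moment k s (kron_pow_vec v p) $ (j * d ^ p + a)\<bar>)"
          using tensor_moment_sum[OF s v] by (simp add: coord_norm_def tensor_moment_def)
        also have "\<dots> \<le> (\<Sum>a<d ^ p. \<Sum>j<N. \<bar>lifted.state_moment k s (kron_pow_vec v p) $ (j * d ^ p + a)\<bar>)"
          by (intro sum_mono sum_abs)
        also have "\<dots> = coord_norm (lifted.state_moment k s (kron_pow_vec v p))"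
          using carrier_vecD[OF lifted.state_moment_carrier[of k s "kron_pow_vec v p"]]
          by (subst sum.swap) (simp add: coord_norm_def sum_blocks)
        also have "\<dots> \<le> entry_norm (lifted.T ^\<^sub>m k) * coord_norm (lifted.state_moment 0 s (kron_pow_vec v p))"
          unfolding lifted.T_pow_state_moment[OF s y, of k, symmetric]
          by (rule coord_norm_mult_mat_vec[OF Tk[unfolded n_def] lifted.state_moment_carrier])
        also have "\<dots> \<le> (real n * (real n * (D * exp (- \<beta> * real k)))) * E"
        proof (intro mult_mono)
          have "(\<Sum>i<n. \<Sum>j<n. \<bar>(lifted.T ^\<^sub>m k) $$ (i, j)\<bar>) \<le> (\<Sum>i<n. \<Sum>j<n. D * exp (- \<beta> * real k))"
            using D(3) by (intro sum_mono) (auto simp: n_def)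
          then show "entry_norm (lifted.T ^\<^sub>m k) \<le> real n * (real n * (D * exp (- \<beta> * real k)))"
            using carrier_matD[OF Tk] by (simp add: entry_norm_def)
          show "coord_norm (lifted.state_moment 0 s (kron_pow_vec v p)) \<le> E"
            unfolding E_def using s
            by (intro member_le_sum[of s _ "\<lambda>s. coord_norm (lifted.state_moment 0 s (kron_pow_vec v p))"])
              (auto simp: coord_norm_nonneg)
        qed (use D(1) in \<open>auto simp: coord_norm_nonneg\<close>)
        finally show ?thesis by (simp add: mult_ac)
      qed
      then show ?thesis
        using D(1) E0 by (intro exp_decay_bound[OF exp_decay_exp[OF D(2)], of "real n * real n * D * E"]) auto
    qed
    then show "exp_decay N growth" by (rule growth_decay_if_moments_decay[OF dom])
  qed
  then show ?thesis
    using spectral_radius_less_1_iff_powers_decay[OF lifted.T_carrier n] by simp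
qed

lemma mean_decay_iff_growth_decay:
  assumes vnorm: "is_vec_norm d vnorm"
  shows "(\<exists>C>0. \<exists>\<beta>>0. \<forall>k. \<forall>x\<in>carrier_vec d. \<forall>s<N.
      path_exp N P k s (\<lambda>w _. vnorm (W w *\<^sub>v x) ^ p) \<le> C * exp (- \<beta> * real k) * vnorm x ^ p)
    \<longleftrightarrow> exp_decay N growth" (is "?mean \<longleftrightarrow> _")
proof -
  obtain c where c: "0 < c" "\<And>x. x \<in> carrier_vec d \<Longrightarrow> vnorm x \<le> c * coord_norm x"
      "\<And>x. x \<in> carrier_vec d \<Longrightarrow> coord_norm x \<le> c * vnorm x"
    using vec_norm_equivalent[OF vnorm] by blast
  have v0: "0 \<le> vnorm x" if "x \<in> carrier_vec d" for x using vnorm that by (simp add: is_vec_norm_def)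
  show ?thesis
  proof
    assume ?mean
    then obtain C \<beta> where C: "0 < C" "0 < \<beta>" "\<And>k x s. x \<in> carrier_vec d \<Longrightarrow> s < N \<Longrightarrow>
        path_exp N P k s (\<lambda>w _. vnorm (W w *\<^sub>v x) ^ p) \<le> C * exp (- \<beta> * real k) * vnorm x ^ p" by blast
    have "exp_decay N (\<lambda>k s. path_exp N P k s (\<lambda>w _. vnorm (W w *\<^sub>v unit_vec d b) ^ p))" for b
    proof -
      show ?thesis
        using C(1) C(3)[of "unit_vec d b"] v0[of "unit_vec d b"]
        by (intro exp_decay_bound[OF exp_decay_exp[OF C(2)], of "C * vnorm (unit_vec d b) ^ p"]) (auto simp: mult_ac)
    qed
    then have decay: "exp_decay N (\<lambda>k s. \<Sum>b<d. path_exp N P k s (\<lambda>w _. vnorm (W w *\<^sub>v unit_vec d b) ^ p))"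
      by (intro exp_decay_sum) auto
    have bound: "growth k s \<le> (real d ^ p * c ^ p) *
        (\<Sum>b<d. path_exp N P k s (\<lambda>w _. vnorm (W w *\<^sub>v unit_vec d b) ^ p))" if s: "s < N" for k s
    proof -
      have "growth k s \<le> path_exp N P k s
          (\<lambda>w _. (real d ^ p * c ^ p) * (\<Sum>b<d. vnorm (W w *\<^sub>v unit_vec d b) ^ p))"
        unfolding growth_def
      proof (rule path_exp_mono[OF transition s])
        fix w assume w: "set w \<subseteq> {..<N}"
        have Wc: "W w *\<^sub>v unit_vec d b \<in> carrier_vec d" for b using W_carrier[OF w] by simp
        have "entry_norm (W w) ^ p = (\<Sum>b<d. coord_norm (W w *\<^sub>v unit_vec d b)) ^ p"
          by (simp add: entry_norm_columns[OF W_carrier[OF w]])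
        also have "\<dots> \<le> real (card {..<d}) ^ p * (\<Sum>b<d. coord_norm (W w *\<^sub>v unit_vec d b) ^ p)"
          using d by (intro power_sum_le) (auto simp: coord_norm_nonneg)
        also have "\<dots> \<le> real (card {..<d}) ^ p * (\<Sum>b<d. (c * vnorm (W w *\<^sub>v unit_vec d b)) ^ p)"
          using c(3)[OF Wc] by (intro mult_left_mono sum_mono power_mono) (auto simp: coord_norm_nonneg)
        finally show "entry_norm (W w) ^ p \<le> (real d ^ p * c ^ p) * (\<Sum>b<d. vnorm (W w *\<^sub>v unit_vec d b) ^ p)"
          by (simp add: power_mult_distrib sum_distrib_left mult.assoc)
      qed
      then show ?thesis by (simp only: path_exp_cmult path_exp_sum)
    qed
    have "0 \<le> real d ^ p * c ^ p" using c(1) by simp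
    then show "exp_decay N growth" by (rule exp_decay_bound[OF decay _ bound])
  next
    assume "exp_decay N growth"
    then obtain C \<beta> where C: "0 < C" "0 < \<beta>" "\<And>k s. s < N \<Longrightarrow> growth k s \<le> C * exp (- \<beta> * real k)"
      unfolding exp_decay_def by blast
    have "path_exp N P k s (\<lambda>w _. vnorm (W w *\<^sub>v x) ^ p) \<le> ((c * c) ^ p * C) * exp (- \<beta> * real k) * vnorm x ^ p"
      if x: "x \<in> carrier_vec d" and s: "s < N" for k x s
    proof -
      have "path_exp N P k s (\<lambda>w _. vnorm (W w *\<^sub>v x) ^ p)
          \<le> path_exp N P k s (\<lambda>w _. ((c * c) ^ p * vnorm x ^ p) * entry_norm (W w) ^ p)"
      proof (rule path_exp_mono[OF transition s])
        fix w assume w: "set w \<subseteq> {..<N}"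
        have Wx: "W w *\<^sub>v x \<in> carrier_vec d" using W_carrier[OF w] x by simp
        have "vnorm (W w *\<^sub>v x) \<le> c * coord_norm (W w *\<^sub>v x)" by (rule c(2)[OF Wx])
        also have "\<dots> \<le> c * (entry_norm (W w) * coord_norm x)"
          using c(1) coord_norm_mult_mat_vec[OF W_carrier[OF w] x] by (intro mult_left_mono) auto
        also have "\<dots> \<le> c * (entry_norm (W w) * (c * vnorm x))"
          using c(1) c(3)[OF x] by (intro mult_left_mono entry_norm_nonneg) auto
        finally have "vnorm (W w *\<^sub>v x) ^ p \<le> (c * (entry_norm (W w) * (c * vnorm x))) ^ p"
          using v0[OF Wx] by (intro power_mono) auto
        then show "vnorm (W w *\<^sub>v x) ^ p \<le> ((c * c) ^ p * vnorm x ^ p) * entry_norm (W w) ^ p"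
          by (simp add: power_mult_distrib mult_ac)
      qed
      also have "\<dots> = ((c * c) ^ p * vnorm x ^ p) * growth k s" by (simp add: growth_def path_exp_cmult)
      also have "\<dots> \<le> ((c * c) ^ p * vnorm x ^ p) * (C * exp (- \<beta> * real k))"
        using c(1) v0[OF x] by (intro mult_left_mono C(3)[OF s]) auto
      finally show ?thesis by (simp add: mult_ac)
    qed
    moreover have "0 < (c * c) ^ p * C" using c(1) C(1) by simp
    ultimately show ?mean using C(2) by blast
  qed
qed

lemma moment_decay_iff_growth_decay:
  assumes vnorm: "is_vec_norm d vnorm" and tnorm: "is_vec_norm (d ^ p) tnorm"
    and dom: "dominating_functional F V B"
  shows "(\<exists>C>0. \<exists>\<beta>>0. \<forall>k. \<forall>x\<in>carrier_vec d. \<forall>s<N.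
      tnorm (tensor_moment k s x) \<le> C * exp (- \<beta> * real k) * vnorm x ^ p)
    \<longleftrightarrow> exp_decay N growth" (is "?moment \<longleftrightarrow> _")
proof -
  obtain c where c: "0 < c" "\<And>x. x \<in> carrier_vec d \<Longrightarrow> coord_norm x \<le> c * vnorm x"
    using vec_norm_equivalent[OF vnorm] by blast
  obtain t where t: "0 < t" "\<And>x. x \<in> carrier_vec (d ^ p) \<Longrightarrow> tnorm x \<le> t * coord_norm x"
      "\<And>x. x \<in> carrier_vec (d ^ p) \<Longrightarrow> coord_norm x \<le> t * tnorm x"
    using vec_norm_equivalent[OF tnorm] by blast
  have v0: "0 \<le> vnorm x" if "x \<in> carrier_vec d" for x using vnorm that by (simp add: is_vec_norm_def)
  have tm: "tensor_moment k s x \<in> carrier_vec (d ^ p)" for k s x by (simp add: tensor_moment_def)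
  show ?thesis
  proof
    assume ?moment
    then obtain C \<beta> where C: "0 < C" "0 < \<beta>" "\<And>k x s. x \<in> carrier_vec d \<Longrightarrow> s < N \<Longrightarrow>
        tnorm (tensor_moment k s x) \<le> C * exp (- \<beta> * real k) * vnorm x ^ p" by blast
    have "exp_decay N (\<lambda>k s. coord_norm (tensor_moment k s v))" if "v \<in> V" for v
    proof -
      have v: "v \<in> carrier_vec d" using dom that by (auto simp: dominating_functional_def)
      show ?thesis
      proof (rule exp_decay_bound[OF exp_decay_exp[OF C(2)], of "t * (C * vnorm v ^ p)"])
        show "0 \<le> t * (C * vnorm v ^ p)" using t(1) C(1) v0[OF v] by simp
        fix k s assume s: "s < N"
        have "coord_norm (tensor_moment k s v) \<le> t * tnorm (tensor_moment k s v)" by (rule t(3)[OF tm])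
        also have "\<dots> \<le> t * (C * exp (- \<beta> * real k) * vnorm v ^ p)"
          using t(1) C(3)[OF v s] by (intro mult_left_mono) auto
        finally show "coord_norm (tensor_moment k s v) \<le> t * (C * vnorm v ^ p) * exp (- \<beta> * real k)"
          by (simp add: mult_ac)
      qed
    qed
    then show "exp_decay N growth" by (rule growth_decay_if_moments_decay[OF dom])
  next
    assume "exp_decay N growth"
    then obtain C \<beta> where C: "0 < C" "0 < \<beta>" "\<And>k s. s < N \<Longrightarrow> growth k s \<le> C * exp (- \<beta> * real k)"
      unfolding exp_decay_def by blast
    have "tnorm (tensor_moment k s x) \<le> (t * real (d ^ p) * c ^ p * C) * exp (- \<beta> * real k) * vnorm x ^ p"
      if x: "x \<in> carrier_vec d" and s: "s < N" for k x s
    proof -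
      have "coord_norm (tensor_moment k s x) = (\<Sum>a<d ^ p. \<bar>tensor_moment k s x $ a\<bar>)"
        by (simp add: coord_norm_def tensor_moment_def)
      also have "\<dots> \<le> (\<Sum>a<d ^ p. coord_norm x ^ p * growth k s)"
        using tensor_moment_le[OF s x] by (intro sum_mono) auto
      also have "\<dots> = real (d ^ p) * (coord_norm x ^ p * growth k s)" by simp
      also have "\<dots> \<le> real (d ^ p) * ((c * vnorm x) ^ p * (C * exp (- \<beta> * real k)))"
        using c(1) c(2)[OF x] v0[OF x] C(1) growth_nonneg[OF s, of k] C(3)[OF s, of k]
        by (intro mult_left_mono mult_mono power_mono) (auto simp: coord_norm_nonneg)
      finally have "t * coord_norm (tensor_moment k s x) \<le> t * (real (d ^ p) * ((c * vnorm x) ^ p * (C * exp (- \<beta> * real k))))"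
        using t(1) by (intro mult_left_mono) auto
      then have "tnorm (tensor_moment k s x) \<le> t * (real (d ^ p) * ((c * vnorm x) ^ p * (C * exp (- \<beta> * real k))))"
        using t(2)[OF tm[of k s x]] by linarith
      then show ?thesis by (simp add: power_mult_distrib mult_ac)
    qed
    moreover have "0 < t * real (d ^ p) * c ^ p * C" using t(1) c(1) C(1) d by simp
    ultimately show ?moment using C(2) by blast
  qed
qed

text \<open>The averages \<open>a\<close> and \<open>b\<close> for the entry sum norm and for \<open>mnorm\<close> are comparable to each other and to the norms
of the orbit \<open>u\<close> of the transfer matrix: \<open>u\<close> is bounded by \<open>a\<close> entry by entry, and \<open>a\<close> by \<open>u\<close> through the
dominating functional.  This makes the limit exist.  To return from \<open>a\<close> to \<open>growth\<close>, the matrix of the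
initial state is put back, which changes the norm by a bounded factor.\<close>

lemma jsr_less_1_iff_growth_decay:
  assumes mnorm: "is_mat_norm d mnorm" and dom: "dominating_functional F V C"
  shows "(\<forall>s<N. lim (\<lambda>k. (\<Sum>j<N. P $$ (s, j) * path_exp N P k j (\<lambda>w _. mnorm (W w) ^ p))
      powr (1 / (real p * real k))) < 1) \<longleftrightarrow> exp_decay N growth"
proof -
  obtain c where c: "0 < c" "\<And>X. X \<in> carrier_mat d d \<Longrightarrow> mnorm X \<le> c * entry_norm X"
      "\<And>X. X \<in> carrier_mat d d \<Longrightarrow> entry_norm X \<le> c * mnorm X"
    using mat_norm_equivalent[OF mnorm] by blast
  have m0: "0 \<le> mnorm X" if "X \<in> carrier_mat d d" for X using mnorm that by (simp add: is_mat_norm_def)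
  have P0: "0 \<le> P $$ (s, j)" if "s < N" "j < N" for s j
    using transition that by (simp add: transition_matrix_def)
  have P1: "(\<Sum>j<N. P $$ (s, j)) = 1" if "s < N" for s
    using transition that by (simp add: transition_matrix_def)
  define a where "a k s = (\<Sum>j<N. P $$ (s, j) * growth k j)" for k s
  define b where "b k s = (\<Sum>j<N. P $$ (s, j) * path_exp N P k j (\<lambda>w _. mnorm (W w) ^ p))" for k s
  have b0: "0 \<le> b k s" if "s < N" for k s
    unfolding b_def using P0 that m0 W_carrier
    by (intro sum_nonneg mult_nonneg_nonneg path_exp_nonneg[OF transition]) auto
  have ba: "b k s \<le> c ^ p * a k s" if s: "s < N" for k s
  proof -
    have "path_exp N P k j (\<lambda>w _. mnorm (W w) ^ p) \<le> c ^ p * growth k j" if j: "j < N" for j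
      unfolding growth_def path_exp_cmult[symmetric] power_mult_distrib[symmetric]
      using c(2)[OF W_carrier] m0[OF W_carrier] by (intro path_exp_mono[OF transition j] power_mono) auto
    then have "b k s \<le> (\<Sum>j<N. P $$ (s, j) * (c ^ p * growth k j))"
      unfolding b_def using P0[OF s] by (intro sum_mono mult_left_mono) auto
    then show ?thesis by (simp add: a_def sum_distrib_left mult_ac)
  qed
  have ab: "a k s \<le> c ^ p * b k s" if s: "s < N" for k s
  proof -
    have "growth k j \<le> c ^ p * path_exp N P k j (\<lambda>w _. mnorm (W w) ^ p)" if j: "j < N" for j
      unfolding growth_def path_exp_cmult[symmetric] power_mult_distrib[symmetric]
      using c(3)[OF W_carrier] entry_norm_nonneg by (intro path_exp_mono[OF transition j] power_mono) auto
    then have "a k s \<le> (\<Sum>j<N. P $$ (s, j) * (c ^ p * path_exp N P k j (\<lambda>w _. mnorm (W w) ^ p)))"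
      unfolding a_def using P0[OF s] by (intro sum_mono mult_left_mono) auto
    then show ?thesis by (simp add: b_def sum_distrib_left mult_ac)
  qed
  have cp: "0 \<le> c ^ p" using c(1) by simp
  have submult: "\<exists>K>0. \<forall>k l. b (k + l) s \<le> K * b k s * b l s" if s: "s < N" for s
  proof -
    have V: "finite V" "V \<subseteq> carrier_vec d" "0 \<le> C" using dom by (auto simp: dominating_functional_def)
    define n where "n = N * d ^ p"
    \<comment> \<open>The initial vector of this orbit mixes the states after the first transition.\<close>
    define u where "u k = vec n (\<lambda>r. \<Sum>j<N. P $$ (s, j) * (\<Sum>v\<in>V. lifted.state_moment k j (kron_pow_vec v p) $ r))" for k
    have u: "u k \<in> carrier_vec n" for k by (simp add: u_def)
    have T: "lifted.T \<in> carrier_mat n n" using lifted.T_carrier by (simp add: n_def)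
    have step: "u (Suc k) = lifted.T *\<^sub>v u k" for k
    proof (rule eq_vecI)
      fix r assume "r < dim_vec (lifted.T *\<^sub>v u k)"
      then have r: "r < n" using T by simp
      have Tsm: "(\<Sum>q<n. lifted.T $$ (r, q) * lifted.state_moment k j (kron_pow_vec v p) $ q)
          = lifted.state_moment (Suc k) j (kron_pow_vec v p) $ r" if "v \<in> V" "j < N" for v j
      proof -
        have "kron_pow_vec v p \<in> carrier_vec (d ^ p)" using V that by (intro kron_pow_vec_carrier) auto
        from lifted.T_state_moment[OF \<open>j < N\<close> this, of k] show ?thesis
          using mult_mat_vec_index[OF T, of "lifted.state_moment k j (kron_pow_vec v p)" r]
            lifted.state_moment_carrier r by (simp add: n_def)
      qed
      have "(lifted.T *\<^sub>v u k) $ r = (\<Sum>q<n. lifted.T $$ (r, q) *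
          (\<Sum>j<N. P $$ (s, j) * (\<Sum>v\<in>V. lifted.state_moment k j (kron_pow_vec v p) $ q)))"
        unfolding mult_mat_vec_index[OF T u r] by (intro sum.cong) (auto simp: u_def)
      also have "\<dots> = (\<Sum>j<N. P $$ (s, j) * (\<Sum>v\<in>V. \<Sum>q<n. lifted.T $$ (r, q) *
          lifted.state_moment k j (kron_pow_vec v p) $ q))"
        unfolding sum_distrib_left
        by (subst sum.swap, intro sum.cong refl, subst sum.swap, intro sum.cong refl) (simp add: mult_ac)
      also have "\<dots> = u (Suc k) $ r" using r Tsm by (simp add: u_def)
      finally show "u (Suc k) $ r = (lifted.T *\<^sub>v u k) $ r" ..
    qed (use T in \<open>simp add: u_def\<close>)
    obtain K where K: "0 < K" "\<And>k l. coord_norm (u (k + l)) \<le> K * coord_norm (u k) * coord_norm (u l)"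
      using linear_orbit_submultiplicative[of lifted.T n u, OF T u step] by blast
    define H where "H = real n * (\<Sum>v\<in>V. coord_norm v ^ p)"
    have H0: "0 \<le> H" unfolding H_def by (intro mult_nonneg_nonneg sum_nonneg) (auto simp: coord_norm_nonneg)
    have ua: "coord_norm (u k) \<le> H * a k s" for k
    proof -
      have "\<bar>u k $ r\<bar> \<le> (\<Sum>v\<in>V. coord_norm v ^ p) * a k s" if r: "r < n" for r
      proof -
        have "\<bar>u k $ r\<bar> \<le> (\<Sum>j<N. \<bar>P $$ (s, j) * (\<Sum>v\<in>V. lifted.state_moment k j (kron_pow_vec v p) $ r)\<bar>)"
          using r by (simp add: u_def sum_abs)
        also have "\<dots> \<le> (\<Sum>j<N. P $$ (s, j) * (\<Sum>v\<in>V. coord_norm v ^ p * growth k j))"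
        proof (intro sum_mono)
          fix j assume "j \<in> {..<N}"
          then have j: "j < N" by simp
          have "\<bar>\<Sum>v\<in>V. lifted.state_moment k j (kron_pow_vec v p) $ r\<bar> \<le> (\<Sum>v\<in>V. coord_norm v ^ p * growth k j)"
            using V r state_moment_le[OF j] by (intro order_trans[OF sum_abs] sum_mono) (auto simp: n_def)
          then show "\<bar>P $$ (s, j) * (\<Sum>v\<in>V. lifted.state_moment k j (kron_pow_vec v p) $ r)\<bar>
              \<le> P $$ (s, j) * (\<Sum>v\<in>V. coord_norm v ^ p * growth k j)"
            using P0[OF s j] by (simp add: abs_mult mult_left_mono)
        qed
        also have "\<dots> = (\<Sum>v\<in>V. coord_norm v ^ p) * a k s"
          by (simp add: a_def sum_distrib_right[symmetric] sum_distrib_left mult_ac)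
        finally show ?thesis .
      qed
      then have "(\<Sum>r<n. \<bar>u k $ r\<bar>) \<le> (\<Sum>r<n. (\<Sum>v\<in>V. coord_norm v ^ p) * a k s)" by (intro sum_mono) auto
      then show ?thesis by (simp add: coord_norm_def u_def H_def mult.assoc)
    qed
    define G where "G = (\<Sum>q<d ^ p. \<bar>F q\<bar>)"
    have G0: "0 \<le> G" unfolding G_def by (intro sum_nonneg) auto
    have au: "a k s \<le> C * G * coord_norm (u k)" for k
    proof -
      have "a k s \<le> (\<Sum>j<N. P $$ (s, j) * (C * (\<Sum>v\<in>V. \<Sum>q<d ^ p. F q * tensor_moment k j v $ q)))"
        unfolding a_def using P0[OF s] growth_le_functional[OF dom] by (intro sum_mono mult_left_mono) auto
      also have "\<dots> = (\<Sum>j<N. P $$ (s, j) * (C * (\<Sum>v\<in>V. \<Sum>q<d ^ p. F q *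
          (\<Sum>i<N. lifted.state_moment k j (kron_pow_vec v p) $ (i * d ^ p + q)))))"
        using V tensor_moment_sum by (intro sum.cong refl arg_cong2[where f = "(*)"]) auto
      also have "\<dots> = C * (\<Sum>j<N. \<Sum>v\<in>V. \<Sum>q<d ^ p. \<Sum>i<N.
          F q * (P $$ (s, j) * lifted.state_moment k j (kron_pow_vec v p) $ (i * d ^ p + q)))"
        by (simp add: sum_distrib_left mult_ac)
      also have "\<dots> = C * (\<Sum>q<d ^ p. \<Sum>i<N. \<Sum>j<N. \<Sum>v\<in>V.
          F q * (P $$ (s, j) * lifted.state_moment k j (kron_pow_vec v p) $ (i * d ^ p + q)))"
        by (intro arg_cong[where f = "(*) C"] sum_swap_pairs)
      also have "\<dots> = C * (\<Sum>q<d ^ p. \<Sum>i<N. F q * u k $ (i * d ^ p + q))"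
        using block_index_less by (simp add: u_def n_def sum_distrib_left)
      also have "\<dots> \<le> C * (\<Sum>q<d ^ p. \<bar>F q\<bar> * coord_norm (u k))"
      proof (intro mult_left_mono sum_mono)
        fix q assume q: "q \<in> {..<d ^ p}"
        have "(\<Sum>i<N. F q * u k $ (i * d ^ p + q)) \<le> \<bar>F q\<bar> * (\<Sum>i<N. \<bar>u k $ (i * d ^ p + q)\<bar>)"
          unfolding sum_distrib_left by (intro sum_mono) (simp add: abs_mult[symmetric])
        also have "(\<Sum>i<N. \<bar>u k $ (i * d ^ p + q)\<bar>) \<le> (\<Sum>i<N. \<Sum>q<d ^ p. \<bar>u k $ (i * d ^ p + q)\<bar>)"
          using q by (intro sum_mono member_le_sum[of q _ "\<lambda>q. \<bar>u k $ (_ * d ^ p + q)\<bar>"]) auto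
        also have "\<dots> = coord_norm (u k)"
          using carrier_vecD[OF u[of k]] by (simp add: coord_norm_def n_def sum_blocks)
        finally show "(\<Sum>i<N. F q * u k $ (i * d ^ p + q)) \<le> \<bar>F q\<bar> * coord_norm (u k)"
          by (simp add: mult_left_mono)
      qed (use V in simp)
      finally show ?thesis by (simp add: G_def sum_distrib_right mult.assoc)
    qed
    have bu: "b k s \<le> (c ^ p * (C * G)) * coord_norm (u k)" for k
      using order_trans[OF ba[OF s] mult_left_mono[OF au[of k]]] c(1) by (simp add: mult.assoc)
    have ub: "coord_norm (u k) \<le> (H * c ^ p) * b k s" for k
      using order_trans[OF ua mult_left_mono[OF ab[OF s, of k] H0]] by (simp add: mult.assoc)
    define L where "L = (c ^ p * (C * G)) * K * (H * c ^ p) ^ 2"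
    have L0: "0 \<le> L" using c(1) V(3) G0 K(1) by (simp add: L_def)
    have "b (k + l) s \<le> (L + 1) * b k s * b l s" for k l
    proof -
      have "b (k + l) s \<le> L * b k s * b l s"
        unfolding L_def using c(1) V(3) G0 K bu ub
        by (intro submultiplicative_comparable[of _ _ "\<lambda>k. coord_norm (u k)"]) (auto simp: coord_norm_nonneg less_imp_le)
      moreover have "0 \<le> b k s * b l s" using b0[OF s] by simp
      ultimately show ?thesis by (simp add: distrib_right mult.assoc)
    qed
    then show ?thesis using L0 by (intro exI[of _ "L + 1"]) auto
  qed
  have "(\<forall>s<N. lim (\<lambda>k. b k s powr (1 / (real p * real k))) < 1) \<longleftrightarrow> exp_decay N b"
  proof -
    have "lim (\<lambda>k. b k s powr (1 / (real p * real k))) < 1 \<longleftrightarrow>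
        (\<exists>C>0. \<exists>\<beta>>0. \<forall>k. b k s \<le> C * exp (- \<beta> * real k))" if s: "s < N" for s
    proof -
      obtain K where "0 < K" "\<And>k l. b (k + l) s \<le> K * b k s * b l s" using submult[OF s] by blast
      then show ?thesis by (intro root_limit_less_1_iff[OF p b0[OF s]])
    qed
    then show ?thesis unfolding exp_decay_pointwise by blast
  qed
  also have "exp_decay N b \<longleftrightarrow> exp_decay N growth"
  proof
    assume "exp_decay N b"
    then have "exp_decay N a" by (rule exp_decay_bound[OF _ cp ab])
    define m where "m = (\<Sum>s<N. entry_norm (M s) ^ p)"
    have m: "entry_norm (M s) ^ p \<le> m" if "s < N" for s
      unfolding m_def using that by (intro member_le_sum) (auto simp: entry_norm_nonneg)
    have m_nonneg: "0 \<le> m" unfolding m_def by (intro sum_nonneg) (simp add: entry_norm_nonneg)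
    have "growth (Suc k) s \<le> m * a k s" if s: "s < N" for k s
    proof -
      have "growth (Suc k) s = (\<Sum>j<N. P $$ (s, j) * path_exp N P k j (\<lambda>w _. entry_norm (W w * M s) ^ p))"
        by (simp add: growth_def)
      also have "\<dots> \<le> (\<Sum>j<N. P $$ (s, j) * (m * growth k j))"
      proof (intro sum_mono mult_left_mono)
        fix j assume "j \<in> {..<N}"
        then have j: "j < N" by simp
        show "path_exp N P k j (\<lambda>w _. entry_norm (W w * M s) ^ p) \<le> m * growth k j"
          unfolding growth_def path_exp_cmult[symmetric]
        proof (rule path_exp_mono[OF transition j])
          fix w assume w: "set w \<subseteq> {..<N}"
          have "entry_norm (W w * M s) ^ p \<le> (entry_norm (W w) * entry_norm (M s)) ^ p"
            using entry_norm_mult[OF W_carrier[OF w] M[OF s]] by (intro power_mono entry_norm_nonneg)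
          also have "\<dots> \<le> m * entry_norm (W w) ^ p"
            using m[OF s] by (simp add: power_mult_distrib mult.commute mult_right_mono entry_norm_nonneg)
          finally show "entry_norm (W w * M s) ^ p \<le> m * entry_norm (W w) ^ p" .
        qed
        show "0 \<le> P $$ (s, j)" by (rule P0[OF s j])
      qed
      also have "\<dots> = m * a k s" by (simp add: a_def sum_distrib_left mult_ac)
      finally show ?thesis .
    qed
    then show "exp_decay N growth" by (rule exp_decay_shift[OF \<open>exp_decay N a\<close> m_nonneg])
  next
    assume "exp_decay N growth"
    then obtain D \<beta> where D: "0 < D" "0 < \<beta>" "\<And>k s. s < N \<Longrightarrow> growth k s \<le> D * exp (- \<beta> * real k)"
      unfolding exp_decay_def by blast
    have "a k s \<le> D * exp (- \<beta> * real k)" if s: "s < N" for k s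
    proof -
      have "a k s \<le> (\<Sum>j<N. P $$ (s, j) * (D * exp (- \<beta> * real k)))"
        unfolding a_def using P0[OF s] D(3) by (intro sum_mono mult_left_mono) auto
      then show ?thesis using P1[OF s] by (simp add: sum_distrib_right[symmetric])
    qed
    then have "exp_decay N a" unfolding exp_decay_def using D(1,2) by blast
    then show "exp_decay N b" by (rule exp_decay_bound[OF _ cp ba])
  qed
  finally show ?thesis unfolding b_def .
qed

lemma integral_trajectory:
  fixes \<phi> :: "real vec \<Rightarrow> real"
  assumes mc: "markov_chain N P s \<Omega> \<sigma>" and x: "x \<in> carrier_vec d"
  shows "(LINT \<omega>|\<Omega>. \<phi> (trajectory M \<sigma> x k \<omega>)) = path_exp N P k s (\<lambda>w _. \<phi> (W w *\<^sub>v x))"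
proof -
  have "(LINT \<omega>|\<Omega>. \<phi> (trajectory M \<sigma> x k \<omega>))
      = (LINT \<omega>|\<Omega>. \<phi> (W (map (\<lambda>l. \<sigma> l \<omega>) [0..<k]) *\<^sub>v x))"
    using trajectory_word_prod[of N M d \<sigma> _ x k, OF M markov_chain_state[OF mc] x]
    by (intro Bochner_Integration.integral_cong) auto
  then show ?thesis using markov_integral[OF mc, of "\<lambda>w _. \<phi> (W w *\<^sub>v x)" k] by simp
qed

text \<open>The product omits the initial state: it is the word of \<open>k + 1\<close> states without its first letter.\<close>

lemma integral_switched_prod:
  fixes \<phi> :: "real mat \<Rightarrow> real"
  assumes mc: "markov_chain N P s \<Omega> \<sigma>"
  shows "(LINT \<omega>|\<Omega>. \<phi> (switched_prod d M \<sigma> k \<omega>))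
    = (\<Sum>j<N. P $$ (s, j) * path_exp N P k j (\<lambda>w _. \<phi> (W w)))"
proof -
  have "(LINT \<omega>|\<Omega>. \<phi> (switched_prod d M \<sigma> k \<omega>))
      = (LINT \<omega>|\<Omega>. \<phi> (W (tl (map (\<lambda>l. \<sigma> l \<omega>) [0..<Suc k]))))"
    using switched_prod_word_prod[of N M d \<sigma> _ k, OF M markov_chain_state[OF mc]]
    by (intro Bochner_Integration.integral_cong) (auto simp del: upt_Suc)
  also have "\<dots> = path_exp N P (Suc k) s (\<lambda>w _. \<phi> (W (tl w)))"
    by (rule markov_integral[OF mc])
  finally show ?thesis by simp
qed

end

theorem theoremV1:
  fixes p d N :: nat
    and M :: "nat \<Rightarrow> real mat"
    and P :: "real mat"
    and \<Omega> :: "nat \<Rightarrow> 'w measure"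
    and \<sigma> :: "nat \<Rightarrow> nat \<Rightarrow> 'w \<Rightarrow> nat"
    and vnorm tnorm :: "real vec \<Rightarrow> real"
    and mnorm :: "real mat \<Rightarrow> real"
  assumes "0 < d" and "0 < N"
    and "\<forall>i < N. M i \<in> carrier_mat d d"
    and "transition_matrix N P"
    and "\<forall>s < N. markov_chain N P s (\<Omega> s) (\<sigma> s)"
    and "is_vec_norm d vnorm" and "is_vec_norm (d ^ p) tnorm" and "is_mat_norm d mnorm"
    and "p = 2 \<or> (p = 1 \<and> (\<exists>K. proper_cone d K \<and> leaves_invariant (M ` {..<N}) K))"
  shows "((\<forall>s < N. Lp_joint_spectral_radius p mnorm d M (\<Omega> s) (\<sigma> s) < 1)
            \<longleftrightarrow> mean_stable p vnorm d N M \<Omega> \<sigma>)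
       \<and> (mean_stable p vnorm d N M \<Omega> \<sigma>
            \<longleftrightarrow> moment_stable p vnorm tnorm d N M \<Omega> \<sigma>)
       \<and> (moment_stable p vnorm tnorm d N M \<Omega> \<sigma>
            \<longleftrightarrow> real_spectral_radius (transfer_matrix p d N P M) < 1)"
proof -
  interpret switched_system p d N P M
    using assms by unfold_locales auto
  have mc: "markov_chain N P s (\<Omega> s) (\<sigma> s)" if "s < N" for s using assms(5) that by blast
  obtain F V C where dom: "dominating_functional F V C"
  proof (cases "p = 2")
    case True
    have "dominating_functional (\<lambda>a. if a div d = a mod d then 1 else 0) (unit_vec d ` {..<d}) (real (d * d) ^ 2)"
      unfolding dominating_functional_def unfolding True
      using trace_dominates_entry_norm[OF W_carrier] by (auto simp del: of_nat_mult)
    then show ?thesis by (rule that)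
  next
    case False
    then have p1: "p = 1" and "\<exists>K. proper_cone d K \<and> leaves_invariant (M ` {..<N}) K"
      using assms(9) by auto
    then obtain K where "proper_cone d K" "leaves_invariant (M ` {..<N}) K" by blast
    from cone_functional_dominates_entry_norm[OF M this] obtain F V C where FVC: "finite V" "V \<subseteq> carrier_vec d" "0 \<le> C"
      "\<forall>w. set w \<subseteq> {..<N} \<longrightarrow> entry_norm (W w) \<le> C * (\<Sum>v\<in>V. \<Sum>a<d. F a * (W w *\<^sub>v v) $ a)"
      by blast
    then have "dominating_functional F V C"
      unfolding dominating_functional_def unfolding p1 kron_pow_vec_1 by simp
    then show ?thesis by (rule that)
  qed
  have radius: "(\<forall>s < N. Lp_joint_spectral_radius p mnorm d M (\<Omega> s) (\<sigma> s) < 1) \<longleftrightarrow> exp_decay N growth"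
    unfolding jsr_less_1_iff_growth_decay[OF assms(8) dom, symmetric] Lp_joint_spectral_radius_def
    using integral_switched_prod[OF mc, of _ "\<lambda>X. mnorm X ^ p"] by simp
  have mean: "mean_stable p vnorm d N M \<Omega> \<sigma> \<longleftrightarrow> exp_decay N growth"
    unfolding mean_decay_iff_growth_decay[OF assms(6), symmetric] mean_stable_def
    using integral_trajectory[OF mc, of _ _ "\<lambda>x. vnorm x ^ p"] by simp
  have "expectation_vec (d ^ p) (\<Omega> s) (\<lambda>\<omega>. kron_pow_vec (trajectory M (\<sigma> s) x k \<omega>) p) = tensor_moment k s x"
    if "s < N" "x \<in> carrier_vec d" for s x k
    unfolding expectation_vec_def tensor_moment_def
    using integral_trajectory[OF mc[OF that(1)] that(2), of "\<lambda>y. kron_pow_vec y p $ _"] by simp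
  then have moment: "moment_stable p vnorm tnorm d N M \<Omega> \<sigma> \<longleftrightarrow> exp_decay N growth"
    unfolding moment_decay_iff_growth_decay[OF assms(6,7) dom, symmetric] moment_stable_def by simp
  have transfer: "real_spectral_radius (transfer_matrix p d N P M) < 1 \<longleftrightarrow> exp_decay N growth"
    using radius_less_1_iff_growth_decay[OF dom] by (simp add: transfer_matrix_def block_transfer_def)
  show ?thesis unfolding radius mean moment transfer by simp
qed

end
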